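(* Let $\nu,\mu\in\mathbb{C}$ with $\nu+\mu\notin-\mathbb{N}_0$ and $2\nu\notin\mathbb{Z}$. If $\pm\operatorname{Im}x>0$ (upper signs throughout when $\operatorname{Im}x>0$, lower signs throughout when $\operatorname{Im}x<0$), then $$\mathsf{Q}_\nu^\mu(x)=2^\nu\left(\cos(\pi\mu)\mp i\frac{\sin(\pi(\mu-\nu))}{2\cos(\pi\nu)}\right)\frac{\Gamma(\nu+1)\Gamma(\nu+\mu+1)}{\Gamma(2\nu+2)}(1+x)^{-1+\frac12\mu-\nu}(1-x)^{-\frac12\mu}{}_2F_1\!\left(\nu-\mu+1,\nu+1;2\nu+2;\frac{2}{1+x}\right)$$ $$\pm\, i\pi\,2^{-\nu-2}\sec(\pi\nu)\frac{\Gamma(-\nu)}{\Gamma(-2\nu)\Gamma(\nu-\mu+1)}(1+x)^{\nu+\frac12\mu}(1-x)^{-\frac12\mu}{}_2F_1\!\left(-\nu,-\nu-\mu;-2\nu;\frac{2}{1+x}\right).$$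
   Context: $\mathbb{N}=\{1,2,3,\dots\}$, $-\mathbb{N}=\{-1,-2,\dots\}$, $-\mathbb{N}_0=\{0,-1,-2,\dots\}$. $D_1=\mathbb{C}\setminus((-\infty,-1]\cup[1,\infty))$, $D_2=\mathbb{C}\setminus(-\infty,1]$. Complex powers are principal values. ${}_2F_1(a,b;c;w)$ is the Gauss hypergeometric function, principal branch on $\mathbb{C}\setminus[1,\infty)$ (the analytic continuation of $\sum_{n\ge0}\frac{(a)_n(b)_n}{(c)_n}\frac{w^n}{n!}$). $1/\Gamma$ is read as the entire function (zero at the poles of $\Gamma$). Associated Legendre function of the second kind: for $z\in D_2$, $\nu+\mu\in\mathbb{C}\setminus-\mathbb{N}$, $$Q_\nu^\mu(z)=\frac{\sqrt{\pi}\,e^{i\pi\mu}\Gamma(\nu+\mu+1)(z^2-1)^{\frac12\mu}}{2^{\nu+1}\Gamma(\nu+\frac32)z^{\nu+\mu+1}}\,{}_2F_1\!\left(\tfrac{\nu+\mu+2}{2},\tfrac{\nu+\mu+1}{2};\nu+\tfrac32;\tfrac1{z^2}\right),$$ where $(z^2-1)^\alpha:=(z+1)^\alpha(z-1)^\alpha$. Ferrers function of the second kind: for $x\in(-1,1)$, $$\mathsf{Q}_\nu^\mu(x)=\tfrac12\big[e^{-\frac12 i\pi\mu}\,e^{-i\pi\mu}Q_\nu^\mu(x+i0)+e^{\frac12 i\pi\mu}\,e^{-i\pi\mu}Q_\nu^\mu(x-i0)\big],$$ where $x\pm i0$ denotes the limit from the upper/lower half-plane, and $\mathsf{Q}_\nu^\mu$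 is extended analytically to $D_1$. *)

theory Defs
  imports "HOL-Complex_Analysis.Complex_Analysis"
begin

text \<open>
  The holomorphic extension to \<open>D\<close> of a function given on \<open>S\<close>. Only its values on \<open>D\<close> are
  meaningful; there it is unique as soon as \<open>D\<close> is open and connected and \<open>S\<close> accumulates
  in \<open>D\<close> (lemma \<open>holomorphic_extension_unique\<close>).
\<close>

definition holomorphic_extension ::
    "complex set \<Rightarrow> complex set \<Rightarrow> (complex \<Rightarrow> complex) \<Rightarrow> complex \<Rightarrow> complex" where
  "holomorphic_extension D S f =
     (SOME g. g holomorphic_on D \<and> (\<forall>w\<in>S. g w = f w))"

lemma holomorphic_extension_unique:
  assumes "open D" "connected D" "S \<subseteq> D" "\<xi> \<in> D" "\<xi> islimpt S"
    and g: "g holomorphic_on D" "\<And>w. w \<in> S \<Longrightarrow> g w = f w"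
    and z: "z \<in> D"
  shows "holomorphic_extension D S f z = g z"
proof -
  let ?h = "holomorphic_extension D S f"
  have h: "?h holomorphic_on D \<and> (\<forall>w\<in>S. ?h w = f w)"
    unfolding holomorphic_extension_def
    by (rule someI [where x = g]) (use g in auto)
  have "(\<lambda>w. ?h w - g w) holomorphic_on D"
    using h g by (intro holomorphic_intros) auto
  then have "?h z - g z = 0"
    by (rule analytic_continuation [where U = S and \<xi> = \<xi>]) (use assms h in auto)
  then show ?thesis by simp
qed

definition hyp2F1_series :: "complex \<Rightarrow> complex \<Rightarrow> complex \<Rightarrow> complex \<Rightarrow> complex" where
  "hyp2F1_series a b c w =
     (\<Sum>n. pochhammer a n * pochhammer b n / pochhammer c n * (w ^ n / fact n))"

definition hyp2F1 :: "complex \<Rightarrow> complex \<Rightarrow> complex \<Rightarrow> complex \<Rightarrow> complex" where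
  "hyp2F1 a b c =
     holomorphic_extension (- complex_of_real ` {1..}) (ball 0 1) (hyp2F1_series a b c)"

text \<open>
  Intended for \<open>z\<close> off the cut \<open>(-\<infinity>, 1]\<close> and \<open>\<nu> + \<mu>\<close> not a negative integer. The power
  \<open>(z\<^sup>2 - 1)\<^bsup>\<mu>/2\<^esup>\<close> is read as \<open>(z + 1)\<^bsup>\<mu>/2\<^esup> (z - 1)\<^bsup>\<mu>/2\<^esup>\<close>.
\<close>

definition legendre_Q :: "complex \<Rightarrow> complex \<Rightarrow> complex \<Rightarrow> complex" where
  "legendre_Q \<nu> \<mu> z =
     complex_of_real (sqrt pi) * exp (\<i> * of_real pi * \<mu>) * Gamma (\<nu> + \<mu> + 1)
       * ((z + 1) powr (\<mu> / 2) * (z - 1) powr (\<mu> / 2))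
       / (2 powr (\<nu> + 1) * z powr (\<nu> + \<mu> + 1))
       * rGamma (\<nu> + 3 / 2)
       * hyp2F1 ((\<nu> + \<mu> + 2) / 2) ((\<nu> + \<mu> + 1) / 2) (\<nu> + 3 / 2) (1 / z\<^sup>2)"

definition legendre_Q_above :: "complex \<Rightarrow> complex \<Rightarrow> complex \<Rightarrow> complex" where
  "legendre_Q_above \<nu> \<mu> x = Lim (at x within {z. Im z > 0}) (legendre_Q \<nu> \<mu>)"

definition legendre_Q_below :: "complex \<Rightarrow> complex \<Rightarrow> complex \<Rightarrow> complex" where
  "legendre_Q_below \<nu> \<mu> x = Lim (at x within {z. Im z < 0}) (legendre_Q \<nu> \<mu>)"

definition ferrers_Q_real :: "complex \<Rightarrow> complex \<Rightarrow> complex \<Rightarrow> complex" where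
  "ferrers_Q_real \<nu> \<mu> x =
     1 / 2 * (exp (- (\<i> * of_real pi * \<mu> / 2)) * exp (- (\<i> * of_real pi * \<mu>)) * legendre_Q_above \<nu> \<mu> x
            + exp (\<i> * of_real pi * \<mu> / 2) * exp (- (\<i> * of_real pi * \<mu>)) * legendre_Q_below \<nu> \<mu> x)"

definition ferrers_Q :: "complex \<Rightarrow> complex \<Rightarrow> complex \<Rightarrow> complex" where
  "ferrers_Q \<nu> \<mu> =
     holomorphic_extension (- complex_of_real ` ({..-1} \<union> {1..}))
       (complex_of_real ` {-1<..<1}) (ferrers_Q_real \<nu> \<mu>)"

end

theory Submission
  imports Defs
begin

text \<open>
  Everything is reduced to the behaviour at \<open>z = 0\<close>. Under \<open>w = 4\<rho> / (1 + \<rho>)\<^sup>2\<close> the hypergeometric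
  equation has no singularity in the punctured unit disc, so a power series in \<open>\<rho>\<close> continues
  \<open>\<^sub>2F\<^sub>1\<close> to the whole cut plane; the Euler, Pfaff and quadratic transformations then follow from the
  uniqueness of the solution that is regular at \<open>0\<close> with value \<open>1\<close>.

  Pfaff's transformation turns the series of \<open>Q\<close> in \<open>1/z\<^sup>2\<close> into one in \<open>1/(1 - z\<^sup>2)\<close> with exponent
  difference \<open>c - a - b = 1/2\<close> at \<open>1\<close>, whatever \<open>\<mu>\<close> and \<open>\<nu>\<close> are. The connection formula for this
  non-degenerate case, a consequence of Gauss's theorem, writes \<open>Q\<close> on either half-plane as a combination of
  an even and an odd function holomorphic on \<open>D\<^sub>1\<close>, hence also \<open>the Ferrers function\<close> on all of \<open>D\<^sub>1\<close>. Both functions are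
  invariant under \<open>\<nu> \<mapsto> - \<nu> - 1\<close>, and by the quadratic transformation the two hypergeometric terms of
  the claim are \<open>Q\<close> with parameters \<open>\<nu>\<close> and \<open>- \<nu> - 1\<close>. It remains to compare the even and the odd
  coefficients, which is done with the reflection and duplication formulas of \<open>\<Gamma>\<close>.
\<close>

section \<open>The hypergeometric equation\<close>

text \<open>\<open>hyp2F1\<close> and the Ferrers function are introduced by choice of a holomorphic
  extension, so nothing can be said about them off the original set before an extension has been
  exhibited. This forces the construction of an explicit solution on the cut plane; after that each
  transformation amounts to three identities between coefficients and one value at 0.

  The boundary values of Q on (-1,1) cannot be read off its definition, since 1/z^2 then meets the
  cut or is infinite. In the even/odd basis the expressions for both half-planes are holomorphic
  across the interval, and the limits become evaluations.

  The condition that 2\<nu> is not an integer enters twice: it makes the lower parameters \<nu> +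
  3/2 and 2\<nu> + 2 and their images under \<nu> \<mapsto> -\<nu> - 1 admissible, and it makes
  cos(\<pi>\<nu>) nonzero. Reciprocal Gamma factors are kept wherever possible, so that poles of the
  individual Gamma functions need no separate treatment.\<close>

abbreviation cut_plane :: "complex set" where
  "cut_plane \<equiv> - complex_of_real ` {1..}"

text \<open>The factor \<open>P\<close> enters through its logarithmic derivative \<open>l\<close>,
  so that it factors out of both derivatives and drops out of every later condition.\<close>

lemma pullback_derivs:
  fixes F P \<phi> l :: "complex \<Rightarrow> complex"
  assumes S: "open S" and T: "open T" and F: "F holomorphic_on T"
    and \<phi>: "\<And>z. z \<in> S \<Longrightarrow> \<phi> z \<in> T"
    and dP: "\<And>z. z \<in> S \<Longrightarrow> (P has_field_derivative l z * P z) (at z)"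
    and dl: "\<And>z. z \<in> S \<Longrightarrow> (l has_field_derivative l' z) (at z)"
    and d\<phi>: "\<And>z. z \<in> S \<Longrightarrow> (\<phi> has_field_derivative \<phi>1 z) (at z)"
    and d\<phi>1: "\<And>z. z \<in> S \<Longrightarrow> (\<phi>1 has_field_derivative \<phi>2 z) (at z)"
    and z: "z \<in> S"
  shows "((\<lambda>z. P z * F (\<phi> z)) has_field_derivative
             P z * (l z * F (\<phi> z) + \<phi>1 z * deriv F (\<phi> z))) (at z)"
    and "deriv (deriv (\<lambda>z. P z * F (\<phi> z))) z =
           P z * (((l z)\<^sup>2 + l' z) * F (\<phi> z)
                  + (2 * l z * \<phi>1 z + \<phi>2 z) * deriv F (\<phi> z)
                  + (\<phi>1 z)\<^sup>2 * deriv (deriv F) (\<phi> z))"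
proof -
  have dF: "(F has_field_derivative deriv F w) (at w)" if "w \<in> T" for w
    using F T that holomorphic_derivI by blast
  have ddF: "(deriv F has_field_derivative deriv (deriv F) w) (at w)" if "w \<in> T" for w
    using holomorphic_deriv[OF F T] T that holomorphic_derivI by blast
  have dF\<phi>: "((\<lambda>z. F (\<phi> z)) has_field_derivative deriv F (\<phi> z) * \<phi>1 z) (at z)" if "z \<in> S" for z
    using DERIV_chain2[OF dF[OF \<phi>[OF that]] d\<phi>[OF that]] .
  have ddF\<phi>: "((\<lambda>z. deriv F (\<phi> z)) has_field_derivative deriv (deriv F) (\<phi> z) * \<phi>1 z) (at z)"
    if "z \<in> S" for z
    using DERIV_chain2[OF ddF[OF \<phi>[OF that]] d\<phi>[OF that]] .
  have 1: "((\<lambda>z. P z * F (\<phi> z)) has_field_derivative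
             P z * (l z * F (\<phi> z) + \<phi>1 z * deriv F (\<phi> z))) (at z)" if "z \<in> S" for z
    by (rule derivative_eq_intros refl dP[OF that] dF\<phi>[OF that])+ (simp add: algebra_simps)
  then show "((\<lambda>z. P z * F (\<phi> z)) has_field_derivative
             P z * (l z * F (\<phi> z) + \<phi>1 z * deriv F (\<phi> z))) (at z)"
    using z by blast
  have "((\<lambda>z. P z * (l z * F (\<phi> z) + \<phi>1 z * deriv F (\<phi> z))) has_field_derivative
          P z * (((l z)\<^sup>2 + l' z) * F (\<phi> z)
                  + (2 * l z * \<phi>1 z + \<phi>2 z) * deriv F (\<phi> z)
                  + (\<phi>1 z)\<^sup>2 * deriv (deriv F) (\<phi> z))) (at z)"
    by (rule derivative_eq_intros refl dP[OF z] dF\<phi>[OF z] ddF\<phi>[OF z] dl[OF z] d\<phi>1[OF z])+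
       (simp add: algebra_simps power2_eq_square)
  moreover have "eventually (\<lambda>w. P w * (l w * F (\<phi> w) + \<phi>1 w * deriv F (\<phi> w))
      = deriv (\<lambda>z. P z * F (\<phi> z)) w) (nhds z)"
    using eventually_nhds_in_open[OF S z] by eventually_elim (simp add: DERIV_imp_deriv[OF 1])
  ultimately show "deriv (deriv (\<lambda>z. P z * F (\<phi> z))) z =
           P z * (((l z)\<^sup>2 + l' z) * F (\<phi> z)
                  + (2 * l z * \<phi>1 z + \<phi>2 z) * deriv F (\<phi> z)
                  + (\<phi>1 z)\<^sup>2 * deriv (deriv F) (\<phi> z))"
    by (simp add: DERIV_cong_ev[OF refl _ refl] DERIV_imp_deriv)
qed

text \<open>Matching the coefficients of \<open>F\<close>, its first and its second derivative with
  the old equation up to a common factor \<open>\<kappa>\<close> leaves three identities free of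
  \<open>F\<close> and \<open>P\<close>. The coefficients \<open>p\<close>, \<open>r\<close>,
  \<open>q\<close> of the new equation are numbers because the argument is pointwise in
  \<open>z\<close>.\<close>

lemma pullback_ode:
  fixes F P \<phi> l :: "complex \<Rightarrow> complex"
  assumes S: "open S" and T: "open T" and F: "F holomorphic_on T"
    and \<phi>: "\<And>z. z \<in> S \<Longrightarrow> \<phi> z \<in> T"
    and dP: "\<And>z. z \<in> S \<Longrightarrow> (P has_field_derivative l z * P z) (at z)"
    and dl: "\<And>z. z \<in> S \<Longrightarrow> (l has_field_derivative l' z) (at z)"
    and d\<phi>: "\<And>z. z \<in> S \<Longrightarrow> (\<phi> has_field_derivative \<phi>1 z) (at z)"
    and d\<phi>1: "\<And>z. z \<in> S \<Longrightarrow> (\<phi>1 has_field_derivative \<phi>2 z) (at z)"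
    and ode: "\<And>w. w \<in> T \<Longrightarrow> A w * deriv (deriv F) w + B w * deriv F w + C w * F w = 0"
    and z: "z \<in> S"
    and A: "p * (\<phi>1 z)\<^sup>2 = \<kappa> * A (\<phi> z)"
    and B: "p * (2 * l z * \<phi>1 z + \<phi>2 z) + r * \<phi>1 z = \<kappa> * B (\<phi> z)"
    and C: "p * ((l z)\<^sup>2 + l' z) + r * l z + q = \<kappa> * C (\<phi> z)"
  shows "p * deriv (deriv (\<lambda>z. P z * F (\<phi> z))) z + r * deriv (\<lambda>z. P z * F (\<phi> z)) z
          + q * (P z * F (\<phi> z)) = 0"
proof -
  note d = pullback_derivs[where l = l and l' = l' and ?\<phi>1.0 = \<phi>1 and ?\<phi>2.0 = \<phi>2,
      OF S T F \<phi> dP dl d\<phi> d\<phi>1 z, simplified]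
  have "p * deriv (deriv (\<lambda>z. P z * F (\<phi> z))) z + r * deriv (\<lambda>z. P z * F (\<phi> z)) z
          + q * (P z * F (\<phi> z))
      = P z * ((p * ((l z)\<^sup>2 + l' z) + r * l z + q) * F (\<phi> z)
          + (p * (2 * l z * \<phi>1 z + \<phi>2 z) + r * \<phi>1 z) * deriv F (\<phi> z)
          + (p * (\<phi>1 z)\<^sup>2) * deriv (deriv F) (\<phi> z))"
    unfolding DERIV_imp_deriv[OF d(1)] d(2) by (simp add: algebra_simps)
  also have "\<dots> = P z * (\<kappa> * (A (\<phi> z) * deriv (deriv F) (\<phi> z)
      + B (\<phi> z) * deriv F (\<phi> z) + C (\<phi> z) * F (\<phi> z)))"
    unfolding A B C by (simp add: algebra_simps)
  also have "\<dots> = 0"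
    using ode[OF \<phi>[OF z]] by simp
  finally show ?thesis .
qed

text \<open>Holomorphy is included because on a set containing 0 it selects the regular solution.
  The last summand has the form \<open>q * f z\<close> expected by
  \<open>pullback_ode\<close>.\<close>

definition hypergeom_ode ::
    "complex \<Rightarrow> complex \<Rightarrow> complex \<Rightarrow> complex set \<Rightarrow> (complex \<Rightarrow> complex) \<Rightarrow> bool" where
  "hypergeom_ode a b c S f \<longleftrightarrow> f holomorphic_on S \<and>
     (\<forall>z\<in>S. z * (1 - z) * deriv (deriv f) z + (c - (a + b + 1) * z) * deriv f z
             + (- (a * b)) * f z = 0)"

lemma hypergeom_ode_pullback:
  fixes F P \<phi> l :: "complex \<Rightarrow> complex"
  assumes S: "open S" and T: "open T" and F: "hypergeom_ode a' b' c' T F"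
    and \<phi>: "\<And>z. z \<in> S \<Longrightarrow> \<phi> z \<in> T"
    and dP: "\<And>z. z \<in> S \<Longrightarrow> (P has_field_derivative l z * P z) (at z)"
    and dl: "\<And>z. z \<in> S \<Longrightarrow> (l has_field_derivative l' z) (at z)"
    and d\<phi>: "\<And>z. z \<in> S \<Longrightarrow> (\<phi> has_field_derivative \<phi>1 z) (at z)"
    and d\<phi>1: "\<And>z. z \<in> S \<Longrightarrow> (\<phi>1 has_field_derivative \<phi>2 z) (at z)"
    and A: "\<And>z. z \<in> S \<Longrightarrow> z * (1 - z) * (\<phi>1 z)\<^sup>2 = \<kappa> z * (\<phi> z * (1 - \<phi> z))"
    and B: "\<And>z. z \<in> S \<Longrightarrow> z * (1 - z) * (2 * l z * \<phi>1 z + \<phi>2 z) + (c - (a + b + 1) * z) * \<phi>1 z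
              = \<kappa> z * (c' - (a' + b' + 1) * \<phi> z)"
    and C: "\<And>z. z \<in> S \<Longrightarrow> z * (1 - z) * ((l z)\<^sup>2 + l' z) + (c - (a + b + 1) * z) * l z + (- (a * b))
              = \<kappa> z * (- (a' * b'))"
  shows "hypergeom_ode a b c S (\<lambda>z. P z * F (\<phi> z))"
  unfolding hypergeom_ode_def
proof (intro conjI ballI)
  have F': "F holomorphic_on T"
    using F by (simp add: hypergeom_ode_def)
  show "(\<lambda>z. P z * F (\<phi> z)) holomorphic_on S"
    using pullback_derivs(1)[where l = l and l' = l' and ?\<phi>1.0 = \<phi>1 and ?\<phi>2.0 = \<phi>2,
      OF S T F' \<phi> dP dl d\<phi> d\<phi>1] by (auto simp: holomorphic_on_open[OF S])
  fix z assume z: "z \<in> S"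
  show "z * (1 - z) * deriv (deriv (\<lambda>z. P z * F (\<phi> z))) z
      + (c - (a + b + 1) * z) * deriv (\<lambda>z. P z * F (\<phi> z)) z + - (a * b) * (P z * F (\<phi> z)) = 0"
    by (rule pullback_ode[where l = l and l' = l' and ?\<phi>1.0 = \<phi>1 and ?\<phi>2.0 = \<phi>2
          and A = "\<lambda>w. w * (1 - w)" and B = "\<lambda>w. c' - (a' + b' + 1) * w" and C = "\<lambda>w. - (a' * b')",
          OF S T F' \<phi> dP dl d\<phi> d\<phi>1 _ z A[OF z] B[OF z] C[OF z]])
       (use F in \<open>auto simp: hypergeom_ode_def\<close>)
qed

lemma hypergeom_ode_subset: "hypergeom_ode a b c T f \<Longrightarrow> S \<subseteq> T \<Longrightarrow> hypergeom_ode a b c S f"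
  unfolding hypergeom_ode_def using holomorphic_on_subset by blast

definition hyp2F1_coeff :: "complex \<Rightarrow> complex \<Rightarrow> complex \<Rightarrow> nat \<Rightarrow> complex" where
  "hyp2F1_coeff a b c n = pochhammer a n * pochhammer b n / (pochhammer c n * fact n)"

lemma hyp2F1_series_altdef: "hyp2F1_series a b c w = (\<Sum>n. hyp2F1_coeff a b c n * w ^ n)"
  by (simp add: hyp2F1_series_def hyp2F1_coeff_def)

lemma nonpos_Int_add_of_nat_neq_0: "c \<notin> \<int>\<^sub>\<le>\<^sub>0 \<Longrightarrow> c + of_nat n \<noteq> (0 :: complex)"
  by (metis add_eq_0_iff2 minus_of_nat_in_nonpos_Ints)

lemma hyp2F1_coeff_Suc:
  assumes "c \<notin> \<int>\<^sub>\<le>\<^sub>0"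
  shows "of_nat (Suc n) * (c + of_nat n) * hyp2F1_coeff a b c (Suc n)
           = (a + of_nat n) * (b + of_nat n) * hyp2F1_coeff a b c n"
  using nonpos_Int_add_of_nat_neq_0[OF assms, of n]
  by (simp add: hyp2F1_coeff_def pochhammer_Suc divide_simps del: of_nat_Suc)

text \<open>Comparing coefficients gives a two-term recurrence whose leading factor
  \<open>(n + 1) * (c + n)\<close> never vanishes, so a solution regular at 0 is determined by its
  value there. This is the uniqueness behind all transformation formulas.\<close>

lemma hypergeom_ode_fps:
  assumes c: "c \<notin> \<int>\<^sub>\<le>\<^sub>0" and f: "hypergeom_ode a b c S f" and S: "open S" "0 \<in> S"
    and f0: "f 0 = 1"
  shows "f has_fps_expansion Abs_fps (hyp2F1_coeff a b c)"
proof -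
  define F where "F = fps_expansion f 0"
  have F: "f has_fps_expansion F"
    unfolding F_def using f S by (auto simp: hypergeom_ode_def intro!: has_fps_expansion_fps_expansion)
  have "(\<lambda>z. z * (1 - z) * deriv (deriv f) z + (c - (a + b + 1) * z) * deriv f z + (- (a * b)) * f z)
     has_fps_expansion fps_X * (1 - fps_X) * fps_deriv (fps_deriv F)
       + (fps_const c - fps_const (a + b + 1) * fps_X) * fps_deriv F + fps_const (- (a * b)) * F"
    by (intro fps_expansion_intros F)
  moreover have "(\<lambda>z. z * (1 - z) * deriv (deriv f) z + (c - (a + b + 1) * z) * deriv f z + (- (a * b)) * f z)
     has_fps_expansion 0"
    unfolding has_fps_expansion_0_iff using eventually_nhds_in_open[OF S]
    by eventually_elim (use f in \<open>auto simp: hypergeom_ode_def\<close>)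
  ultimately have eq: "fps_X * (1 - fps_X) * fps_deriv (fps_deriv F)
       + (fps_const c - fps_const (a + b + 1) * fps_X) * fps_deriv F + fps_const (- (a * b)) * F = 0"
    using fps_expansion_unique_complex by blast
  have "fps_nth F n = hyp2F1_coeff a b c n" for n
  proof (induction n)
    case 0
    then show ?case
      using has_fps_expansion_imp_0_eq_fps_nth_0[OF F] f0 by (simp add: hyp2F1_coeff_def)
  next
    case (Suc n)
    have "fps_nth (fps_X * (1 - fps_X) * fps_deriv (fps_deriv F)
       + (fps_const c - fps_const (a + b + 1) * fps_X) * fps_deriv F + fps_const (- (a * b)) * F) n
      = of_nat (Suc n) * (c + of_nat n) * fps_nth F (Suc n) - (a + of_nat n) * (b + of_nat n) * fps_nth F n"
    \<comment> \<open>Low indices are separated because multiplication by \<open>fps_X\<close>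
      shifts coefficients and subtraction of indices truncates at 0.\<close>
    proof (cases n)
      case 0
      then show ?thesis by (simp add: algebra_simps)
    next
      case (Suc m)
      then show ?thesis
        by (cases m) (simp_all add: algebra_simps)
    qed
    then have "of_nat (Suc n) * (c + of_nat n) * fps_nth F (Suc n)
                 = (a + of_nat n) * (b + of_nat n) * fps_nth F n"
      unfolding eq by simp
    then have "of_nat (Suc n) * (c + of_nat n) * fps_nth F (Suc n)
                 = of_nat (Suc n) * (c + of_nat n) * hyp2F1_coeff a b c (Suc n)"
      unfolding hyp2F1_coeff_Suc[OF c] Suc.IH .
    then show ?case
      using nonpos_Int_add_of_nat_neq_0[OF c, of n] by (simp del: of_nat_Suc)
  qed
  then have "F = Abs_fps (hyp2F1_coeff a b c)"
    by (simp add: fps_eq_iff)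
  then show ?thesis using F by simp
qed

section \<open>Analytic continuation to the cut plane\<close>

text \<open>The comparison recurrence tends to \<open>h (n + 2) = h n\<close>, whose solutions are
  bounded; the perturbation allows at most growth like \<open>R ^ n\<close>, for any
  \<open>R > 1\<close>.\<close>

lemma conv_radius_ge_1_of_three_term_bound:
  fixes h :: "nat \<Rightarrow> complex"
  assumes bound: "\<And>n. norm (h (Suc (Suc n))) \<le> A n * norm (h (Suc n)) + B n * norm (h n)"
    and A: "A \<longlonglongrightarrow> 0" and B: "B \<longlonglongrightarrow> 1" and nonneg: "\<And>n. A n \<ge> 0" "\<And>n. B n \<ge> 0"
  shows "conv_radius h \<ge> 1"
proof (rule conv_radius_geI_ex)
  fix r :: real assume r: "0 < r" "ereal r < 1"
  then have r1: "r < 1" by simp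
  \<comment> \<open>A growth rate above the limiting rate 1, yet small enough for the geometric
    series with ratio \<open>R * r\<close> to converge.\<close>
  obtain R where R: "1 < R" "R * r < 1"
  proof -
    have "1 < 1 / r" using r r1 by simp
    then obtain R where "1 < R" "R < 1 / r" using dense by blast
    then show ?thesis using that r by (simp add: field_simps)
  qed
  have "(\<lambda>n. A n * R + B n) \<longlonglongrightarrow> 0 * R + 1"
    by (intro tendsto_intros A B)
  moreover have "0 * R + 1 < R\<^sup>2" using R by (simp add: power2_eq_square less_1_mult)
  ultimately have "eventually (\<lambda>n. A n * R + B n < R\<^sup>2) sequentially"
    by (rule order_tendstoD)
  then obtain N where N: "\<And>n. n \<ge> N \<Longrightarrow> A n * R + B n < R\<^sup>2"
    by (auto simp: eventually_sequentially)
  define C where "C = norm (h N) + norm (h (Suc N))"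
  have C: "C \<ge> 0" by (simp add: C_def)
  \<comment> \<open>The recurrence has three terms, so the induction carries the bound for two
    consecutive values.\<close>
  have "norm (h (N + n)) \<le> C * R ^ n \<and> norm (h (N + Suc n)) \<le> C * R ^ Suc n" for n
  proof (induction n)
    case 0
    have "C * 1 \<le> C * R" using R C by (intro mult_left_mono) auto
    then show ?case using C by (simp add: C_def) (smt (verit) norm_ge_zero)
  next
    case (Suc n)
    have "norm (h (N + Suc (Suc n))) \<le> A (N + n) * norm (h (N + Suc n)) + B (N + n) * norm (h (N + n))"
      using bound[of "N + n"] by simp
    also have "\<dots> \<le> A (N + n) * (C * R ^ Suc n) + B (N + n) * (C * R ^ n)"
      using Suc nonneg by (intro add_mono mult_left_mono) auto
    also have "\<dots> = (A (N + n) * R + B (N + n)) * (C * R ^ n)"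
      by (simp add: algebra_simps)
    also have "\<dots> \<le> R\<^sup>2 * (C * R ^ n)"
      using N[of "N + n"] C R by (intro mult_right_mono) auto
    finally show ?case using Suc by (simp add: power2_eq_square algebra_simps)
  qed
  then have le: "norm (h (N + n)) \<le> C * R ^ n" for n by blast
  have "summable (\<lambda>n. h (n + N) * complex_of_real r ^ (n + N))"
  proof (rule summable_comparison_test)
    show "\<exists>M. \<forall>n\<ge>M. norm (h (n + N) * complex_of_real r ^ (n + N)) \<le> C * r ^ N * (R * r) ^ n"
    proof (intro exI allI impI)
      fix n :: nat
      have "norm (h (n + N) * complex_of_real r ^ (n + N)) = norm (h (N + n)) * r ^ (n + N)"
        using r by (simp add: norm_mult norm_power add.commute)
      also have "\<dots> \<le> C * R ^ n * r ^ (n + N)"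
        using le r by (intro mult_right_mono) auto
      finally show "norm (h (n + N) * complex_of_real r ^ (n + N)) \<le> C * r ^ N * (R * r) ^ n"
        by (simp add: power_add power_mult_distrib algebra_simps)
    qed
    show "summable (\<lambda>n. C * r ^ N * (R * r) ^ n)"
      using R r by (intro summable_mult summable_geometric) (auto simp: abs_mult)
  qed
  then have "summable (\<lambda>n. h n * complex_of_real r ^ n)"
    by (subst (asm) summable_iff_shift)
  then show "\<exists>z. norm z = r \<and> summable (\<lambda>n. h n * z ^ n)"
    using r by (intro exI[of _ "complex_of_real r"]) auto
qed

lemma tendsto_of_nat_add_ratio:
  fixes \<alpha> \<beta> :: complex
  shows "(\<lambda>n. (of_nat n + \<alpha>) / (of_nat n + \<beta>)) \<longlonglongrightarrow> 1"
proof -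
  have "(\<lambda>n. (1 + \<alpha> * inverse (of_nat n)) / (1 + \<beta> * inverse (of_nat n))) \<longlonglongrightarrow> (1 + \<alpha> * 0) / (1 + \<beta> * 0)"
    by (intro tendsto_intros lim_inverse_n) auto
  moreover have "eventually (\<lambda>n. (1 + \<alpha> * inverse (of_nat n)) / (1 + \<beta> * inverse (of_nat n))
       = (of_nat n + \<alpha>) / (of_nat n + \<beta>)) sequentially"
    using eventually_gt_at_top[of 0]
  proof eventually_elim
    case (elim n)
    have "(of_nat n + \<alpha>) / (of_nat n + \<beta>)
        = (of_nat n * (1 + \<alpha> * inverse (of_nat n))) / (of_nat n * (1 + \<beta> * inverse (of_nat n)))"
      using elim by (simp add: algebra_simps)
    then show ?case using elim by simp
  qed
  ultimately show ?thesis by (simp add: tendsto_cong)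
qed

lemma tendsto_inverse_of_nat_add:
  fixes \<beta> :: complex
  shows "(\<lambda>n. 1 / (of_nat n + \<beta>)) \<longlonglongrightarrow> 0"
proof -
  have "(\<lambda>n. inverse (of_nat n) * ((of_nat n + 0) / (of_nat n + \<beta>))) \<longlonglongrightarrow> 0 * (1 :: complex)"
    by (intro tendsto_mult lim_inverse_n tendsto_of_nat_add_ratio)
  moreover have "eventually (\<lambda>n. inverse (of_nat n) * ((of_nat n + 0) / (of_nat n + \<beta>))
       = 1 / (of_nat n + \<beta>)) sequentially"
    using eventually_gt_at_top[of 0] by eventually_elim auto
  ultimately show ?thesis using Lim_transform_eventually by fastforce
qed

text \<open>
  The recurrence is that of the power series in \<open>\<rho>\<close> of \<open>(1 + \<rho>)\<close> to the power \<open>- 2 a\<close> times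
  \<open>\<^sub>2F\<^sub>1(a, b; c; 4\<rho> / (1 + \<rho>)\<^sup>2)\<close>.
\<close>

fun gauss_coeff :: "complex \<Rightarrow> complex \<Rightarrow> complex \<Rightarrow> nat \<Rightarrow> complex" where
  "gauss_coeff a b c 0 = 1"
| "gauss_coeff a b c (Suc 0) = (4 * b - 2 * c) * a / c"
| "gauss_coeff a b c (Suc (Suc n)) =
     ((4 * b - 2 * c) * (of_nat n + 1 + a) * gauss_coeff a b c (Suc n)
      + (of_nat n + 2 * a) * (of_nat n + 1 - c + 2 * a) * gauss_coeff a b c n)
     / ((of_nat n + 2) * (of_nat n + 1 + c))"

text \<open>The limits 0 and 1 of the two recurrence coefficients reflect the singular points 1 and
  -1 of the equation in \<open>gauss_ode\<close>, both on the unit circle.\<close>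

lemma gauss_coeff_conv_radius: "conv_radius (gauss_coeff a b c) \<ge> 1"
proof (rule conv_radius_ge_1_of_three_term_bound)
  \<comment> \<open>The recurrence coefficients are arranged as products of quotients whose limits
    are known.\<close>
  let ?A = "\<lambda>n. (4 * b - 2 * c) * (1 / (of_nat n + 2)) * ((of_nat n + (1 + a)) / (of_nat n + (1 + c)))"
  let ?B = "\<lambda>n. ((of_nat n + 2 * a) / (of_nat n + 2)) * ((of_nat n + (1 - c + 2 * a)) / (of_nat n + (1 + c)))"
  have eq: "gauss_coeff a b c (Suc (Suc n)) = ?A n * gauss_coeff a b c (Suc n) + ?B n * gauss_coeff a b c n" for n
  proof -
    have "(x * y * h + p * q * g) / (u * v) = x * (1 / u) * (y / v) * h + (p / u) * (q / v) * g"
      for x y h p q g u v :: complex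
      by (simp add: add_divide_distrib)
    then show ?thesis
      by (simp only: gauss_coeff.simps add.assoc diff_conv_add_uminus)
  qed
  show "norm (gauss_coeff a b c (Suc (Suc n)))
     \<le> norm (?A n) * norm (gauss_coeff a b c (Suc n)) + norm (?B n) * norm (gauss_coeff a b c n)" for n
    unfolding eq norm_mult[symmetric] by (rule norm_triangle_ineq)
  have "?A \<longlonglongrightarrow> (4 * b - 2 * c) * 0 * 1"
    by (intro tendsto_mult tendsto_const tendsto_inverse_of_nat_add tendsto_of_nat_add_ratio)
  then show "(\<lambda>n. norm (?A n)) \<longlonglongrightarrow> 0"
    using tendsto_norm by fastforce
  have "?B \<longlonglongrightarrow> 1 * 1"
    by (intro tendsto_mult tendsto_of_nat_add_ratio)
  then show "(\<lambda>n. norm (?B n)) \<longlonglongrightarrow> 1"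
    using tendsto_norm by fastforce
qed auto

text \<open>Under the substitution the singular points 1 and \<infinity> of the hypergeometric
  equation correspond to \<rho> = 1 and \<rho> = -1. Hence the leading coefficient
  \<open>z * (1 - z\<^sup>2)\<close>, and 0 is the only singular point in the open disc.\<close>

lemma gauss_ode:
  fixes a b c :: complex
  assumes c: "c \<notin> \<int>\<^sub>\<le>\<^sub>0"
  defines "H \<equiv> eval_fps (Abs_fps (gauss_coeff a b c))"
  shows "H holomorphic_on ball 0 1" "H 0 = 1"
    and "z \<in> ball 0 1 \<Longrightarrow> z * (1 - z\<^sup>2) * deriv (deriv H) z
           + (c + (2 * c - 4 * b) * z + (c - 2 - 4 * a) * z\<^sup>2) * deriv H z
           + (- (2 * a * (2 * a + 1 - c) * z + (4 * a * b - 2 * a * c))) * H z = 0"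
proof -
  define F where "F = Abs_fps (gauss_coeff a b c)"
  have rad: "fps_conv_radius F \<ge> 1"
    using gauss_coeff_conv_radius[of a b c] by (simp add: F_def fps_conv_radius_def)
  then show hol: "H holomorphic_on ball 0 1"
    unfolding H_def F_def[symmetric] using ball_eball_mono[of 1 "fps_conv_radius F" 0]
    by (intro holomorphic_on_eval_fps) (auto simp: one_ereal_def)
  show "H 0 = 1" by (simp add: H_def eval_fps_at_0)
  have H: "H has_fps_expansion F"
    unfolding H_def F_def[symmetric] using rad
    by (intro eval_fps_has_fps_expansion) (auto intro: less_le_trans[of _ 1])
  let ?L = "\<lambda>z. z * (1 - z\<^sup>2) * deriv (deriv H) z
           + (c + (2 * c - 4 * b) * z + (c - 2 - 4 * a) * z\<^sup>2) * deriv H z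
           + (- (2 * a * (2 * a + 1 - c) * z + (4 * a * b - 2 * a * c))) * H z"
  let ?F = "fps_X * (1 - fps_X ^ 2) * fps_deriv (fps_deriv F)
       + (fps_const c + fps_const (2 * c - 4 * b) * fps_X + fps_const (c - 2 - 4 * a) * fps_X ^ 2)
          * fps_deriv F
       + (- (fps_const (2 * a * (2 * a + 1 - c)) * fps_X + fps_const (4 * a * b - 2 * a * c))) * F"
  have "?L has_fps_expansion ?F"
    by (intro fps_expansion_intros H)
  moreover have "fps_nth ?F n = 0" for n
  proof (cases n)
    case 0
    then show ?thesis
      using nonpos_Int_add_of_nat_neq_0[OF c, of 0] by (simp add: F_def field_simps)
  next
    case (Suc m)
    have nz: "(of_nat m + 2 :: complex) \<noteq> 0" "of_nat m + 1 + c \<noteq> 0"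
      using nonpos_Int_add_of_nat_neq_0[OF c, of "Suc m"] of_nat_neq_0[of "Suc m", where 'a = complex]
      by (auto simp: add_ac simp del: of_nat_eq_0_iff)
    have rec: "(of_nat m + 2) * (of_nat m + 1 + c) * gauss_coeff a b c (Suc (Suc m))
      = (4 * b - 2 * c) * (of_nat m + 1 + a) * gauss_coeff a b c (Suc m)
      + (of_nat m + 2 * a) * (of_nat m + 1 - c + 2 * a) * gauss_coeff a b c m"
      using nz by simp
    have "fps_nth ?F n = (of_nat m + 2) * (of_nat m + 1 + c) * gauss_coeff a b c (Suc (Suc m))
       - (4 * b - 2 * c) * (of_nat m + 1 + a) * gauss_coeff a b c (Suc m)
       - (of_nat m + 2 * a) * (of_nat m + 1 - c + 2 * a) * gauss_coeff a b c m"
    proof (cases m)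
      case 0
      then show ?thesis using Suc
        by (simp add: F_def algebra_simps power2_eq_square del: gauss_coeff.simps)
    next
      case (Suc k)
      then show ?thesis using \<open>n = Suc m\<close>
        by (cases k) (simp_all add: F_def algebra_simps power2_eq_square del: gauss_coeff.simps)
    qed
    then show ?thesis unfolding rec by simp
  qed
  then have "?F = 0" unfolding fps_eq_iff fps_zero_nth by blast
  \<comment> \<open>The left-hand side vanishes near 0 because its expansion does; the identity
    theorem extends this to the whole disc.\<close>
  ultimately have L0: "?L has_fps_expansion 0" by metis
  have "deriv H holomorphic_on ball 0 1" "deriv (deriv H) holomorphic_on ball 0 1"
    using hol by (auto intro!: holomorphic_deriv)
  then have "?L holomorphic_on ball 0 1"
    by (intro holomorphic_intros hol) auto
  then show "?L z = 0" if "z \<in> ball 0 1"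
    using has_fps_expansion_0_analytic_continuation[OF L0] that by auto
qed

section \<open>Geometry of the cut plane and existence of the regular solution\<close>

lemma open_cut_plane: "open cut_plane"
  using closed_slot_right[of 1] by (simp add: open_closed)

lemma connected_cut_plane: "connected cut_plane"
  using simply_connected_imp_connected simply_connected_slotted_complex_plane_right by blast

lemma mem_cut_plane_iff: "z \<in> cut_plane \<longleftrightarrow> (Im z = 0 \<longrightarrow> Re z < 1)"
  by (auto simp: complex_slot_right_eq)

lemma ball_subset_cut_plane: "ball 0 1 \<subseteq> cut_plane"
proof
  fix z :: complex assume "z \<in> ball 0 1"
  then show "z \<in> cut_plane"
    unfolding mem_cut_plane_iff using complex_Re_le_cmod[of z] by auto
qed

lemma Re_csqrt_pos: "z \<notin> \<real>\<^sub>\<le>\<^sub>0 \<Longrightarrow> Re (csqrt z) > 0"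
proof -
  assume z: "z \<notin> \<real>\<^sub>\<le>\<^sub>0"
  have "Re (csqrt z) \<noteq> 0"
  proof
    assume 0: "Re (csqrt z) = 0"
    have "z = csqrt z ^ 2" by simp
    also have "\<dots> = complex_of_real (- (Im (csqrt z))\<^sup>2)"
      using 0 by (simp add: complex_eq_iff power2_eq_square del: csqrt.simps)
    also have "\<dots> \<in> \<real>\<^sub>\<le>\<^sub>0" by (subst complex_nonpos_Reals_iff) simp
    finally show False using z by simp
  qed
  then show ?thesis using Re_csqrt[of z] by simp
qed

text \<open>
  The substitution \<open>w = 4\<rho> / (1 + \<rho>)\<^sup>2\<close> maps the unit disc conformally onto the cut plane;
  with \<open>s = \<surd>(1 - w)\<close> its inverse is \<open>\<rho> = (1 - s) / (1 + s)\<close>.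
\<close>

lemma hypergeom_ode_exists:
  assumes c: "c \<notin> \<int>\<^sub>\<le>\<^sub>0"
  shows "\<exists>g. hypergeom_ode a b c cut_plane g \<and> g 0 = 1"
proof -
  define H where "H = eval_fps (Abs_fps (gauss_coeff a b c))"
  note H = gauss_ode[where a = a and b = b, OF c, folded H_def]
  define s where "s = (\<lambda>w::complex. csqrt (1 - w))"
  \<comment> \<open>Since \<open>1 + \<rho> = 2 / (1 + s w)\<close>, this is
    \<open>1 + \<rho>\<close> to the power \<open>2 * a\<close>, which undoes the prefactor
    contained in \<open>H\<close>.\<close>
  define P where "P = (\<lambda>w. ((1 + s w) / 2) powr (- 2 * a))"
  define \<phi> where "\<phi> = (\<lambda>w. (1 - s w) / (1 + s w))"
  define l where "l = (\<lambda>w. a / (s w * (1 + s w)))"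
  define \<phi>1 where "\<phi>1 = (\<lambda>w. 1 / (s w * (1 + s w)\<^sup>2))"
  have nonpos: "1 - w \<notin> \<real>\<^sub>\<le>\<^sub>0" if "w \<in> cut_plane" for w
    using that unfolding mem_cut_plane_iff complex_nonpos_Reals_iff by auto
  have spos: "Re (s w) > 0" if "w \<in> cut_plane" for w
    unfolding s_def using Re_csqrt_pos nonpos that by blast
  have nz: "s w \<noteq> 0" "1 + s w \<noteq> 0" if "w \<in> cut_plane" for w
    using spos[OF that] by (auto simp: complex_eq_iff)
  have ds: "(s has_field_derivative - 1 / (2 * s w)) (at w)" if "w \<in> cut_plane" for w
    unfolding s_def using nonpos[OF that] by (auto intro!: derivative_eq_intros)
  have w_eq: "w = 1 - (s w)\<^sup>2" for w by (simp add: s_def)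
  have dP: "(P has_field_derivative l w * P w) (at w)" if w: "w \<in> cut_plane" for w
  proof -
    have "(1 + s w) / 2 \<notin> \<real>\<^sub>\<le>\<^sub>0"
      using spos[OF w] by (auto simp: complex_nonpos_Reals_iff)
    then have "(P has_field_derivative (- 2 * a) * ((1 + s w) / 2) powr (- 2 * a - 1) * (- 1 / (2 * s w) / 2)) (at w)"
      unfolding P_def by (auto intro!: derivative_eq_intros ds w)
    moreover have "(- 2 * a) * ((1 + s w) / 2) powr (- 2 * a - 1) * (- 1 / (2 * s w) / 2) = l w * P w"
      using nz[OF w] by (simp add: powr_diff P_def l_def field_simps)
    ultimately show ?thesis by simp
  qed
  have dl: "(l has_field_derivative a * (1 + 2 * s w) / (2 * s w ^ 3 * (1 + s w)\<^sup>2)) (at w)"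
    if w: "w \<in> cut_plane" for w
    unfolding l_def using nz[OF w]
    by (auto intro!: derivative_eq_intros ds w) (simp add: divide_simps, algebra)
  have d\<phi>: "(\<phi> has_field_derivative \<phi>1 w) (at w)" if w: "w \<in> cut_plane" for w
    unfolding \<phi>_def \<phi>1_def using nz[OF w]
    by (auto intro!: derivative_eq_intros ds w) (simp add: field_simps power2_eq_square)
  have d\<phi>1: "(\<phi>1 has_field_derivative (1 + 3 * s w) / (2 * s w ^ 3 * (1 + s w) ^ 3)) (at w)"
    if w: "w \<in> cut_plane" for w
    unfolding \<phi>1_def using nz[OF w]
    by (auto intro!: derivative_eq_intros ds w) (simp add: divide_simps, algebra)
  \<comment> \<open>The Cayley map takes the right half-plane into the unit disc.\<close>
  have \<phi>_ball: "\<phi> w \<in> ball 0 1" if w: "w \<in> cut_plane" for w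
  proof -
    have "(norm (1 - s w))\<^sup>2 < (norm (1 + s w))\<^sup>2"
      unfolding cmod_power2 using spos[OF w] by (simp add: power2_eq_square algebra_simps)
    then have "norm (1 - s w) < norm (1 + s w)"
      using power2_less_imp_less norm_ge_zero by blast
    then show ?thesis using nz[OF w] by (simp add: \<phi>_def norm_divide)
  qed
  have "hypergeom_ode a b c cut_plane (\<lambda>w. P w * H (\<phi> w))"
    unfolding hypergeom_ode_def
  proof (intro conjI ballI)
    show "(\<lambda>w. P w * H (\<phi> w)) holomorphic_on cut_plane"
      using pullback_derivs(1)[where l = l and ?\<phi>1.0 = \<phi>1,
        OF open_cut_plane open_ball H(1) \<phi>_ball dP dl d\<phi> d\<phi>1]
      by (auto simp: holomorphic_on_open[OF open_cut_plane])
    fix w assume w: "w \<in> cut_plane"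
    note nz = nz[OF w]
    \<comment> \<open>In terms of the root \<open>t\<close> all coefficients are rational, which
      reduces the matching conditions to polynomial identities.\<close>
    define t where "t = s w"
    have wt: "w = 1 - t\<^sup>2" using w_eq by (simp add: t_def)
    have t: "t \<noteq> 0" "1 + t \<noteq> 0" using nz by (auto simp: t_def)
    show "w * (1 - w) * deriv (deriv (\<lambda>w. P w * H (\<phi> w))) w +
         (c - (a + b + 1) * w) * deriv (\<lambda>w. P w * H (\<phi> w)) w + - (a * b) * (P w * H (\<phi> w)) = 0"
    \<comment> \<open>The value of \<open>\<kappa>\<close> is forced by the condition on the second
      derivative.\<close>
    proof (rule pullback_ode[where l = l and ?\<phi>1.0 = \<phi>1 and \<kappa> = "1 / (4 * s w)"
          and A = "\<lambda>z. z * (1 - z\<^sup>2)" and B = "\<lambda>z. c + (2 * c - 4 * b) * z + (c - 2 - 4 * a) * z\<^sup>2"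
          and C = "\<lambda>z. - (2 * a * (2 * a + 1 - c) * z + (4 * a * b - 2 * a * c))",
          OF open_cut_plane open_ball H(1) \<phi>_ball dP dl d\<phi> d\<phi>1 H(3) w])
      show "w * (1 - w) * (\<phi>1 w)\<^sup>2 = 1 / (4 * s w) * (\<phi> w * (1 - (\<phi> w)\<^sup>2))"
        unfolding \<phi>1_def \<phi>_def t_def[symmetric] unfolding wt using t by (simp add: divide_simps) algebra
      show "w * (1 - w) * (2 * l w * \<phi>1 w + (1 + 3 * s w) / (2 * s w ^ 3 * (1 + s w) ^ 3))
          + (c - (a + b + 1) * w) * \<phi>1 w
        = 1 / (4 * s w) * (c + (2 * c - 4 * b) * \<phi> w + (c - 2 - 4 * a) * (\<phi> w)\<^sup>2)"
        unfolding \<phi>1_def \<phi>_def l_def t_def[symmetric] unfolding wt using t by (simp add: divide_simps) algebra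
      show "w * (1 - w) * ((l w)\<^sup>2 + a * (1 + 2 * s w) / (2 * s w ^ 3 * (1 + s w)\<^sup>2))
          + (c - (a + b + 1) * w) * l w + - (a * b)
        = 1 / (4 * s w) * - (2 * a * (2 * a + 1 - c) * \<phi> w + (4 * a * b - 2 * a * c))"
        unfolding \<phi>_def l_def t_def[symmetric] unfolding wt using t by (simp add: divide_simps) algebra
    qed auto
  qed
  moreover have "P 0 * H (\<phi> 0) = 1"
    by (simp add: P_def \<phi>_def s_def H(2))
  ultimately show ?thesis by blast
qed

section \<open>Identification of the Gauss function with the regular solution\<close>

lemma hypergeom_ode_imp_eq_series:
  assumes c: "c \<notin> \<int>\<^sub>\<le>\<^sub>0" and g: "hypergeom_ode a b c cut_plane g" "g 0 = 1"
    and w: "w \<in> ball 0 1"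
  shows "(\<lambda>n. hyp2F1_coeff a b c n * w ^ n) sums g w"
proof -
  have "g has_fps_expansion Abs_fps (hyp2F1_coeff a b c)"
    using hypergeom_ode_fps[OF c g(1) open_cut_plane _ g(2)] ball_subset_cut_plane by force
  moreover have "g holomorphic_on eball 0 1"
    using g ball_subset_cut_plane holomorphic_on_subset
    unfolding hypergeom_ode_def one_ereal_def by auto
  ultimately show ?thesis
    using has_fps_expansion_imp_sums_complex[of g "Abs_fps (hyp2F1_coeff a b c)" 1 w] w
    by (simp add: one_ereal_def)
qed

text \<open>Euler's, Pfaff's and the quadratic transformation are instances: it suffices that the
  right-hand side solves the equation on the cut plane and has value 1 at 0.\<close>

lemma hyp2F1_eqI:
  assumes c: "c \<notin> \<int>\<^sub>\<le>\<^sub>0" and g: "hypergeom_ode a b c cut_plane g" "g 0 = 1"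
    and z: "z \<in> cut_plane"
  shows "hyp2F1 a b c z = g z"
  unfolding hyp2F1_def
proof (rule holomorphic_extension_unique[OF open_cut_plane connected_cut_plane
        ball_subset_cut_plane _ _ _ _ z])
  show "(0::complex) islimpt ball 0 1"
    by (rule interior_limit_point) auto
  show "g holomorphic_on cut_plane" using g by (simp add: hypergeom_ode_def)
  show "g w = hyp2F1_series a b c w" if "w \<in> ball 0 1" for w
    using hypergeom_ode_imp_eq_series[OF c g that] by (simp add: hyp2F1_series_altdef sums_iff)
  show "0 \<in> cut_plane" using ball_subset_cut_plane by force
qed

text \<open>\<open>hyp2F1\<close> agrees with the constructed solution only on the cut plane, so the
  equation has to be transferred between functions that may differ elsewhere.\<close>

lemma hypergeom_ode_cong:
  assumes "open S" "\<And>z. z \<in> S \<Longrightarrow> f z = g z"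
  shows "hypergeom_ode a b c S f \<longleftrightarrow> hypergeom_ode a b c S g"
proof -
  have d: "deriv f z = deriv g z" if "z \<in> S" for z
    using assms that by (intro deriv_cong_ev) (auto simp: eventually_nhds)
  have dd: "deriv (deriv f) z = deriv (deriv g) z" if "z \<in> S" for z
    using assms(1) d that by (intro deriv_cong_ev) (auto simp: eventually_nhds)
  show ?thesis
    using d dd assms(2) holomorphic_cong[OF refl assms(2)] unfolding hypergeom_ode_def by simp
qed

lemma
  assumes c: "c \<notin> \<int>\<^sub>\<le>\<^sub>0"
  shows hypergeom_ode_hyp2F1: "hypergeom_ode a b c cut_plane (hyp2F1 a b c)"
    and hyp2F1_0: "hyp2F1 a b c 0 = 1"
proof -
  obtain g where g: "hypergeom_ode a b c cut_plane g" "g 0 = 1"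
    using hypergeom_ode_exists[OF c] by blast
  show "hypergeom_ode a b c cut_plane (hyp2F1 a b c)"
    using hypergeom_ode_cong[OF open_cut_plane, of "hyp2F1 a b c" g] hyp2F1_eqI[OF c g] g(1) by blast
  show "hyp2F1 a b c 0 = 1"
    using hyp2F1_eqI[OF c g, of 0] g(2) ball_subset_cut_plane by force
qed

lemma holomorphic_on_hyp2F1: "c \<notin> \<int>\<^sub>\<le>\<^sub>0 \<Longrightarrow> hyp2F1 a b c holomorphic_on cut_plane"
  using hypergeom_ode_hyp2F1 by (simp add: hypergeom_ode_def)

lemma hyp2F1_sums:
  assumes "c \<notin> \<int>\<^sub>\<le>\<^sub>0" "norm w < 1"
  shows "(\<lambda>n. hyp2F1_coeff a b c n * w ^ n) sums hyp2F1 a b c w"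
  using hypergeom_ode_imp_eq_series[OF assms(1) hypergeom_ode_hyp2F1 hyp2F1_0] assms by simp

section \<open>Transformation formulas\<close>

text \<open>The derivative of a power in the shape \<open>l z * P z\<close> that the pullback lemmas
  ask for.\<close>

lemma powr_log_derivative:
  fixes u :: "complex \<Rightarrow> complex"
  assumes "(u has_field_derivative u') (at z)" "u z \<notin> \<real>\<^sub>\<le>\<^sub>0"
  shows "((\<lambda>z. u z powr e) has_field_derivative (e * u' / u z) * (u z powr e)) (at z)"
proof -
  have "u z \<noteq> 0" using assms(2) by auto
  then have "e * u z powr (e - 1) * u' = (e * u' / u z) * (u z powr e)"
    by (simp add: powr_diff)
  moreover have "((\<lambda>z. u z powr e) has_field_derivative e * u z powr (e - 1) * u') (at z)"
    by (auto intro!: derivative_eq_intros assms)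
  ultimately show ?thesis by simp
qed

lemma one_minus_cut_plane: "z \<in> cut_plane \<Longrightarrow> 1 - z \<notin> \<real>\<^sub>\<le>\<^sub>0"
  unfolding mem_cut_plane_iff complex_nonpos_Reals_iff by auto

lemma cut_plane_neq_1: "z \<in> cut_plane \<Longrightarrow> z \<noteq> 1"
  unfolding mem_cut_plane_iff by auto

text \<open>The exponents at 1 are 0 and c - a - b. The power of 1 - z exchanges their roles and
  leaves the regular solution at 0 in place.\<close>

lemma hyp2F1_Euler:
  assumes c: "c \<notin> \<int>\<^sub>\<le>\<^sub>0" and z: "z \<in> cut_plane"
  shows "hyp2F1 a b c z = (1 - z) powr (c - a - b) * hyp2F1 (c - a) (c - b) c z"
proof (rule hyp2F1_eqI[OF c _ _ z])
  let ?e = "c - a - b"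
  show "hypergeom_ode a b c cut_plane (\<lambda>z. (1 - z) powr ?e * hyp2F1 (c - a) (c - b) c z)"
  proof (rule hypergeom_ode_pullback[OF open_cut_plane open_cut_plane hypergeom_ode_hyp2F1[OF c],
        where \<phi> = "\<lambda>z. z" and ?\<phi>1.0 = "\<lambda>_. 1" and ?\<phi>2.0 = "\<lambda>_. 0" and \<kappa> = "\<lambda>_. 1"
          and l = "\<lambda>z. ?e * (- 1) / (1 - z)" and l' = "\<lambda>z. - ?e / (1 - z)\<^sup>2"])
    fix z assume z: "z \<in> cut_plane"
    have nz: "1 - z \<noteq> 0" using cut_plane_neq_1[OF z] by simp
    show "((\<lambda>z. (1 - z) powr ?e) has_field_derivative
            ?e * (- 1) / (1 - z) * (1 - z) powr ?e) (at z)"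
      by (rule powr_log_derivative[where u = "\<lambda>z. 1 - z", OF _ one_minus_cut_plane[OF z]]) (auto intro!: derivative_eq_intros)
    show "((\<lambda>z. ?e * (- 1) / (1 - z)) has_field_derivative - ?e / (1 - z)\<^sup>2) (at z)"
      using nz by (auto intro!: derivative_eq_intros simp: power2_eq_square)
    show "z * (1 - z) * (2 * (?e * - 1 / (1 - z)) * 1 + 0) + (c - (a + b + 1) * z) * 1 =
         1 * (c - (c - a + (c - b) + 1) * z)"
      using nz by (simp add: divide_simps) algebra
    show "z * (1 - z) * ((?e * - 1 / (1 - z))\<^sup>2 + - ?e / (1 - z)\<^sup>2)
           + (c - (a + b + 1) * z) * (?e * - 1 / (1 - z)) + - (a * b)
         = 1 * - ((c - a) * (c - b))"
      using nz by (simp add: divide_simps) algebra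
  qed (auto intro!: derivative_eq_intros)
qed (simp add: hyp2F1_0[OF c])

text \<open>The map is an involution: a value \<open>r\<close> on the cut forces
  \<open>r > 1\<close> and \<open>z = r / (r - 1)\<close>, again on the cut.\<close>

lemma Pfaff_cut_plane:
  assumes z: "z \<in> cut_plane"
  shows "z / (z - 1) \<in> cut_plane"
proof
  have nz: "z - 1 \<noteq> 0" using cut_plane_neq_1[OF z] by auto
  assume "z / (z - 1) \<in> complex_of_real ` {1..}"
  then obtain r where r: "r \<ge> 1" "z / (z - 1) = of_real r" by auto
  then have *: "z * of_real (r - 1) = of_real r" using nz by (simp add: field_simps)
  then have "r \<noteq> 1" by auto
  then have "z = of_real (r / (r - 1))" using * by (simp add: field_simps)
  moreover have "r / (r - 1) \<ge> 1" using r \<open>r \<noteq> 1\<close> by (simp add: field_simps)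
  ultimately have "z \<in> complex_of_real ` {1..}" by (intro image_eqI) auto
  then show False using z by blast
qed

text \<open>The Moebius map fixes 0 and exchanges 1 and \<infinity>. At 1 it produces the exponents
  c - a and b, which the power of 1 - z shifts to c - a - b and 0.\<close>

lemma hyp2F1_Pfaff:
  assumes c: "c \<notin> \<int>\<^sub>\<le>\<^sub>0" and z: "z \<in> cut_plane"
  shows "hyp2F1 a b c z = (1 - z) powr (- b) * hyp2F1 (c - a) b c (z / (z - 1))"
proof (rule hyp2F1_eqI[OF c _ _ z])
  show "hypergeom_ode a b c cut_plane (\<lambda>z. (1 - z) powr (- b) * hyp2F1 (c - a) b c (z / (z - 1)))"
  proof (rule hypergeom_ode_pullback[OF open_cut_plane open_cut_plane hypergeom_ode_hyp2F1[OF c],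
        where ?\<phi>1.0 = "\<lambda>z. - 1 / (z - 1)\<^sup>2" and ?\<phi>2.0 = "\<lambda>z. 2 / (z - 1) ^ 3"
          and \<kappa> = "\<lambda>z. 1 / (z - 1)"
          and l = "\<lambda>z. - b * (- 1) / (1 - z)" and l' = "\<lambda>z. b / (1 - z)\<^sup>2"])
    fix z assume z: "z \<in> cut_plane"
    have nz: "1 - z \<noteq> 0" "z - 1 \<noteq> 0" using cut_plane_neq_1[OF z] by auto
    show "z / (z - 1) \<in> cut_plane" by (rule Pfaff_cut_plane[OF z])
    show "((\<lambda>z. (1 - z) powr (- b)) has_field_derivative
            - b * (- 1) / (1 - z) * (1 - z) powr (- b)) (at z)"
      by (rule powr_log_derivative[where u = "\<lambda>z. 1 - z", OF _ one_minus_cut_plane[OF z]]) (auto intro!: derivative_eq_intros)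
    show "((\<lambda>z. - b * (- 1) / (1 - z)) has_field_derivative b / (1 - z)\<^sup>2) (at z)"
      using nz by (auto intro!: derivative_eq_intros simp: power2_eq_square)
    show "((\<lambda>z. z / (z - 1)) has_field_derivative - 1 / (z - 1)\<^sup>2) (at z)"
      using nz by (auto intro!: derivative_eq_intros simp: power2_eq_square)
    show "((\<lambda>z. - 1 / (z - 1)\<^sup>2) has_field_derivative 2 / (z - 1) ^ 3) (at z)"
      using nz by (auto intro!: derivative_eq_intros)
        (simp add: divide_simps, algebra)
    show "z * (1 - z) * (- 1 / (z - 1)\<^sup>2)\<^sup>2 = 1 / (z - 1) * (z / (z - 1) * (1 - z / (z - 1)))"
      using nz by (simp add: divide_simps) algebra
    show "z * (1 - z) * (2 * (- b * - 1 / (1 - z)) * (- 1 / (z - 1)\<^sup>2) + 2 / (z - 1) ^ 3)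
          + (c - (a + b + 1) * z) * (- 1 / (z - 1)\<^sup>2)
        = 1 / (z - 1) * (c - (c - a + b + 1) * (z / (z - 1)))"
      using nz by (simp add: divide_simps) algebra
    show "z * (1 - z) * ((- b * - 1 / (1 - z))\<^sup>2 + b / (1 - z)\<^sup>2)
          + (c - (a + b + 1) * z) * (- b * - 1 / (1 - z)) + - (a * b)
        = 1 / (z - 1) * - ((c - a) * b)"
      using nz by (simp add: divide_simps) algebra
  qed
qed (simp add: hyp2F1_0[OF c])

text \<open>If the square is on the cut, then w/(2 - w) is a real q with |q| at least 1, and w =
  2q/(1 + q) is again at least 1, for either sign of q.\<close>

lemma quadratic_cut_plane:
  assumes "w \<in> cut_plane"
  shows "(w / (2 - w))\<^sup>2 \<in> cut_plane"
proof
  assume "(w / (2 - w))\<^sup>2 \<in> complex_of_real ` {1..}"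
  then obtain r where r: "r \<ge> 1" "(w / (2 - w))\<^sup>2 = of_real r" by auto
  have "w \<noteq> 2" using assms unfolding mem_cut_plane_iff by auto
  have "(w / (2 - w))\<^sup>2 = (of_real (sqrt r))\<^sup>2"
    using r by (simp flip: of_real_power)
  obtain q where q: "\<bar>q\<bar> \<ge> 1" "w / (2 - w) = complex_of_real q"
  proof -
    have "w / (2 - w) = of_real (sqrt r) \<or> w / (2 - w) = of_real (- sqrt r)"
      using \<open>(w / (2 - w))\<^sup>2 = (of_real (sqrt r))\<^sup>2\<close> by (simp add: power2_eq_iff)
    then show ?thesis using r that[of "sqrt r"] that[of "- sqrt r"] by auto
  qed
  then have *: "w * of_real (1 + q) = of_real (2 * q)"
    using \<open>w \<noteq> 2\<close> by (simp add: field_simps)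
  then have "q \<noteq> - 1" by auto
  then have "complex_of_real (1 + q) \<noteq> 0"
    unfolding of_real_eq_0_iff by simp
  then have "w = of_real (2 * q / (1 + q))"
    using * unfolding of_real_divide by (metis nonzero_eq_divide_eq)
  moreover have "2 * q / (1 + q) \<ge> 1"
    using q(1) \<open>q \<noteq> - 1\<close> by (simp add: le_divide_eq) linarith
  ultimately have "w \<in> complex_of_real ` {1..}" by (intro image_eqI) auto
  then show False using assms by blast
qed

text \<open>For c = 2b Pfaff's involution w \<mapsto> w/(w - 1) maps the equation to itself, and it
  changes the sign of w/(2 - w). The solution therefore descends, up to a power, to a function of
  the square.\<close>

lemma hyp2F1_quadratic:
  assumes c: "2 * b \<notin> \<int>\<^sub>\<le>\<^sub>0" "b + 1 / 2 \<notin> \<int>\<^sub>\<le>\<^sub>0" and w: "w \<in> cut_plane"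
  shows "hyp2F1 a b (2 * b) w
           = (1 - w / 2) powr (- a) * hyp2F1 (a / 2) ((a + 1) / 2) (b + 1 / 2) ((w / (2 - w))\<^sup>2)"
proof (rule hyp2F1_eqI[OF c(1) _ _ w])
  show "hypergeom_ode a b (2 * b) cut_plane
    (\<lambda>w. (1 - w / 2) powr (- a) * hyp2F1 (a / 2) ((a + 1) / 2) (b + 1 / 2) ((w / (2 - w))\<^sup>2))"
  proof (rule hypergeom_ode_pullback[OF open_cut_plane open_cut_plane hypergeom_ode_hyp2F1[OF c(2)],
        where ?\<phi>1.0 = "\<lambda>w. 4 * w / (2 - w) ^ 3" and ?\<phi>2.0 = "\<lambda>w. (8 + 8 * w) / (2 - w) ^ 4"
          and \<kappa> = "\<lambda>w. 4 * w / (2 - w)\<^sup>2"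
          and l = "\<lambda>w. - a * (- (1 / 2)) / (1 - w / 2)" and l' = "\<lambda>w. a / (2 - w)\<^sup>2"])
    fix w assume w: "w \<in> cut_plane"
    have nz: "2 - w \<noteq> 0" using w unfolding mem_cut_plane_iff by (auto simp: complex_eq_iff)
    define u where "u = 2 - w"
    have u: "u \<noteq> 0" "w = 2 - u" using nz by (auto simp: u_def)
    have l: "- a * (- (1 / 2)) / (1 - w / 2) = a / (2 - w)" for w
      by (simp add: field_simps)
    have "1 - w / 2 \<notin> \<real>\<^sub>\<le>\<^sub>0"
      using w unfolding mem_cut_plane_iff complex_nonpos_Reals_iff by auto
    then show "((\<lambda>z. (1 - z / 2) powr (- a)) has_field_derivative
            - a * (- (1 / 2)) / (1 - w / 2) * (1 - w / 2) powr (- a)) (at w)"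
      by (rule powr_log_derivative[where u = "\<lambda>z. 1 - z / 2", rotated]) (auto intro!: derivative_eq_intros)
    show "((\<lambda>w. - a * (- (1 / 2)) / (1 - w / 2)) has_field_derivative a / (2 - w)\<^sup>2) (at w)"
      unfolding l using nz by (auto intro!: derivative_eq_intros simp: power2_eq_square)
    show "((\<lambda>w. (w / (2 - w))\<^sup>2) has_field_derivative 4 * w / (2 - w) ^ 3) (at w)"
      using nz by (auto intro!: derivative_eq_intros)
        (simp add: divide_simps power2_eq_square power3_eq_cube)
    show "((\<lambda>w. 4 * w / (2 - w) ^ 3) has_field_derivative (8 + 8 * w) / (2 - w) ^ 4) (at w)"
    proof -
      \<comment> \<open>The quotient rule leaves the denominator \<open>(2 - w) ^ 6\<close>, from
        which a square cancels.\<close>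
      have "4 * (2 - w) ^ 3 + 12 * (w * (2 - w)\<^sup>2) = (8 + 8 * w) * (2 - w)\<^sup>2" by algebra
      moreover have "(2 - w) ^ 6 = (2 - w) ^ 4 * (2 - w)\<^sup>2" by algebra
      ultimately have "(4 * (2 - w) ^ 3 + 12 * (w * (2 - w)\<^sup>2)) / (2 - w) ^ 6 = (8 + 8 * w) / (2 - w) ^ 4"
        using nz by (metis nonzero_mult_divide_mult_cancel_right power_not_zero)
      then show ?thesis
        using nz by (auto intro!: derivative_eq_intros)
    qed
    show "w * (1 - w) * (4 * w / (2 - w) ^ 3)\<^sup>2
        = 4 * w / (2 - w)\<^sup>2 * ((w / (2 - w))\<^sup>2 * (1 - (w / (2 - w))\<^sup>2))"
      using u(1) by (simp add: u(2) divide_simps) (simp add: power2_eq_square algebra_simps)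
    show "w * (1 - w) * (2 * (- a * - (1 / 2) / (1 - w / 2)) * (4 * w / (2 - w) ^ 3) + (8 + 8 * w) / (2 - w) ^ 4)
          + (2 * b - (a + b + 1) * w) * (4 * w / (2 - w) ^ 3)
        = 4 * w / (2 - w)\<^sup>2 * (b + 1 / 2 - (a / 2 + (a + 1) / 2 + 1) * (w / (2 - w))\<^sup>2)"
      unfolding l using u(1) by (simp add: u(2) divide_simps) algebra
    show "w * (1 - w) * ((- a * - (1 / 2) / (1 - w / 2))\<^sup>2 + a / (2 - w)\<^sup>2)
          + (2 * b - (a + b + 1) * w) * (- a * - (1 / 2) / (1 - w / 2)) + - (a * b)
        = 4 * w / (2 - w)\<^sup>2 * - (a / 2 * ((a + 1) / 2))"
      unfolding l using u(1) by (simp add: u(2) divide_simps) algebra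
  qed (rule quadratic_cut_plane)
qed (simp add: hyp2F1_0[OF c(2)])

text \<open>Both sides have the same Taylor series at 0. The formula serves to find the second
  connection coefficient.\<close>

lemma deriv_hyp2F1:
  assumes c: "c \<notin> \<int>\<^sub>\<le>\<^sub>0" and z: "z \<in> cut_plane"
  shows "deriv (hyp2F1 a b c) z = a * b / c * hyp2F1 (a + 1) (b + 1) (c + 1) z"
proof -
  have c1: "c + 1 \<notin> \<int>\<^sub>\<le>\<^sub>0"
    using c plus_one_in_nonpos_Ints_imp by blast
  have 0: "0 \<in> cut_plane" using ball_subset_cut_plane by force
  note exp = hypergeom_ode_fps[OF _ hypergeom_ode_hyp2F1 open_cut_plane 0 hyp2F1_0]
  let ?f = "\<lambda>z. deriv (hyp2F1 a b c) z - a * b / c * hyp2F1 (a + 1) (b + 1) (c + 1) z"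
  have "?f has_fps_expansion fps_deriv (Abs_fps (hyp2F1_coeff a b c))
          - fps_const (a * b / c) * Abs_fps (hyp2F1_coeff (a + 1) (b + 1) (c + 1))"
    by (intro fps_expansion_intros exp c c1)
  also have "fps_deriv (Abs_fps (hyp2F1_coeff a b c))
          - fps_const (a * b / c) * Abs_fps (hyp2F1_coeff (a + 1) (b + 1) (c + 1)) = 0"
    by (simp add: fps_eq_iff hyp2F1_coeff_def pochhammer_rec del: of_nat_Suc)
  finally have "?f has_fps_expansion 0" .
  moreover have "?f holomorphic_on cut_plane"
    by (intro holomorphic_intros holomorphic_deriv open_cut_plane holomorphic_on_hyp2F1 c c1)
  ultimately have "?f z = 0"
    using has_fps_expansion_0_analytic_continuation open_cut_plane connected_cut_plane 0 z by blast
  then show ?thesis by simp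
qed

section \<open>Gauss's summation theorem\<close>

text \<open>Gauss's limit for the reciprocal Gamma function, read as the growth of Pochhammer
  symbols. The product in \<open>rGamma_series z n\<close> has \<open>n + 1\<close> factors, hence
  the index \<open>Suc n\<close>.\<close>

lemma pochhammer_eq_rGamma_series:
  "pochhammer (z :: complex) (Suc n) = rGamma_series z n * (fact n * exp (z * of_real (ln (real n))))"
  by (simp add: rGamma_series_def)

text \<open>The Pochhammer quotient is a convergent sequence times \<open>n\<close> to the power
  \<open>a + b - c\<close>; the factor \<open>Suc n\<close> turns \<open>fact (Suc n)\<close> into
  \<open>fact n\<close>, so that all factorials cancel.\<close>

lemma hyp2F1_coeff_bound:
  assumes c: "c \<notin> \<int>\<^sub>\<le>\<^sub>0"
  shows "\<exists>M. \<forall>n>0. real (Suc n) * norm (hyp2F1_coeff a b c (Suc n)) \<le> M * real n powr Re (a + b - c)"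
proof -
  define R where "R = (\<lambda>n. rGamma_series a n * rGamma_series b n / rGamma_series c n)"
  have "R \<longlonglongrightarrow> rGamma a * rGamma b / rGamma c"
    unfolding R_def using c by (intro tendsto_intros) (auto simp: rGamma_eq_zero_iff)
  then have "Bseq R"
    by (intro convergent_imp_Bseq convergentI)
  then obtain M where M: "\<And>n. norm (R n) \<le> M"
    by (auto simp: Bseq_def)
  have "real (Suc n) * norm (hyp2F1_coeff a b c (Suc n)) \<le> M * real n powr Re (a + b - c)"
    if n: "n > 0" for n
  proof -
    have "of_nat (Suc n) * hyp2F1_coeff a b c (Suc n) = R n * exp ((a + b - c) * of_real (ln (real n)))"
      unfolding hyp2F1_coeff_def pochhammer_eq_rGamma_series R_def
      by (simp add: divide_simps exp_diff exp_add ring_distribs del: of_nat_Suc)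
    then have "real (Suc n) * norm (hyp2F1_coeff a b c (Suc n))
        = norm (R n) * norm (exp ((a + b - c) * of_real (ln (real n))))"
      by (metis norm_mult norm_of_nat)
    also have "norm (exp ((a + b - c) * of_real (ln (real n)))) = real n powr Re (a + b - c)"
      using n by (simp add: powr_def mult.commute)
    finally show ?thesis using M[of n] by (simp add: mult_right_mono)
  qed
  then show ?thesis by blast
qed

text \<open>The first conclusion gives absolute convergence at the point 1, the second makes the
  boundary term of a telescoping sum vanish.\<close>

lemma
  assumes c: "c \<notin> \<int>\<^sub>\<le>\<^sub>0" and re: "Re (c - a - b) > 0"
  shows summable_norm_hyp2F1_coeff: "summable (\<lambda>n. norm (hyp2F1_coeff a b c n))"
    and tendsto_n_hyp2F1_coeff: "(\<lambda>n. of_nat n * hyp2F1_coeff a b c n) \<longlonglongrightarrow> 0"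
proof -
  obtain M where M: "\<And>n. n > 0 \<Longrightarrow>
      real (Suc n) * norm (hyp2F1_coeff a b c (Suc n)) \<le> M * real n powr Re (a + b - c)"
    using hyp2F1_coeff_bound[OF c, of a b] by blast
  have "summable (\<lambda>n. norm (hyp2F1_coeff a b c (Suc n)))"
  proof (rule summable_comparison_test)
    show "summable (\<lambda>n. M * real n powr (Re (a + b - c) - 1))"
      using re by (intro summable_mult) (simp add: summable_real_powr_iff)
    show "\<exists>N. \<forall>n\<ge>N. norm (norm (hyp2F1_coeff a b c (Suc n))) \<le> M * real n powr (Re (a + b - c) - 1)"
    proof (intro exI[of _ 1] allI impI)
      fix n :: nat assume n: "n \<ge> 1"
      have "real n * norm (hyp2F1_coeff a b c (Suc n)) \<le> real (Suc n) * norm (hyp2F1_coeff a b c (Suc n))"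
        by (intro mult_right_mono) auto
      also have "\<dots> \<le> M * real n powr Re (a + b - c)" using M n by simp
      finally have "norm (hyp2F1_coeff a b c (Suc n)) \<le> M * real n powr Re (a + b - c) / real n"
        using n by (subst pos_le_divide_eq) (auto simp: mult.commute)
      also have "\<dots> = M * real n powr (Re (a + b - c) - 1)"
        using n by (subst powr_diff) simp
      finally show "norm (norm (hyp2F1_coeff a b c (Suc n))) \<le> M * real n powr (Re (a + b - c) - 1)"
        by simp
    qed
  qed
  then show "summable (\<lambda>n. norm (hyp2F1_coeff a b c n))"
    by (subst (asm) summable_Suc_iff)
  have "(\<lambda>n. of_nat (Suc n) * hyp2F1_coeff a b c (Suc n)) \<longlonglongrightarrow> 0"
  proof (rule Lim_null_comparison)
    show "eventually (\<lambda>n. norm (of_nat (Suc n) * hyp2F1_coeff a b c (Suc n))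
            \<le> M * real n powr Re (a + b - c)) sequentially"
      using eventually_gt_at_top[of 0]
      by eventually_elim (use M in \<open>simp add: norm_mult del: of_nat_Suc\<close>)
    have "((\<lambda>n. M * real n powr Re (a + b - c)) \<longlonglongrightarrow> M * 0)"
      using re by (intro tendsto_mult tendsto_const tendsto_neg_powr filterlim_real_sequentially) auto
    then show "(\<lambda>n. M * real n powr Re (a + b - c)) \<longlonglongrightarrow> 0" by simp
  qed
  then show "(\<lambda>n. of_nat n * hyp2F1_coeff a b c n) \<longlonglongrightarrow> 0"
    by (subst (asm) filterlim_sequentially_Suc)
qed

lemma hyp2F1_coeff_contiguous:
  assumes c: "c \<notin> \<int>\<^sub>\<le>\<^sub>0"
  shows "(c - a) * (c - b) * hyp2F1_coeff a b (c + 1) n - c * (c - a - b) * hyp2F1_coeff a b c n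
       = c * (of_nat (Suc n) * hyp2F1_coeff a b c (Suc n) - of_nat n * hyp2F1_coeff a b c n)"
proof -
  have cn: "c + of_nat n \<noteq> 0" "c \<noteq> 0"
    using nonpos_Int_add_of_nat_neq_0[OF c, of n] nonpos_Int_add_of_nat_neq_0[OF c, of 0] by auto
  have "pochhammer (c + 1) n * c = pochhammer c n * (c + of_nat n)"
    using pochhammer_rec[of c n] by (simp add: pochhammer_Suc mult.commute)
  then have "pochhammer (c + 1) n = pochhammer c n * (c + of_nat n) / c"
    using cn by (simp add: field_simps)
  then have 1: "hyp2F1_coeff a b (c + 1) n = hyp2F1_coeff a b c n * c / (c + of_nat n)"
    using cn by (simp add: hyp2F1_coeff_def)
  have 2: "of_nat (Suc n) * hyp2F1_coeff a b c (Suc n)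
      = (a + of_nat n) * (b + of_nat n) * hyp2F1_coeff a b c n / (c + of_nat n)"
    using hyp2F1_coeff_Suc[OF c, of n a b] cn by (simp add: field_simps del: of_nat_Suc)
  \<comment> \<open>Both neighbouring coefficients are now rational multiples of
    \<open>hyp2F1_coeff a b c n\<close> with denominator \<open>c + of_nat n\<close>, so that a
    polynomial identity remains.\<close>
  show ?thesis unfolding 1 2 using cn by (simp add: divide_simps) algebra
qed

text \<open>The two sides of \<open>hyp2F1_coeff_contiguous\<close> sum to this because its right-hand side telescopes.\<close>

lemma Gauss_sum_contiguous:
  assumes c: "c \<notin> \<int>\<^sub>\<le>\<^sub>0" and re: "Re (c - a - b) > 0"
  shows "(c - a) * (c - b) * (\<Sum>n. hyp2F1_coeff a b (c + 1) n)
       = c * (c - a - b) * (\<Sum>n. hyp2F1_coeff a b c n)"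
proof -
  have c1: "c + 1 \<notin> \<int>\<^sub>\<le>\<^sub>0"
    using c plus_one_in_nonpos_Ints_imp by blast
  have s: "hyp2F1_coeff a b c sums (\<Sum>n. hyp2F1_coeff a b c n)"
    using summable_norm_cancel[OF summable_norm_hyp2F1_coeff[OF c re]] by (rule summable_sums)
  have s1: "hyp2F1_coeff a b (c + 1) sums (\<Sum>n. hyp2F1_coeff a b (c + 1) n)"
    using summable_norm_cancel[OF summable_norm_hyp2F1_coeff[OF c1, of a b]] re by (intro summable_sums) auto
  have "(\<lambda>n. c * (of_nat (Suc n) * hyp2F1_coeff a b c (Suc n) - of_nat n * hyp2F1_coeff a b c n))
          sums (c * (0 - of_nat 0 * hyp2F1_coeff a b c 0))"
    by (intro sums_mult telescope_sums tendsto_n_hyp2F1_coeff[OF c re])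
  moreover have "(\<lambda>n. c * (of_nat (Suc n) * hyp2F1_coeff a b c (Suc n) - of_nat n * hyp2F1_coeff a b c n))
       sums ((c - a) * (c - b) * (\<Sum>n. hyp2F1_coeff a b (c + 1) n)
              - c * (c - a - b) * (\<Sum>n. hyp2F1_coeff a b c n))"
    unfolding hyp2F1_coeff_contiguous[OF c, symmetric]
    by (intro sums_diff sums_mult s s1)
  ultimately show ?thesis
    using sums_unique2 by fastforce
qed

section \<open>The Gauss sum for a large lower parameter\<close>

lemma pochhammer_nonneg': "x \<ge> 0 \<Longrightarrow> pochhammer (x :: real) n \<ge> 0"
  unfolding pochhammer_prod by (intro prod_nonneg) auto

lemma norm_pochhammer_le: "norm (pochhammer (a :: complex) n) \<le> pochhammer (norm a) n"
proof (induction n)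
  case (Suc n)
  have "norm (a + of_nat n) \<le> norm a + real n"
    using norm_triangle_ineq[of a "of_nat n"] by simp
  then show ?case using Suc by (auto simp: pochhammer_Suc norm_mult intro!: mult_mono pochhammer_nonneg')
qed simp

lemma pochhammer_le_norm:
  assumes "0 \<le> C" "C \<le> Re c"
  shows "pochhammer C n \<le> norm (pochhammer c n)"
proof (induction n)
  case (Suc n)
  have "C + real n \<le> norm (c + of_nat n)"
    using assms complex_Re_le_cmod[of "c + of_nat n"] by simp
  then show ?case using Suc assms
    by (auto simp: pochhammer_Suc norm_mult intro!: mult_mono pochhammer_nonneg')
qed simp

text \<open>Every term except the one with index 0 tends to 0 as the lower parameter grows, and a
  convergent hypergeometric series with positive parameters dominates.\<close>

lemma Gauss_sum_tendsto_1:
  "(\<lambda>m. \<Sum>n. hyp2F1_coeff a b (c + of_nat m) n) \<longlonglongrightarrow> 1"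
proof -
  \<comment> \<open>The summand 1 makes the parameter excess of the dominating series equal to 1,
    hence positive, so that it converges.\<close>
  define C where "C = norm a + norm b + 1"
  have C: "C > 0" by (simp add: C_def add_nonneg_pos)
  define u where "u = hyp2F1_coeff (of_real (norm a)) (of_real (norm b)) (of_real C)"
  have Cn: "complex_of_real C \<notin> \<int>\<^sub>\<le>\<^sub>0"
    using C by (auto simp: nonpos_Ints_def complex_eq_iff)
  have sum: "summable (\<lambda>n. norm (u n))"
    unfolding u_def by (rule summable_norm_hyp2F1_coeff[OF Cn]) (simp add: C_def)
  have u: "norm (u n) = pochhammer (norm a) n * pochhammer (norm b) n / (pochhammer C n * fact n)" for n
    unfolding u_def hyp2F1_coeff_def pochhammer_of_real
    using C by (simp add: norm_mult norm_divide abs_of_nonneg pochhammer_nonneg')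
  obtain m0 where m0: "C - Re c \<le> real m0" using real_arch_simple by blast
  have "((\<lambda>m. \<Sum>n. hyp2F1_coeff a b (c + of_nat m) n) \<longlongrightarrow> (\<Sum>n. if n = 0 then 1 else 0)) sequentially"
  proof (rule tannerys_theorem[where M = "\<lambda>n. norm (u n)", THEN conjunct2, THEN conjunct2])
    show "eventually (\<lambda>(k, m). norm (hyp2F1_coeff a b (c + of_nat m) k) \<le> norm (u k))
            (at_top \<times>\<^sub>F sequentially)"
      unfolding eventually_prod_filter
    proof (intro exI conjI allI impI)
      show "eventually (\<lambda>_::nat. True) at_top" "eventually (\<lambda>m. m \<ge> m0) at_top"
        by (auto intro: eventually_ge_at_top)
      fix k m :: nat assume m: "m \<ge> m0"
      have "C \<le> Re (c + of_nat m)" using m0 m by simp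
      then have "pochhammer C k \<le> norm (pochhammer (c + of_nat m) k)"
        using C by (intro pochhammer_le_norm) auto
      moreover have "pochhammer C k > 0" using C by (simp add: pochhammer_pos)
      ultimately show "case (k, m) of (k, m) \<Rightarrow> norm (hyp2F1_coeff a b (c + of_nat m) k) \<le> norm (u k)"
        unfolding u by (auto simp: hyp2F1_coeff_def norm_mult norm_divide
            intro!: frac_le mult_mono norm_pochhammer_le mult_nonneg_nonneg pochhammer_nonneg')
    qed
    show "((\<lambda>m. hyp2F1_coeff a b (c + of_nat m) k) \<longlongrightarrow> (if k = 0 then 1 else 0)) sequentially" for k
    proof (cases k)
      case (Suc j)
      have inf: "filterlim (\<lambda>m. norm (pochhammer (c + of_nat m) (Suc j))) at_top sequentially"
      proof (rule filterlim_at_top_mono)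
        show "filterlim (\<lambda>m. real m + Re c) at_top sequentially"
          by real_asymp
        \<comment> \<open>The first factor of the Pochhammer symbol already tends to infinity, and
          the remaining ones do not decrease the product once \<open>real m + Re c\<close> is at
          least 1.\<close>
        show "eventually (\<lambda>m. real m + Re c \<le> norm (pochhammer (c + of_nat m) (Suc j))) sequentially"
        proof -
          have "eventually (\<lambda>m. real m + Re c \<ge> 1) sequentially" by real_asymp
          then show ?thesis
          proof eventually_elim
            case (elim m)
            have "pochhammer (real m + Re c) (Suc j) \<le> norm (pochhammer (c + of_nat m) (Suc j))"
              using elim by (intro pochhammer_le_norm) auto
            moreover have "real m + Re c \<le> (real m + Re c) * pochhammer (real m + Re c + 1) j"
            proof -
              have "1 \<le> pochhammer (real m + Re c + 1) j"
              proof -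
                show ?thesis unfolding pochhammer_prod using elim by (intro prod_ge_1) auto
              qed
              then show ?thesis using elim by (simp add: mult_le_cancel_left1)
            qed
            ultimately show ?case by (simp add: pochhammer_rec)
          qed
        qed
      qed
      have "(\<lambda>m. (pochhammer a k * pochhammer b k / fact k) * inverse (pochhammer (c + of_nat m) k)) \<longlonglongrightarrow>
               (pochhammer a k * pochhammer b k / fact k) * 0"
        by (intro tendsto_mult tendsto_const tendsto_inverse_0[THEN filterlim_compose]
            filterlim_norm_at_top_imp_at_infinity) (use inf Suc in simp)
      then show ?thesis using Suc by (simp add: hyp2F1_coeff_def field_simps)
    qed (simp add: hyp2F1_coeff_def)
  qed (use sum in auto)
  then show ?thesis
    using sums_single[of 0 "\<lambda>_. 1 :: complex"] by (simp add: sums_iff)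
qed

lemma add_of_nat_notin_nonpos_Ints:
  "c \<notin> \<int>\<^sub>\<le>\<^sub>0 \<Longrightarrow> c + of_nat m \<notin> (\<int>\<^sub>\<le>\<^sub>0 :: complex set)"
proof (induction m)
  case (Suc m)
  then show ?case
    using plus_one_in_nonpos_Ints_imp[of "c + of_nat m"] by (auto simp: add_ac)
qed simp

lemma Re_pos_notin_nonpos_Ints: "Re z > 0 \<Longrightarrow> z \<notin> \<int>\<^sub>\<le>\<^sub>0"
  by (auto elim!: nonpos_Ints_cases)

text \<open>Iterating the contiguous relation pushes \<open>c\<close> to
  \<open>c + of_nat m\<close>, where the sum tends to 1. The Pochhammer symbols left behind become
  Gamma functions in the limit.\<close>

lemma Gauss_sum:
  assumes c: "c \<notin> \<int>\<^sub>\<le>\<^sub>0" and re: "Re (c - a - b) > 0"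
  shows "(\<Sum>n. hyp2F1_coeff a b c n) = Gamma c * Gamma (c - a - b) * rGamma (c - a) * rGamma (c - b)"
proof -
  let ?G = "\<lambda>c. \<Sum>n. hyp2F1_coeff a b c n"
  have *: "pochhammer (c - a) m * pochhammer (c - b) m * ?G (c + of_nat m)
          = pochhammer c m * pochhammer (c - a - b) m * ?G c" for m
  proof (induction m)
    case (Suc m)
    have cm: "c + of_nat m \<notin> \<int>\<^sub>\<le>\<^sub>0" using c by (rule add_of_nat_notin_nonpos_Ints)
    have "pochhammer (c - a) (Suc m) * pochhammer (c - b) (Suc m) * ?G (c + of_nat (Suc m))
        = pochhammer (c - a) m * pochhammer (c - b) m *
          (((c + of_nat m) - a) * ((c + of_nat m) - b) * ?G ((c + of_nat m) + 1))"
      by (simp add: pochhammer_Suc algebra_simps)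
    also have "\<dots> = (c + of_nat m) * (c + of_nat m - a - b) * (pochhammer (c - a) m * pochhammer (c - b) m *
          ?G (c + of_nat m))"
      using re by (subst Gauss_sum_contiguous[OF cm]) auto
    also have "\<dots> = pochhammer c (Suc m) * pochhammer (c - a - b) (Suc m) * ?G c"
      unfolding Suc.IH by (simp add: pochhammer_Suc algebra_simps)
    finally show ?case .
  qed simp
  have eq: "rGamma_series (c - a) n * rGamma_series (c - b) n * ?G (c + of_nat (Suc n))
           = rGamma_series c n * rGamma_series (c - a - b) n * ?G c" for n
  proof -
    define e where "e = (\<lambda>z::complex. fact n * exp (z * of_real (ln (real n))))"
    \<comment> \<open>The normalising powers of \<open>n\<close> cancel because the exponents on
      both sides add up to \<open>2 * c - a - b\<close>.\<close>
    have e: "e (c - a) * e (c - b) = e c * e (c - a - b)"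
      unfolding e_def by (simp add: algebra_simps flip: exp_add)
    have nz: "e c * e (c - a - b) \<noteq> 0" by (simp add: e_def)
    have "(rGamma_series (c - a) n * rGamma_series (c - b) n * ?G (c + of_nat (Suc n))) * (e (c - a) * e (c - b))
       = (rGamma_series c n * rGamma_series (c - a - b) n * ?G c) * (e c * e (c - a - b))"
      using *[of "Suc n"] unfolding pochhammer_eq_rGamma_series e_def by (simp only: mult_ac)
    then show ?thesis unfolding e using nz by (metis mult_right_cancel)
  qed
  have "(\<lambda>n. rGamma_series (c - a) n * rGamma_series (c - b) n * ?G (c + of_nat (Suc n)))
     \<longlonglongrightarrow> rGamma (c - a) * rGamma (c - b) * 1"
    by (intro tendsto_mult rGamma_series_LIMSEQ LIMSEQ_Suc[OF Gauss_sum_tendsto_1])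
  moreover have "(\<lambda>n. rGamma_series c n * rGamma_series (c - a - b) n * ?G c)
     \<longlonglongrightarrow> rGamma c * rGamma (c - a - b) * ?G c"
    by (intro tendsto_intros)
  ultimately have "rGamma (c - a) * rGamma (c - b) * 1 = rGamma c * rGamma (c - a - b) * ?G c"
    unfolding eq using LIMSEQ_unique by blast
  moreover have "rGamma c \<noteq> 0" "rGamma (c - a - b) \<noteq> 0"
    using c Re_pos_notin_nonpos_Ints[OF re] by (auto simp: rGamma_eq_zero_iff)
  ultimately show ?thesis by (simp add: Gamma_def field_simps)
qed

text \<open>Abel's limit theorem; for an absolutely convergent series it is dominated
  convergence.\<close>

lemma hyp2F1_tendsto_at_1:
  assumes c: "c \<notin> \<int>\<^sub>\<le>\<^sub>0" and re: "Re (c - a - b) > 0"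
  shows "((\<lambda>s. hyp2F1 a b c (of_real s)) \<longlongrightarrow> Gamma c * Gamma (c - a - b) * rGamma (c - a) * rGamma (c - b))
           (at_left 1)"
proof -
  have "((\<lambda>s. \<Sum>n. hyp2F1_coeff a b c n * of_real s ^ n) \<longlongrightarrow> (\<Sum>n. hyp2F1_coeff a b c n)) (at_left (1::real))"
  proof (rule tannerys_theorem[where M = "\<lambda>n. norm (hyp2F1_coeff a b c n)", THEN conjunct2, THEN conjunct2])
    show "((\<lambda>s. hyp2F1_coeff a b c k * of_real s ^ k) \<longlongrightarrow> hyp2F1_coeff a b c k) (at_left (1::real))" for k
      by (auto intro!: tendsto_eq_intros)
    show "eventually (\<lambda>(k, s). norm (hyp2F1_coeff a b c k * of_real s ^ k) \<le> norm (hyp2F1_coeff a b c k))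
            (at_top \<times>\<^sub>F at_left (1::real))"
      unfolding eventually_prod_filter
    proof (intro exI conjI allI impI)
      show "eventually (\<lambda>_::nat. True) at_top" by simp
      show "eventually (\<lambda>s. s \<in> {0<..<1}) (at_left (1::real))"
        by (rule eventually_at_left_real) simp
      fix k :: nat and s :: real assume "s \<in> {0<..<1}"
      then show "case (k, s) of (k, s) \<Rightarrow> norm (hyp2F1_coeff a b c k * of_real s ^ k) \<le> norm (hyp2F1_coeff a b c k)"
        by (auto simp: norm_mult norm_power power_le_one intro!: mult_left_le)
    qed
  qed (use summable_norm_hyp2F1_coeff[OF c re] in auto)
  moreover have "eventually (\<lambda>s. (\<Sum>n. hyp2F1_coeff a b c n * of_real s ^ n) = hyp2F1 a b c (of_real s))
      (at_left (1::real))"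
    using eventually_at_left_real[of 0 1]
    by (rule eventually_mono) (use hyp2F1_sums[OF c] in \<open>auto simp: sums_iff\<close>)
  ultimately show ?thesis
    unfolding Gauss_sum[OF c re] by (rule Lim_transform_eventually)
qed

section \<open>Connection formula between 0 and 1\<close>

text \<open>Away from 0 and 1 the equation can be solved for the second derivative. Leibniz's rule
  then expresses each higher derivative at \<open>z0\<close> through lower ones, so all of them
  vanish.\<close>

lemma hypergeom_ode_unique_zero:
  assumes f: "hypergeom_ode a b c S f" and S: "open S" "connected S" "0 \<notin> S" "1 \<notin> S"
    and z0: "z0 \<in> S" "f z0 = 0" "deriv f z0 = 0" and z: "z \<in> S"
  shows "f z = 0"
proof -
  define p where "p = (\<lambda>z. - (c - (a + b + 1) * z) / (z * (1 - z)))"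
  define q where "q = (\<lambda>z. a * b / (z * (1 - z)))"
  have nz: "w * (1 - w) \<noteq> 0" if "w \<in> S" for w using S that by auto
  have hol: "f holomorphic_on S" "deriv f holomorphic_on S" "p holomorphic_on S" "q holomorphic_on S"
    using f S nz by (auto simp: hypergeom_ode_def p_def q_def intro!: holomorphic_intros holomorphic_deriv)
  have ode: "deriv (deriv f) w = p w * deriv f w + q w * f w" if w: "w \<in> S" for w
  proof -
    have "w * (1 - w) * deriv (deriv f) w = - (c - (a + b + 1) * w) * deriv f w + a * b * f w"
      using f w unfolding hypergeom_ode_def by (auto simp: algebra_simps)
    then have "deriv (deriv f) w = (- (c - (a + b + 1) * w) * deriv f w + a * b * f w) / (w * (1 - w))"
      using nz[OF w] by (metis nonzero_mult_div_cancel_left)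
    then show ?thesis by (simp add: p_def q_def add_divide_distrib)
  qed
  have "(deriv ^^ n) f z0 = 0" for n
  proof (induction n rule: less_induct)
    case (less n)
    show ?case
    proof (cases "n < 2")
      case True
      then show ?thesis using z0 less_2_cases by fastforce
    next
      case False
      then obtain m where m: "n = Suc (Suc m)" by (metis Suc_diff_Suc diff_Suc_1 less_2_cases_iff not0_implies_Suc One_nat_def)
      have "(deriv ^^ n) f z0 = (deriv ^^ m) (deriv (deriv f)) z0"
        unfolding m funpow_Suc_right by simp
      also have "\<dots> = (deriv ^^ m) (\<lambda>w. p w * deriv f w + q w * f w) z0"
        using ode by (intro higher_deriv_cong_ev eventually_mono[OF eventually_nhds_in_open[OF S(1) z0(1)]]) auto
      also have "\<dots> = (deriv ^^ m) (\<lambda>w. p w * deriv f w) z0 + (deriv ^^ m) (\<lambda>w. q w * f w) z0"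
        using hol S(1) z0(1) by (intro higher_deriv_add[of _ S]) (auto intro!: holomorphic_intros)
      also have "(deriv ^^ m) (\<lambda>w. p w * deriv f w) z0
          = (\<Sum>i = 0..m. of_nat (m choose i) * (deriv ^^ i) p z0 * (deriv ^^ (m - i)) (deriv f) z0)"
        using hol S(1) z0(1) by (intro higher_deriv_mult[of _ S]) auto
      also have "\<dots> = 0"
      proof (intro sum.neutral ballI)
        fix i assume "i \<in> {0..m}"
        have "(deriv ^^ (m - i)) (deriv f) z0 = (deriv ^^ Suc (m - i)) f z0"
          unfolding funpow_Suc_right by simp
        then show "of_nat (m choose i) * (deriv ^^ i) p z0 * (deriv ^^ (m - i)) (deriv f) z0 = 0"
          using less[of "Suc (m - i)"] m by simp
      qed
      also have "(deriv ^^ m) (\<lambda>w. q w * f w) z0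
          = (\<Sum>i = 0..m. of_nat (m choose i) * (deriv ^^ i) q z0 * (deriv ^^ (m - i)) f z0)"
        using hol S(1) z0(1) by (intro higher_deriv_mult[of _ S]) auto
      also have "\<dots> = 0"
        using less m by (intro sum.neutral ballI) auto
      finally show ?thesis by simp
    qed
  qed
  then show ?thesis
    using holomorphic_fun_eq_0_on_connected[OF hol(1) S(1,2) _ z0(1) z] by blast
qed

lemma deriv_linear_combination:
  assumes "open S" "f holomorphic_on S" "g holomorphic_on S" "z \<in> S"
  shows "deriv (\<lambda>z. x * f z + y * g z) z = x * deriv f z + y * deriv g z"
  by (rule DERIV_imp_deriv) (use assms in \<open>auto intro!: derivative_eq_intros holomorphic_derivI\<close>)

lemma hypergeom_ode_linear_combination:
  assumes S: "open S" and f: "hypergeom_ode a b c S f" and g: "hypergeom_ode a b c S g"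
  shows "hypergeom_ode a b c S (\<lambda>z. x * f z + y * g z)"
  unfolding hypergeom_ode_def
proof (intro conjI ballI)
  have hol: "f holomorphic_on S" "g holomorphic_on S"
    using f g by (auto simp: hypergeom_ode_def)
  then show "(\<lambda>z. x * f z + y * g z) holomorphic_on S" by (intro holomorphic_intros)
  fix z assume z: "z \<in> S"
  note d = deriv_linear_combination[OF S hol]
  have "deriv (deriv (\<lambda>z. x * f z + y * g z)) z = deriv (\<lambda>z. x * deriv f z + y * deriv g z) z"
    using d by (intro deriv_cong_ev refl eventually_mono[OF eventually_nhds_in_open[OF S z]]) auto
  also have "\<dots> = x * deriv (deriv f) z + y * deriv (deriv g) z"
    by (rule deriv_linear_combination[OF S _ _ z]) (use hol S in \<open>auto intro!: holomorphic_deriv\<close>)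
  finally have dd: "deriv (deriv (\<lambda>z. x * f z + y * g z)) z = x * deriv (deriv f) z + y * deriv (deriv g) z" .
  have "z * (1 - z) * deriv (deriv f) z + (c - (a + b + 1) * z) * deriv f z + - (a * b) * f z = 0"
    "z * (1 - z) * deriv (deriv g) z + (c - (a + b + 1) * z) * deriv g z + - (a * b) * g z = 0"
    using f g z unfolding hypergeom_ode_def by auto
  then show "z * (1 - z) * deriv (deriv (\<lambda>z. x * f z + y * g z)) z
      + (c - (a + b + 1) * z) * deriv (\<lambda>z. x * f z + y * g z) z
      + - (a * b) * (x * f z + y * g z) = 0"
    unfolding dd d[OF z] by algebra
qed

text \<open>Independence is required of the functions, which is easy to verify by limits, and no
  Wronskian has to be computed: it is nonzero as a consequence, and Cramer's rule for the initial
  data at \<open>z0\<close> gives the coefficients.\<close>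

lemma hypergeom_ode_basis:
  assumes S: "open S" "connected S" "0 \<notin> S" "1 \<notin> S" "z0 \<in> S"
    and f: "hypergeom_ode a b c S f"
    and g: "hypergeom_ode a b c S g" and h: "hypergeom_ode a b c S h"
    and indep: "\<And>x y. (\<And>z. z \<in> S \<Longrightarrow> x * g z + y * h z = 0) \<Longrightarrow> x = 0 \<and> y = 0"
  obtains x y where "\<And>z. z \<in> S \<Longrightarrow> f z = x * g z + y * h z"
proof -
  have hol: "f holomorphic_on S" "g holomorphic_on S" "h holomorphic_on S"
    using f g h by (auto simp: hypergeom_ode_def)
  define W where "W = g z0 * deriv h z0 - h z0 * deriv g z0"
  have zero: "x = 0 \<and> y = 0" if "x * g z0 + y * h z0 = 0" "x * deriv g z0 + y * deriv h z0 = 0" for x y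
  proof (rule indep)
    fix z assume "z \<in> S"
    show "x * g z + y * h z = 0"
      by (rule hypergeom_ode_unique_zero[OF hypergeom_ode_linear_combination[OF S(1) g h]
              S(1-5) that(1) _ \<open>z \<in> S\<close>])
        (use that deriv_linear_combination[OF S(1) hol(2,3) S(5)] in simp)
  qed
  \<comment> \<open>If \<open>W\<close> were 0, the coefficient pairs \<open>(h z0, - g z0)\<close>
    and \<open>(deriv h z0, - deriv g z0)\<close> would give combinations with zero initial data.
    All four numbers would vanish, and the pair (1, 1) would contradict independence.\<close>
  have W: "W \<noteq> 0"
  proof
    assume "W = 0"
    then have "h z0 = 0 \<and> - g z0 = 0"
      by (intro zero) (auto simp: W_def algebra_simps)
    moreover from \<open>W = 0\<close> have "deriv h z0 = 0 \<and> - deriv g z0 = 0"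
      by (intro zero) (auto simp: W_def algebra_simps)
    ultimately show False using zero[of 1 1] by simp
  qed
  define x where "x = (f z0 * deriv h z0 - h z0 * deriv f z0) / W"
  define y where "y = (g z0 * deriv f z0 - f z0 * deriv g z0) / W"
  have xy: "f z0 = x * g z0 + y * h z0" "deriv f z0 = x * deriv g z0 + y * deriv h z0"
    unfolding x_def y_def using W by (simp_all add: field_simps) (simp_all add: W_def algebra_simps)
  let ?k = "\<lambda>z. 1 * f z + (- 1) * (x * g z + y * h z)"
  have gh: "hypergeom_ode a b c S (\<lambda>z. x * g z + y * h z)"
    by (rule hypergeom_ode_linear_combination[OF S(1) g h])
  have "?k z = 0" if "z \<in> S" for z
  proof (rule hypergeom_ode_unique_zero[OF hypergeom_ode_linear_combination[OF S(1) f gh] S(1-5) _ _ that])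
    show "?k z0 = 0" using xy by simp
    have "deriv ?k z0 = 1 * deriv f z0 + (- 1) * deriv (\<lambda>z. x * g z + y * h z) z0"
      by (rule deriv_linear_combination[OF S(1) hol(1) _ S(5)]) (intro holomorphic_intros hol)
    then show "deriv ?k z0 = 0"
      using deriv_linear_combination[OF S(1) hol(2,3) S(5), of x y] xy by simp
  qed
  then have "f z = x * g z + y * h z" if "z \<in> S" for z
    using that by (simp add: algebra_simps)
  then show ?thesis using that by blast
qed

section \<open>Exponent difference one half at the point 1\<close>

abbreviation two_cut_plane :: "complex set" where
  "two_cut_plane \<equiv> - complex_of_real ` ({..0} \<union> {1..})"

lemma two_cut_plane_eq: "two_cut_plane = cut_plane \<inter> {s. 1 - s \<in> cut_plane}"
  by (auto simp: image_Un complex_slot_right_eq complex_slot_left_eq)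

lemma open_doubly_cut_plane: "open (- complex_of_real ` ({..x} \<union> {y..}))"
  unfolding image_Un by (intro open_Compl closed_Un closed_slot_left closed_slot_right)

lemma connected_doubly_cut_plane: "x < y \<Longrightarrow> connected (- complex_of_real ` ({..x} \<union> {y..}))"
  by (intro starlike_imp_connected starlike_doubly_slotted_complex_plane)

lemma of_real_mem_two_cut_plane: "0 < s \<Longrightarrow> s < 1 \<Longrightarrow> complex_of_real s \<in> two_cut_plane"
  by auto

lemma half_notin_nonpos_Ints: "(1 / 2 :: complex) \<notin> \<int>\<^sub>\<le>\<^sub>0" "(3 / 2 :: complex) \<notin> \<int>\<^sub>\<le>\<^sub>0"
  by (rule Re_pos_notin_nonpos_Ints; simp)+

lemma eventually_at_left_1: "eventually (\<lambda>s::real. 0 < s \<and> s < 1) (at_left 1)"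
  using eventually_at_left_real[of 0 1] by (simp add: greaterThanLessThan_def conj_commute)

lemma tendsto_compose_at_left_1:
  assumes "f holomorphic_on cut_plane"
  shows "((\<lambda>s. f (1 - complex_of_real s)) \<longlongrightarrow> f 0) (at_left 1)"
proof -
  have "isCont f 0"
    using assms open_cut_plane ball_subset_cut_plane
    by (metis (no_types) centre_in_ball continuous_on_eq_continuous_at holomorphic_on_imp_continuous_on
        subsetD zero_less_one)
  moreover have "((\<lambda>s. 1 - complex_of_real s) \<longlongrightarrow> 0) (at_left 1)"
    by (auto intro!: tendsto_eq_intros)
  ultimately show ?thesis by (rule isCont_tendsto_compose)
qed

text \<open>The exponents at 1 are 0 and 1/2, so no logarithm can occur for any \<open>a\<close> and
  \<open>b\<close>. The coefficients are found from the limits at 1 of the function and of its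
  derivative times (1 - s)^(1/2). The factor -2 is the quotient of Gamma(-1/2) by
  Gamma(1/2).\<close>

lemma hyp2F1_connection_half:
  assumes c_eq: "c = a + b + 1 / 2" and c: "c \<notin> \<int>\<^sub>\<le>\<^sub>0" and s: "s \<in> two_cut_plane"
  shows "hyp2F1 a b c s = Gamma c * Gamma (1 / 2)
           * (rGamma (a + 1 / 2) * rGamma (b + 1 / 2) * hyp2F1 a b (1 / 2) (1 - s)
              - 2 * rGamma a * rGamma b * ((1 - s) powr (1 / 2) * hyp2F1 (a + 1 / 2) (b + 1 / 2) (3 / 2) (1 - s)))"
proof -
  let ?S = two_cut_plane
  let ?F = "hyp2F1 a b c"
  define K where "K = hyp2F1 a b (1 / 2)"
  define H where "H = hyp2F1 (a + 1 / 2) (b + 1 / 2) (3 / 2)"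
  define G1 where "G1 = (\<lambda>s::complex. K (1 - s))"
  define G2 where "G2 = (\<lambda>s::complex. (1 - s) powr (1 / 2) * H (1 - s))"
  note half = half_notin_nonpos_Ints
  have S: "open ?S" "connected ?S" "0 \<notin> ?S" "1 \<notin> ?S" "1 / 2 \<in> ?S"
    using open_doubly_cut_plane connected_doubly_cut_plane[of 0 1] of_real_mem_two_cut_plane[of "1 / 2"]
    by force+
  have mem: "w \<in> cut_plane" "1 - w \<in> cut_plane" if "w \<in> ?S" for w
    using that unfolding two_cut_plane_eq by auto
  have KH: "K holomorphic_on cut_plane" "H holomorphic_on cut_plane" "K 0 = 1" "H 0 = 1"
    unfolding K_def H_def using half by (auto intro: holomorphic_on_hyp2F1 hyp2F1_0)
  have dKH: "deriv K holomorphic_on cut_plane" "deriv H holomorphic_on cut_plane"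
    using KH open_cut_plane by (auto intro: holomorphic_deriv)
  have nonpos: "1 - w \<notin> \<real>\<^sub>\<le>\<^sub>0" "1 - w \<noteq> 0" if "w \<in> ?S" for w
    using one_minus_cut_plane[OF mem(1)[OF that]] by auto
  have ode: "hypergeom_ode a b c ?S ?F"
    using hypergeom_ode_subset[OF hypergeom_ode_hyp2F1[OF c]] mem by blast
  have ode1: "hypergeom_ode a b c ?S G1"
  proof -
    have "hypergeom_ode a b c ?S (\<lambda>s. 1 * K (1 - s))"
      unfolding K_def
      by (rule hypergeom_ode_pullback[OF S(1) open_cut_plane hypergeom_ode_hyp2F1[OF half(1)],
            where ?\<phi>1.0 = "\<lambda>_. - 1" and ?\<phi>2.0 = "\<lambda>_. 0" and \<kappa> = "\<lambda>_. 1"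
              and l = "\<lambda>_. 0" and l' = "\<lambda>_. 0"])
         (use mem in \<open>auto intro!: derivative_eq_intros simp: c_eq algebra_simps\<close>)
    then show ?thesis by (simp add: G1_def)
  qed
  have ode2: "hypergeom_ode a b c ?S G2"
    unfolding G2_def H_def
  proof (rule hypergeom_ode_pullback[OF S(1) open_cut_plane hypergeom_ode_hyp2F1[OF half(2)],
        where ?\<phi>1.0 = "\<lambda>_. - 1" and ?\<phi>2.0 = "\<lambda>_. 0" and \<kappa> = "\<lambda>_. 1"
          and l = "\<lambda>s. 1 / 2 * (- 1) / (1 - s)" and l' = "\<lambda>s. - 1 / 2 / (1 - s)\<^sup>2"])
    fix w assume w: "w \<in> ?S"
    note nz = nonpos(2)[OF w]
    show "((\<lambda>s. (1 - s) powr (1 / 2)) has_field_derivative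
             1 / 2 * (- 1) / (1 - w) * (1 - w) powr (1 / 2)) (at w)"
      by (rule powr_log_derivative[where u = "\<lambda>z. 1 - z", OF _ nonpos(1)[OF w]])
         (auto intro!: derivative_eq_intros)
    show "((\<lambda>s. 1 / 2 * (- 1) / (1 - s)) has_field_derivative - 1 / 2 / (1 - w)\<^sup>2) (at w)"
      using nz by (auto intro!: derivative_eq_intros simp: power2_eq_square divide_simps)
        (simp add: algebra_simps)
    show "w * (1 - w) * (2 * (1 / 2 * - 1 / (1 - w)) * - 1 + 0) + (c - (a + b + 1) * w) * - 1
        = 1 * (3 / 2 - (a + 1 / 2 + (b + 1 / 2) + 1) * (1 - w))"
      unfolding c_eq using nz by (simp add: divide_simps) algebra
    show "w * (1 - w) * ((1 / 2 * - 1 / (1 - w))\<^sup>2 + - 1 / 2 / (1 - w)\<^sup>2)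
         + (c - (a + b + 1) * w) * (1 / 2 * - 1 / (1 - w)) + - (a * b)
        = 1 * - ((a + 1 / 2) * (b + 1 / 2))"
      unfolding c_eq using nz by (simp add: divide_simps) algebra
  qed (use mem in \<open>auto intro!: derivative_eq_intros simp: algebra_simps\<close>)
  have ev: "eventually (\<lambda>s. complex_of_real s \<in> ?S) (at_left 1)"
    using eventually_at_left_1 by eventually_elim (use of_real_mem_two_cut_plane in blast)
  have lim_sqrt: "((\<lambda>s. (1 - complex_of_real s) powr (1 / 2)) \<longlongrightarrow> 0) (at_left 1)"
  proof -
    have "((\<lambda>s. complex_of_real ((1 - s) powr (1 / 2))) \<longlongrightarrow> of_real 0) (at_left 1)"
    proof (rule tendsto_of_real)
      show "((\<lambda>s::real. (1 - s) powr (1 / 2)) \<longlongrightarrow> 0) (at_left 1)" by real_asymp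
    qed
    moreover have "eventually (\<lambda>s. complex_of_real ((1 - s) powr (1 / 2))
        = (1 - complex_of_real s) powr (1 / 2)) (at_left 1)"
      using eventually_at_left_1 by eventually_elim (simp flip: powr_of_real)
    ultimately show ?thesis using Lim_transform_eventually by fastforce
  qed
  have lim1: "((\<lambda>s. G1 (of_real s)) \<longlongrightarrow> 1) (at_left 1)"
    unfolding G1_def using tendsto_compose_at_left_1[OF KH(1)] KH by simp
  have limH: "((\<lambda>s. H (1 - of_real s)) \<longlongrightarrow> 1) (at_left 1)"
    using tendsto_compose_at_left_1[OF KH(2)] KH by simp
  have lim2: "((\<lambda>s. G2 (of_real s)) \<longlongrightarrow> 0) (at_left 1)"
    unfolding G2_def using tendsto_mult[OF lim_sqrt limH] by simp
  \<comment> \<open>As the argument tends to 1, \<open>G1\<close> tends to 1 and \<open>G2\<close>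
    to 0, which isolates \<open>x\<close>; after division by the root the limit of \<open>H\<close>
    isolates \<open>y\<close>.\<close>
  have indep: "x = 0 \<and> y = 0" if zero: "\<And>w. w \<in> ?S \<Longrightarrow> x * G1 w + y * G2 w = 0" for x y
  proof -
    have "((\<lambda>s. x * G1 (of_real s) + y * G2 (of_real s)) \<longlongrightarrow> x * 1 + y * 0) (at_left 1)"
      by (intro tendsto_intros lim1 lim2)
    moreover have "eventually (\<lambda>s. x * G1 (of_real s) + y * G2 (of_real s) = 0) (at_left 1)"
      using ev by eventually_elim (rule zero)
    ultimately have "((\<lambda>s::real. 0) \<longlongrightarrow> x) (at_left 1)"
      using Lim_transform_eventually by fastforce
    then have x: "x = 0"
      using tendsto_unique[OF trivial_limit_at_left_real] tendsto_const by blast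
    have "((\<lambda>s. y * H (1 - of_real s)) \<longlongrightarrow> y * 1) (at_left 1)"
      by (intro tendsto_intros limH)
    moreover have "eventually (\<lambda>s. y * H (1 - of_real s) = 0) (at_left 1)"
      using ev
    proof eventually_elim
      case (elim s)
      have "(1 - complex_of_real s) powr (1 / 2) \<noteq> 0"
        unfolding powr_def using nonpos(2)[OF elim] by (simp only: if_False exp_not_eq_zero not_False_eq_True)
      then show ?case
        using zero[OF elim] unfolding x G2_def by (auto simp only: mult_zero_left add_0 mult_eq_0_iff)
    qed
    ultimately have "((\<lambda>s::real. 0) \<longlongrightarrow> y) (at_left 1)"
      using Lim_transform_eventually by fastforce
    then have "y = 0"
      using tendsto_unique[OF trivial_limit_at_left_real] tendsto_const by blast
    with x show ?thesis by simp
  qed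
  obtain x y where xy: "\<And>w. w \<in> ?S \<Longrightarrow> ?F w = x * G1 w + y * G2 w"
    using hypergeom_ode_basis[OF S ode ode1 ode2 indep] by blast
  have cab: "c - a - b = 1 / 2" "c - a = b + 1 / 2" "c - b = a + 1 / 2" by (auto simp: c_eq)
  have x: "x = Gamma c * Gamma (1 / 2) * rGamma (b + 1 / 2) * rGamma (a + 1 / 2)"
  proof -
    have L: "((\<lambda>s. ?F (of_real s)) \<longlongrightarrow> Gamma c * Gamma (1 / 2) * rGamma (b + 1 / 2) * rGamma (a + 1 / 2)) (at_left 1)"
      using hyp2F1_tendsto_at_1[OF c, of a b] unfolding cab by simp
    have "((\<lambda>s. x * G1 (of_real s) + y * G2 (of_real s)) \<longlongrightarrow> x * 1 + y * 0) (at_left 1)"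
      by (intro tendsto_intros lim1 lim2)
    moreover have "eventually (\<lambda>s. x * G1 (of_real s) + y * G2 (of_real s) = ?F (of_real s)) (at_left 1)"
      using ev by eventually_elim (use xy in simp)
    ultimately have "((\<lambda>s. ?F (of_real s)) \<longlongrightarrow> x * 1 + y * 0) (at_left 1)"
      by (rule Lim_transform_eventually)
    from tendsto_unique[OF trivial_limit_at_left_real this L] show ?thesis by simp
  qed
  have c1: "c + 1 \<notin> \<int>\<^sub>\<le>\<^sub>0" using add_of_nat_notin_nonpos_Ints[OF c, of 1] by simp
  have c0: "c \<noteq> 0" using c by auto
  \<comment> \<open>The derivative is singular at 1, but its product with the root is not:
    \<open>?E\<close> is that product for \<open>x * G1 + y * G2\<close>, with limit
    \<open>- y / 2\<close>.\<close>
  have y: "y = - 2 * (Gamma c * Gamma (1 / 2) * rGamma a * rGamma b)"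
  proof -
    let ?R = "\<lambda>s. (1 - complex_of_real s) powr (1 / 2)"
    let ?E = "\<lambda>s. x * (- deriv K (1 - of_real s)) * ?R s
       + y * (- (1 / 2) * H (1 - of_real s) - (1 - of_real s) * deriv H (1 - of_real s))"
    have "eventually (\<lambda>s. ?E s = a * b / c * hyp2F1 (b + 1 / 2) (a + 1 / 2) (c + 1) (of_real s)) (at_left 1)"
      using ev
    proof eventually_elim
      case (elim s)
      define w where "w = complex_of_real s"
      have w: "w \<in> ?S" using elim by (simp add: w_def)
      define r where "r = (1 - w) powr (1 / 2)"
      have r: "r \<noteq> 0" "r * r = 1 - w"
        using nonpos(2)[OF w] by (auto simp: r_def simp flip: powr_add)
      have dK: "(K has_field_derivative deriv K (1 - w)) (at (1 - w))"
        "(H has_field_derivative deriv H (1 - w)) (at (1 - w))"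
        using KH mem(2)[OF w] open_cut_plane by (auto intro: holomorphic_derivI)
      have d1: "(G1 has_field_derivative deriv K (1 - w) * - 1) (at w)"
        unfolding G1_def by (rule DERIV_chain2[where g = "\<lambda>s. 1 - s", OF dK(1)]) (auto intro!: derivative_eq_intros)
      have "((\<lambda>s. H (1 - s)) has_field_derivative deriv H (1 - w) * - 1) (at w)"
        by (rule DERIV_chain2[where g = "\<lambda>s. 1 - s", OF dK(2)]) (auto intro!: derivative_eq_intros)
      moreover have "((\<lambda>s. (1 - s) powr (1 / 2)) has_field_derivative (1 / 2 * (- 1) / (1 - w)) * r) (at w)"
        unfolding r_def
        by (rule powr_log_derivative[where u = "\<lambda>z. 1 - z", OF _ nonpos(1)[OF w]])
           (auto intro!: derivative_eq_intros)
      ultimately have d2: "(G2 has_field_derivative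
          (1 / 2 * (- 1) / (1 - w)) * r * H (1 - w) + deriv H (1 - w) * - 1 * r) (at w)"
        unfolding G2_def r_def by (intro DERIV_mult)
      have dx: "((\<lambda>w. x * G1 w + y * G2 w) has_field_derivative x * (deriv K (1 - w) * - 1)
           + y * ((1 / 2 * (- 1) / (1 - w)) * r * H (1 - w) + deriv H (1 - w) * - 1 * r)) (at w)"
        by (intro DERIV_add DERIV_cmult d1 d2)
      have eq: "deriv ?F w = deriv (\<lambda>w. x * G1 w + y * G2 w) w"
        using xy by (intro deriv_cong_ev refl eventually_mono[OF eventually_nhds_in_open[OF S(1) w]]) auto
      have D1: "deriv ?F w = x * (deriv K (1 - w) * - 1)
           + y * ((1 / 2 * (- 1) / (1 - w)) * r * H (1 - w) + deriv H (1 - w) * - 1 * r)"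
        unfolding eq by (rule DERIV_imp_deriv[OF dx])
      \<comment> \<open>The differentiated series has parameter excess -1/2, where Gauss's theorem
        fails. Euler's transformation extracts exactly the singular factor \<open>1 / r\<close> and
        leaves the excess 1/2.\<close>
      have D2: "deriv ?F w = a * b / c * (1 / r * hyp2F1 (b + 1 / 2) (a + 1 / 2) (c + 1) w)"
      proof -
        have e: "b + 1 / 2 - (b + 1) = - (1 / 2)" "c + 1 - (a + 1) = b + 1 / 2" "c + 1 - (b + 1) = a + 1 / 2"
          by (auto simp: c_eq)
        show ?thesis
          unfolding deriv_hyp2F1[OF c mem(1)[OF w]] hyp2F1_Euler[OF c1 mem(1)[OF w], of "a + 1" "b + 1"]
            e r_def powr_minus_divide by (rule refl)
      qed
      have "k * h = x * (- A) * r + y * (- (1 / 2) * B - q * C)"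
        if "D = x * (A * - 1) + y * ((1 / 2 * (- 1) / q) * r * B + C * - 1 * r)" "D = k * (1 / r * h)"
          "r * r = q" for D A B C k h q
      proof -
        have "k * h = D * r" using that(2) r(1) by simp
        also have "\<dots> = x * (- A) * r + y * (- (1 / 2) * B - q * C)"
          unfolding that(1) that(3)[symmetric] using r(1) by (simp add: field_simps)
        finally show ?thesis .
      qed
      from this[OF D1 D2 r(2)] show ?case unfolding r_def w_def by (rule sym)
    qed
    moreover have "(?E \<longlongrightarrow> x * (- deriv K 0) * 0 + y * (- (1 / 2) * 1 - (1 - of_real 1) * deriv H 0)) (at_left 1)"
      by (intro tendsto_intros tendsto_compose_at_left_1 dKH limH lim_sqrt)
    ultimately have L1: "((\<lambda>s. a * b / c * hyp2F1 (b + 1 / 2) (a + 1 / 2) (c + 1) (of_real s))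
       \<longlongrightarrow> x * (- deriv K 0) * 0 + y * (- (1 / 2) * 1 - (1 - of_real 1) * deriv H 0)) (at_left 1)"
      by (rule Lim_transform_eventually[rotated])
    have e: "c + 1 - (b + 1 / 2) = a + 1" "c + 1 - (a + 1 / 2) = b + 1" "a + 1 - (a + 1 / 2) = 1 / 2"
      by (auto simp: c_eq)
    have "Re (1 / 2 :: complex) > 0" by simp
    then have "((\<lambda>s. hyp2F1 (b + 1 / 2) (a + 1 / 2) (c + 1) (of_real s))
       \<longlongrightarrow> Gamma (c + 1) * Gamma (1 / 2) * rGamma (a + 1) * rGamma (b + 1)) (at_left 1)"
      using hyp2F1_tendsto_at_1[OF c1, of "b + 1 / 2" "a + 1 / 2"] unfolding e by blast
    then have L2: "((\<lambda>s. a * b / c * hyp2F1 (b + 1 / 2) (a + 1 / 2) (c + 1) (of_real s))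
       \<longlongrightarrow> a * b / c * (Gamma (c + 1) * Gamma (1 / 2) * rGamma (a + 1) * rGamma (b + 1))) (at_left 1)"
      by (rule tendsto_mult_left)
    have "- y / 2 = x * (- deriv K 0) * 0 + y * (- (1 / 2) * 1 - (1 - of_real 1) * deriv H 0)"
      by simp
    also have "\<dots> = a * b / c * (Gamma (c + 1) * Gamma (1 / 2) * rGamma (a + 1) * rGamma (b + 1))"
      by (rule tendsto_unique[OF trivial_limit_at_left_real L1 L2])
    \<comment> \<open>The recurrence of the reciprocal Gamma function absorbs \<open>a\<close> and
      \<open>b\<close>, also when one of them is 0.\<close>
    also have "\<dots> = Gamma c * Gamma (1 / 2) * (a * rGamma (a + 1)) * (b * rGamma (b + 1))"
      unfolding Gamma_plus1[OF c] using c0 by simp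
    also have "\<dots> = Gamma c * Gamma (1 / 2) * rGamma a * rGamma b"
      unfolding rGamma_plus1 by (rule refl)
    finally have eq: "- y / 2 = Gamma c * Gamma (1 / 2) * rGamma a * rGamma b" .
    have "y = - 2 * (- y / 2)" by simp
    then show ?thesis unfolding eq .
  qed
  have "g * h * p * q * A + - 2 * (g * h * u * v) * B = g * h * (q * p * A - 2 * u * v * B)"
    for g h p q u v A B :: complex
    by algebra
  then show ?thesis
    unfolding xy[OF s] x y G1_def G2_def K_def H_def by blast
qed

section \<open>Legendre and Ferrers functions\<close>

text \<open>In reciprocal form the formula needs no exceptions: at a pole of one of the Gamma
  factors on the left, Gamma(2z) has a pole as well, and both sides are 0.\<close>

lemma rGamma_legendre_duplication:
  "rGamma z * rGamma (z + 1 / 2) * of_real (sqrt pi)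
     = exp ((2 * z - 1) * of_real (ln 2)) * rGamma (2 * z :: complex)"
proof (cases "z \<in> \<int>\<^sub>\<le>\<^sub>0 \<or> z + 1 / 2 \<in> \<int>\<^sub>\<le>\<^sub>0")
  case True
  have "2 * z \<in> \<int>\<^sub>\<le>\<^sub>0"
    using True
  proof
    assume "z \<in> \<int>\<^sub>\<le>\<^sub>0"
    then obtain n where "z = of_int n" "n \<le> 0" by (elim nonpos_Ints_cases)
    then have "2 * z = of_int (2 * n)" by simp
    then show ?thesis using \<open>n \<le> 0\<close> by (simp only: nonpos_Ints_of_int)
  next
    assume "z + 1 / 2 \<in> \<int>\<^sub>\<le>\<^sub>0"
    then obtain n where n: "z + 1 / 2 = of_int n" "n \<le> 0" by (elim nonpos_Ints_cases)
    then have "2 * z = of_int (2 * n - 1)" by (simp add: field_simps)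
    then show ?thesis using n by (simp only: nonpos_Ints_of_int)
  qed
  then have "rGamma (2 * z) = 0" by (simp only: rGamma_eq_zero_iff)
  moreover have "rGamma z = 0 \<or> rGamma (z + 1 / 2) = 0"
    using True by (simp only: rGamma_eq_zero_iff)
  ultimately show ?thesis by auto
next
  case False
  then have nz: "Gamma z \<noteq> 0" "Gamma (z + 1 / 2) \<noteq> 0"
    by (auto simp: Gamma_eq_zero_iff)
  have eq: "Gamma z * Gamma (z + 1 / 2) = exp ((1 - 2 * z) * of_real (ln 2)) * of_real (sqrt pi) * Gamma (2 * z)"
    using False by (intro Gamma_legendre_duplication) auto
  with nz have "Gamma (2 * z) \<noteq> 0" by auto
  moreover have "exp ((2 * z - 1) * of_real (ln 2)) * exp ((1 - 2 * z) * of_real (ln 2)) = 1"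
    by (simp add: algebra_simps flip: exp_add)
  moreover have "inverse p * inverse q * S = E * inverse G"
    if "E * E' = 1" "p * q = E' * S * G" "p \<noteq> 0" "q \<noteq> 0" "G \<noteq> 0" for p q S G E E' :: complex
  proof -
    have "E * (p * q) = (E * E') * (S * G)" unfolding that(2) by (simp only: mult_ac)
    then have "E * (p * q) = S * G" unfolding that(1) by simp
    then show ?thesis using that(3-5) by (simp add: field_simps)
  qed
  ultimately show ?thesis
    using nz eq unfolding rGamma_inverse_Gamma by blast
qed

section \<open>Logarithms on the half-planes\<close>

text \<open>All of z, z - 1 and (z - 1)/z lie in the upper half-plane, with arguments in (0, \<pi>).
  A correction by 2\<pi> in the sum of two of them would make the argument of z - 1
  negative.\<close>

lemma Ln_diff_1_upper:
  assumes "Im z > 0"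
  shows "Ln ((z - 1) / z) = Ln (z - 1) - Ln z" and "Im ((z - 1) / z) > 0"
proof -
  have z: "z \<noteq> 0" "z - 1 \<noteq> 0" using assms by auto
  have "Im ((z - 1) / z) = Im z / (norm z)\<^sup>2"
    unfolding cmod_power2 by (simp add: Im_divide algebra_simps)
  then show pos: "Im ((z - 1) / z) > 0" using assms z by simp
  have im: "0 < Im (Ln z)" "0 < Im (Ln ((z - 1) / z))" "0 < Im (Ln (z - 1))"
    using Im_Ln_pos_lt_imp[of z] Im_Ln_pos_lt_imp[OF pos] Im_Ln_pos_lt_imp[of "z - 1"] assms by auto
  have "Ln (z - 1) = Ln (z * ((z - 1) / z))" using z by simp
  also have "\<dots> = Ln z + Ln ((z - 1) / z)"
  proof -
    have nle: "\<not> Im (Ln z + Ln ((z - 1) / z)) \<le> - pi"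
      using im pi_gt_zero unfolding plus_complex.sel by linarith
    have "\<not> Im (Ln z + Ln ((z - 1) / z)) > pi"
    proof
      assume gt: "Im (Ln z + Ln ((z - 1) / z)) > pi"
      then have "Ln (z * ((z - 1) / z)) = (Ln z + Ln ((z - 1) / z)) - \<i> * of_real (2 * pi)"
        using z nle by (subst Ln_times) auto
      then have "Im (Ln (z - 1)) = Im (Ln z) + Im (Ln ((z - 1) / z)) - 2 * pi"
        using z by simp
      moreover have "Im (Ln z) < pi" "Im (Ln ((z - 1) / z)) < pi"
        using Im_Ln_pos_lt_imp[of z] Im_Ln_pos_lt_imp[OF pos] assms by auto
      ultimately show False using im by linarith
    qed
    then show ?thesis using z nle by (subst Ln_times) auto
  qed
  finally show "Ln ((z - 1) / z) = Ln (z - 1) - Ln z" by simp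
qed

text \<open>In the factorisations of 1 - 1/z^2 and 1 - z^2 one factor lies in the upper and one in
  the lower half-plane, so their principal arguments add without correction. The term \<i>\<pi>
  arises on passing from z - 1 to 1 - z and is the source of the phases in the expansion of
  Q.\<close>

lemma Ln_Legendre_upper:
  assumes "Im z > 0"
  shows "Ln (1 - 1 / z\<^sup>2) = Ln (z - 1) + Ln (z + 1) - 2 * Ln z"
    and "Ln (z / (1 + z)) = Ln z - Ln (z + 1)"
    and "Ln (z - 1) + Ln (z + 1) = Ln (1 - z\<^sup>2) + \<i> * of_real pi"
proof -
  have z: "z \<noteq> 0" "z - 1 \<noteq> 0" "z + 1 \<noteq> 0" using assms by (auto simp: complex_eq_iff)
  note A = Ln_diff_1_upper[OF assms] and B = Ln_diff_1_upper[of "z + 1"]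
  show B1: "Ln (z / (1 + z)) = Ln z - Ln (z + 1)"
    using B assms by (simp add: add.commute)
  have B2: "Im (z / (z + 1)) > 0" using B assms by simp
  have inv: "Ln ((z + 1) / z) = - Ln (z / (z + 1))"
    using Ln_inverse[of "z / (z + 1)"] B2 by (auto simp: complex_nonpos_Reals_iff)
  have "1 - 1 / z\<^sup>2 = (z - 1) / z * ((z + 1) / z)"
    using z by (simp add: field_simps power2_eq_square)
  also have "Ln \<dots> = Ln ((z - 1) / z) + Ln ((z + 1) / z)"
    using z inv Im_Ln_pos_lt_imp[OF A(2)] Im_Ln_pos_lt_imp[OF B2] by (intro Ln_times_simple) auto
  finally show "Ln (1 - 1 / z\<^sup>2) = Ln (z - 1) + Ln (z + 1) - 2 * Ln z"
    unfolding inv A(1) using B1 by (simp add: add.commute)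
  have "1 - z\<^sup>2 = (1 - z) * (1 + z)" by (simp add: power2_eq_square algebra_simps)
  also have "Ln \<dots> = Ln (1 - z) + Ln (1 + z)"
  proof (rule Ln_times_simple)
    have "Ln (- (z - 1)) = Ln (z - 1) - \<i> * of_real pi"
      using assms z by (subst Ln_minus) auto
    then have *: "Ln (1 - z) = Ln (z - 1) - \<i> * of_real pi" by simp
    show "- pi < Im (Ln (1 - z)) + Im (Ln (1 + z))" "Im (Ln (1 - z)) + Im (Ln (1 + z)) \<le> pi"
      using Im_Ln_pos_lt_imp[of "z - 1"] Im_Ln_pos_lt_imp[of "1 + z"] assms unfolding * by auto
  qed (use z in \<open>auto simp: add.commute\<close>)
  also have "Ln (1 - z) = Ln (z - 1) - \<i> * of_real pi"
    using assms z Ln_minus[of "z - 1"] by auto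
  finally show "Ln (z - 1) + Ln (z + 1) = Ln (1 - z\<^sup>2) + \<i> * of_real pi"
    by (simp add: add.commute)
qed

text \<open>The lower half-plane follows by conjugation once the arguments are known to avoid the
  branch cut. The third identity of \<open>Ln_Legendre_upper\<close> is left out, because its
  \<i>\<pi> changes sign with the half-plane.\<close>

lemma Ln_Legendre:
  assumes "Im z \<noteq> 0"
  shows "Ln (1 - 1 / z\<^sup>2) = Ln (z - 1) + Ln (z + 1) - 2 * Ln z"
    and "Ln (z / (1 + z)) = Ln z - Ln (z + 1)"
proof -
  have "Ln (1 - 1 / z\<^sup>2) = Ln (z - 1) + Ln (z + 1) - 2 * Ln z \<and> Ln (z / (1 + z)) = Ln z - Ln (z + 1)"
  proof (cases "Im z > 0")
    case True
    then show ?thesis using Ln_Legendre_upper by blast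
  next
    case False
    define y where "y = cnj z"
    have y: "Im y > 0" "z = cnj y" using False assms by (auto simp: y_def)
    have y0: "y \<noteq> 0" "y + 1 \<noteq> 0" using y by (auto simp: complex_eq_iff)
    have np: "y \<notin> \<real>\<^sub>\<le>\<^sub>0" "y - 1 \<notin> \<real>\<^sub>\<le>\<^sub>0" "y + 1 \<notin> \<real>\<^sub>\<le>\<^sub>0"
      using y by (auto simp: complex_nonpos_Reals_iff)
    have "Im (y / (1 + y)) > 0" using Ln_diff_1_upper(2)[of "y + 1"] y by (simp add: add.commute)
    then have np1: "y / (1 + y) \<notin> \<real>\<^sub>\<le>\<^sub>0" by (auto simp: complex_nonpos_Reals_iff)
    have np2: "1 - 1 / y\<^sup>2 \<notin> \<real>\<^sub>\<le>\<^sub>0"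
    proof
      assume "1 - 1 / y\<^sup>2 \<in> \<real>\<^sub>\<le>\<^sub>0"
      then obtain r where r: "r \<le> 0" "1 - 1 / y\<^sup>2 = of_real r" by (elim nonpos_Reals_cases)
      then have "y\<^sup>2 = of_real (1 / (1 - r))" using y0 by (simp add: field_simps)
      then have "y\<^sup>2 = (of_real (sqrt (1 / (1 - r))))\<^sup>2" using r by (simp flip: of_real_power)
      then have "y = of_real (sqrt (1 / (1 - r))) \<or> y = - of_real (sqrt (1 / (1 - r)))"
        using power2_eq_iff by blast
      then show False using y by auto
    qed
    have "cnj (Ln (1 - 1 / y\<^sup>2)) = cnj (Ln (y - 1) + Ln (y + 1) - 2 * Ln y)"
      "cnj (Ln (y / (1 + y))) = cnj (Ln y - Ln (y + 1))"
      using Ln_Legendre_upper[OF y(1)] by simp_all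
    then show ?thesis
      unfolding y(2) using np np1 np2 by (simp add: cnj_Ln)
  qed
  then show "Ln (1 - 1 / z\<^sup>2) = Ln (z - 1) + Ln (z + 1) - 2 * Ln z"
    and "Ln (z / (1 + z)) = Ln z - Ln (z + 1)" by blast+
qed

lemma exp_minus_i_pi_half: "exp (- (\<i> * of_real pi / 2)) = - \<i>"
proof -
  have "exp (- (\<i> * of_real pi / 2)) = cis (- (pi / 2))" by (simp add: cis_conv_exp)
  also have "\<dots> = - \<i>" by (simp add: complex_eq_iff)
  finally show ?thesis .
qed

text \<open>
  Up to a factor independent of \<open>z\<close>, \<open>norm_Q\<close> is \<open>Q\<close>, and \<open>even_sol\<close> and \<open>odd_sol\<close> are the even and the
  odd solution of Legendre's equation on the doubly cut plane. The argument \<open>z\<^sup>2 / (z\<^sup>2 - 1)\<close>, rather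
  than the customary \<open>z\<^sup>2\<close>, is the one that comes out of the connection formula.
\<close>

definition norm_Q :: "complex \<Rightarrow> complex \<Rightarrow> complex \<Rightarrow> complex" where
  "norm_Q \<nu> \<mu> z = (z + 1) powr (\<mu> / 2) * (z - 1) powr (\<mu> / 2) / z powr (\<nu> + \<mu> + 1)
     * hyp2F1 ((\<nu> + \<mu> + 2) / 2) ((\<nu> + \<mu> + 1) / 2) (\<nu> + 3 / 2) (1 / z\<^sup>2)"

definition even_sol :: "complex \<Rightarrow> complex \<Rightarrow> complex \<Rightarrow> complex" where
  "even_sol \<nu> \<mu> z = (1 - z\<^sup>2) powr (- (\<nu> + 1) / 2)
     * hyp2F1 ((\<nu> - \<mu> + 1) / 2) ((\<nu> + \<mu> + 1) / 2) (1 / 2) (z\<^sup>2 / (z\<^sup>2 - 1))"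

definition odd_sol :: "complex \<Rightarrow> complex \<Rightarrow> complex \<Rightarrow> complex" where
  "odd_sol \<nu> \<mu> z = z * (1 - z\<^sup>2) powr (- (\<nu> + 2) / 2)
     * hyp2F1 ((\<nu> - \<mu> + 2) / 2) ((\<nu> + \<mu> + 2) / 2) (3 / 2) (z\<^sup>2 / (z\<^sup>2 - 1))"

lemma even_sol_minus: "even_sol \<nu> \<mu> (- z) = even_sol \<nu> \<mu> z"
  and odd_sol_minus: "odd_sol \<nu> \<mu> (- z) = - odd_sol \<nu> \<mu> z"
  by (simp_all add: even_sol_def odd_sol_def)

abbreviation ferrers_plane :: "complex set" where
  "ferrers_plane \<equiv> - complex_of_real ` ({..-1} \<union> {1..})"

lemma mem_ferrers_plane_iff: "z \<in> ferrers_plane \<longleftrightarrow> (Im z = 0 \<longrightarrow> \<bar>Re z\<bar> < 1)"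
  by (auto simp: image_Un complex_slot_right_eq complex_slot_left_eq)

lemma square_mem_cut_plane:
  assumes "z \<in> ferrers_plane"
  shows "z\<^sup>2 \<in> cut_plane"
proof
  assume "z\<^sup>2 \<in> complex_of_real ` {1..}"
  then obtain r where r: "r \<ge> 1" "z\<^sup>2 = of_real r" by auto
  then have "z\<^sup>2 = (of_real (sqrt r))\<^sup>2" by (simp flip: of_real_power)
  then have "z = of_real (sqrt r) \<or> z = of_real (- sqrt r)" by (simp add: power2_eq_iff)
  then show False using assms r unfolding mem_ferrers_plane_iff by auto
qed

text \<open>The argument is Pfaff's map applied to \<open>z\<^sup>2\<close>, so it avoids the cut
  even on (-1,1), where the argument 1/z^2 of Q does not.\<close>

lemma
  shows holomorphic_on_even_sol: "even_sol \<nu> \<mu> holomorphic_on ferrers_plane"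
    and holomorphic_on_odd_sol: "odd_sol \<nu> \<mu> holomorphic_on ferrers_plane"
proof -
  have nz: "z\<^sup>2 - 1 \<noteq> 0" if "z \<in> ferrers_plane" for z
    using cut_plane_neq_1[OF square_mem_cut_plane[OF that]] by simp
  have sq: "(\<lambda>z. z\<^sup>2 / (z\<^sup>2 - 1)) holomorphic_on ferrers_plane"
    by (intro holomorphic_intros nz)
  have "(\<lambda>z. z\<^sup>2 / (z\<^sup>2 - 1)) ` ferrers_plane \<subseteq> cut_plane"
    by (intro image_subsetI Pfaff_cut_plane square_mem_cut_plane)
  from holomorphic_on_compose_gen[OF sq holomorphic_on_hyp2F1 this, unfolded o_def]
  have F: "(\<lambda>z. hyp2F1 a b c (z\<^sup>2 / (z\<^sup>2 - 1))) holomorphic_on ferrers_plane"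
    if "c \<notin> \<int>\<^sub>\<le>\<^sub>0" for a b c
    using that .
  have P: "(\<lambda>z. (1 - z\<^sup>2) powr e) holomorphic_on ferrers_plane" for e
    by (intro holomorphic_intros one_minus_cut_plane square_mem_cut_plane)
  show "even_sol \<nu> \<mu> holomorphic_on ferrers_plane"
    unfolding even_sol_def[abs_def]
    by (rule holomorphic_on_mult[OF P F[OF half_notin_nonpos_Ints(1)]])
  show "odd_sol \<nu> \<mu> holomorphic_on ferrers_plane"
    unfolding odd_sol_def[abs_def]
    by (rule holomorphic_on_mult[OF holomorphic_on_mult[OF holomorphic_on_ident P]
          F[OF half_notin_nonpos_Ints(2)]])
qed

lemma hyp2F1_commute: "hyp2F1 a b c = hyp2F1 b a c"
proof -
  have "hyp2F1_series a b c = hyp2F1_series b a c"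
    by (simp add: hyp2F1_series_def fun_eq_iff mult_ac)
  then show ?thesis by (simp add: hyp2F1_def)
qed

text \<open>Euler's transformation: replacing \<nu> by -\<nu> - 1 turns the upper parameters into c
  - b and c - a, and 1 - p is the inverse of 1 - z^2, so the Euler factor merges with the power in
  front.\<close>

lemma
  assumes z: "z \<in> ferrers_plane"
  shows even_sol_reflect: "even_sol (- \<nu> - 1) \<mu> z = even_sol \<nu> \<mu> z"
    and odd_sol_reflect: "odd_sol (- \<nu> - 1) \<mu> z = odd_sol \<nu> \<mu> z"
proof -
  define p where "p = z\<^sup>2 / (z\<^sup>2 - 1)"
  have z2: "z\<^sup>2 \<in> cut_plane" by (rule square_mem_cut_plane[OF z])
  then have nz: "z\<^sup>2 \<noteq> 1" "1 - z\<^sup>2 \<noteq> 0" using cut_plane_neq_1 by force+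
  have p: "p \<in> cut_plane" unfolding p_def by (rule Pfaff_cut_plane[OF z2])
  have "1 - p = inverse (1 - z\<^sup>2)"
    using nz by (simp add: p_def field_simps)
  then have Ln: "Ln (1 - p) = - Ln (1 - z\<^sup>2)"
    using Ln_inverse one_minus_cut_plane[OF z2] by simp
  have powr: "(1 - p) powr e = (1 - z\<^sup>2) powr (- e)" for e
  proof -
    have "1 - p \<noteq> 0" using one_minus_cut_plane[OF p] by auto
    then show ?thesis using nz Ln by (simp add: powr_def)
  qed
  have *: "(1 - z\<^sup>2) powr e * hyp2F1 a b c p = (1 - z\<^sup>2) powr e' * hyp2F1 (c - b) (c - a) c p"
    if "c \<notin> \<int>\<^sub>\<le>\<^sub>0" "e' = e - (c - a - b)" for a b c e e'
  proof -
    have "hyp2F1 a b c p = (1 - z\<^sup>2) powr (- (c - a - b)) * hyp2F1 (c - b) (c - a) c p"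
      unfolding hyp2F1_Euler[OF that(1) p, of a b] powr hyp2F1_commute[of "c - b"] by (rule refl)
    moreover have "(1 - z\<^sup>2) powr e' = (1 - z\<^sup>2) powr e * (1 - z\<^sup>2) powr (- (c - a - b))"
      unfolding that(2) by (simp only: diff_conv_add_uminus powr_add)
    ultimately show ?thesis by (simp only: mult.assoc)
  qed
  have e: "1 / 2 - (- \<nu> - 1 - \<mu> + 1) / 2 = (\<nu> + \<mu> + 1) / 2"
    "1 / 2 - (- \<nu> - 1 + \<mu> + 1) / 2 = (\<nu> - \<mu> + 1) / 2"
    "- (\<nu> + 1) / 2 = - (- \<nu> - 1 + 1) / 2
        - (1 / 2 - (- \<nu> - 1 - \<mu> + 1) / 2 - (- \<nu> - 1 + \<mu> + 1) / 2)"
    and o: "3 / 2 - (- \<nu> - 1 - \<mu> + 2) / 2 = (\<nu> + \<mu> + 2) / 2"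
    "3 / 2 - (- \<nu> - 1 + \<mu> + 2) / 2 = (\<nu> - \<mu> + 2) / 2"
    "- (\<nu> + 2) / 2 = - (- \<nu> - 1 + 2) / 2
        - (3 / 2 - (- \<nu> - 1 - \<mu> + 2) / 2 - (- \<nu> - 1 + \<mu> + 2) / 2)"
    by (simp_all add: field_simps)
  show "even_sol (- \<nu> - 1) \<mu> z = even_sol \<nu> \<mu> z"
    using *[OF half_notin_nonpos_Ints(1) e(3)] unfolding even_sol_def p_def[symmetric] e(1,2) .
  show "odd_sol (- \<nu> - 1) \<mu> z = odd_sol \<nu> \<mu> z"
    using *[OF half_notin_nonpos_Ints(2) o(3)] unfolding odd_sol_def p_def[symmetric] o(1,2) mult.assoc
    by (simp only:)
qed

text \<open>With w = 2/(1 + z) one has w/(2 - w) = 1/z, so the first claim follows from the second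
  by \<open>quadratic_cut_plane\<close>.\<close>

lemma inverse_square_mem_cut_plane:
  assumes "Im z \<noteq> 0"
  shows "1 / z\<^sup>2 \<in> cut_plane" "2 / (1 + z) \<in> cut_plane"
proof -
  have z: "z \<noteq> 0" "1 + z \<noteq> 0" using assms by (auto simp: complex_eq_iff)
  have "(1 + Re z)\<^sup>2 + (Im z)\<^sup>2 \<noteq> 0"
    using assms by (simp add: add_nonneg_eq_0_iff)
  then have "Im (2 / (1 + z)) \<noteq> 0"
    using assms by (simp add: Im_divide)
  then show w: "2 / (1 + z) \<in> cut_plane" unfolding mem_cut_plane_iff by simp
  have "2 / (1 + z) / (2 - 2 / (1 + z)) = 1 / z"
  proof -
    have "2 - 2 / (1 + z) = 2 * z / (1 + z)" using z by (simp add: field_simps)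
    moreover have "2 / u / (2 * z / u) = 1 / z" if "u \<noteq> 0" for u
      using z that by simp
    ultimately show ?thesis using z by metis
  qed
  then show "1 / z\<^sup>2 \<in> cut_plane"
    using quadratic_cut_plane[OF w] by (simp add: power_divide)
qed

section \<open>Q on the half-planes\<close>

text \<open>Pfaff's map sends 1/z^2 to s = 1/(1 - z^2), the new parameters satisfy c = a + b + 1/2,
  and 1 - s is the argument occurring in the even and odd solutions. What remains is to determine
  the branches of the powers.\<close>

lemma norm_Q_eq_even_odd:
  assumes z: "Im z > 0" and c: "\<nu> + 3 / 2 \<notin> \<int>\<^sub>\<le>\<^sub>0"
  shows "norm_Q \<nu> \<mu> z = exp (- (\<i> * of_real pi * (\<nu> + 1) / 2)) * (Gamma (\<nu> + 3 / 2) * of_real (sqrt pi)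
           * (rGamma ((\<nu> - \<mu> + 2) / 2) * rGamma ((\<nu> + \<mu> + 2) / 2) * even_sol \<nu> \<mu> z
              + 2 * \<i> * rGamma ((\<nu> - \<mu> + 1) / 2) * rGamma ((\<nu> + \<mu> + 1) / 2) * odd_sol \<nu> \<mu> z))"
proof -
  define a where "a = (\<nu> - \<mu> + 1) / 2"
  define b where "b = (\<nu> + \<mu> + 1) / 2"
  define t where "t = 1 / z\<^sup>2"
  define D where "D = Ln (1 - z\<^sup>2)"
  have zn: "z \<noteq> 0" "z + 1 \<noteq> 0" "z - 1 \<noteq> 0" using z by (auto simp: complex_eq_iff)
  have z2: "z\<^sup>2 \<noteq> 1" using zn by (auto simp: power2_eq_1_iff add_eq_0_iff)
  have t: "t \<in> cut_plane" unfolding t_def using z by (intro inverse_square_mem_cut_plane) auto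
  have t1: "1 - t \<noteq> 0" using one_minus_cut_plane[OF t] by auto
  define s where "s = t / (t - 1)"
  have s_eq: "s = 1 / (1 - z\<^sup>2)" "1 - s = z\<^sup>2 / (z\<^sup>2 - 1)" "1 - s = inverse (1 - t)"
    unfolding s_def t_def using zn z2 by (auto simp: field_simps)
  have z_mem: "z \<in> ferrers_plane" unfolding mem_ferrers_plane_iff using z by simp
  have s: "s \<in> two_cut_plane"
    unfolding two_cut_plane_eq
    using Pfaff_cut_plane[OF t] Pfaff_cut_plane[OF square_mem_cut_plane[OF z_mem]] s_eq(2)
    by (simp add: s_def)
  have s1: "1 - s \<noteq> 0" using s_eq(3) t1 by simp
  note L = Ln_Legendre_upper[OF z]
  have L1: "Ln (1 - t) = D + \<i> * of_real pi - 2 * Ln z"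
    unfolding t_def D_def using L(1,3) by simp
  have L2: "Ln (1 - s) = 2 * Ln z - D - \<i> * of_real pi"
    unfolding s_eq(3) using Ln_inverse[OF one_minus_cut_plane[OF t]] L1 by simp
  have "hyp2F1 (b + 1 / 2) b (\<nu> + 3 / 2) t = (1 - t) powr (- b) * hyp2F1 (\<nu> + 3 / 2 - (b + 1 / 2)) b (\<nu> + 3 / 2) s"
    unfolding s_def by (rule hyp2F1_Pfaff[OF c t])
  also have "\<nu> + 3 / 2 - (b + 1 / 2) = a" by (simp add: a_def b_def field_simps)
  finally have P: "hyp2F1 (b + 1 / 2) b (\<nu> + 3 / 2) t = (1 - t) powr (- b) * hyp2F1 a b (\<nu> + 3 / 2) s" .
  have half: "(\<nu> + \<mu> + 2) / 2 = b + 1 / 2" "(\<nu> + \<mu> + 1) / 2 = b" "(\<nu> - \<mu> + 2) / 2 = a + 1 / 2" "(\<nu> - \<mu> + 1) / 2 = a"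
    by (simp_all add: a_def b_def field_simps)
  have p1: "(1 - s) powr e = exp (e * Ln (1 - s))" for e using s1 by (simp add: powr_def)
  have p2: "(1 - z\<^sup>2) powr e = exp (e * D)" for e using z2 by (simp add: powr_def D_def)
  \<comment> \<open>The powers of \<open>z\<close> cancel because
    \<open>2 * b = \<nu> + \<mu> + 1\<close>; only a power of \<open>1 - z\<^sup>2\<close> and a
    constant phase survive.\<close>
  have pw: "(z + 1) powr (\<mu> / 2) * (z - 1) powr (\<mu> / 2) / z powr (\<nu> + \<mu> + 1) * (1 - t) powr (- b)
     = exp (- (\<i> * of_real pi * (\<nu> + 1) / 2)) * (1 - z\<^sup>2) powr (- (\<nu> + 1) / 2)"
  proof -
    have "exp A * exp B / exp C * exp E = exp (A + B - C + E)" for A B C E :: complex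
      by (simp add: exp_add exp_diff)
    then have e1: "(z + 1) powr (\<mu> / 2) * (z - 1) powr (\<mu> / 2) / z powr (\<nu> + \<mu> + 1) * (1 - t) powr (- b)
      = exp (\<mu> / 2 * Ln (z + 1) + \<mu> / 2 * Ln (z - 1) - (\<nu> + \<mu> + 1) * Ln z + (- b) * Ln (1 - t))"
      by (simp only: powr_def zn t1 if_False)
    have L3: "Ln (z + 1) = D + \<i> * of_real pi - Ln (z - 1)"
      unfolding D_def using L(3) by (simp add: eq_diff_eq add.commute)
    have e2: "\<mu> / 2 * Ln (z + 1) + \<mu> / 2 * Ln (z - 1) - (\<nu> + \<mu> + 1) * Ln z + (- b) * Ln (1 - t)
      = - (\<i> * of_real pi * (\<nu> + 1) / 2) + (- (\<nu> + 1) / 2) * D"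
      unfolding L1 L3 b_def by (simp add: field_simps)
    show ?thesis unfolding e1 e2 p2 by (rule exp_add)
  qed
  \<comment> \<open>In the upper half-plane the root of 1 - s is -\<i> z (1 - z^2)^(-1/2). The
    factor \<open>z\<close> makes the second solution odd, and -\<i> turns the coefficient -2 into
    2\<i>.\<close>
  have sq: "(1 - s) powr (1 / 2) * (1 - z\<^sup>2) powr (- (\<nu> + 1) / 2) = - \<i> * (z * (1 - z\<^sup>2) powr (- (\<nu> + 2) / 2))"
  proof -
    have e1: "1 / 2 * Ln (1 - s) + (- (\<nu> + 1) / 2) * D
       = - (\<i> * of_real pi / 2) + (Ln z + (- (\<nu> + 2) / 2) * D)"
      unfolding L2 by (simp add: field_simps)
    have e3: "exp (Ln z) = z" using zn by simp
    show ?thesis unfolding p1 p2 exp_add[symmetric] e1 unfolding exp_add exp_minus_i_pi_half e3 by (rule refl)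
  qed
  have c_eq: "\<nu> + 3 / 2 = a + b + 1 / 2" by (simp add: a_def b_def field_simps)
  have "norm_Q \<nu> \<mu> z = ((z + 1) powr (\<mu> / 2) * (z - 1) powr (\<mu> / 2) / z powr (\<nu> + \<mu> + 1) * (1 - t) powr (- b))
      * hyp2F1 a b (\<nu> + 3 / 2) s"
    unfolding norm_Q_def half t_def[symmetric] P by (simp only: mult_ac)
  also have "\<dots> = exp (- (\<i> * of_real pi * (\<nu> + 1) / 2)) * (Gamma (\<nu> + 3 / 2) * Gamma (1 / 2)
      * (rGamma (a + 1 / 2) * rGamma (b + 1 / 2)
             * ((1 - z\<^sup>2) powr (- (\<nu> + 1) / 2) * hyp2F1 a b (1 / 2) (1 - s))
         - 2 * rGamma a * rGamma b * (((1 - s) powr (1 / 2) * (1 - z\<^sup>2) powr (- (\<nu> + 1) / 2))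
             * hyp2F1 (a + 1 / 2) (b + 1 / 2) (3 / 2) (1 - s))))"
    unfolding pw hyp2F1_connection_half[OF c_eq c s] by (simp add: algebra_simps)
  finally show ?thesis
    unfolding sq unfolding even_sol_def odd_sol_def half s_eq(2) Gamma_one_half_complex by (simp add: algebra_simps)
qed

text \<open>The hypergeometric factor is even, so only powers contribute: each of the three
  logarithms changes by -\<i>\<pi>, with total weight \<mu>/2 + \<mu>/2 - (\<nu> + \<mu> + 1) =
  -(\<nu> + 1).\<close>

lemma norm_Q_minus:
  assumes z: "Im z > 0"
  shows "norm_Q \<nu> \<mu> (- z) = exp (\<i> * of_real pi * (\<nu> + 1)) * norm_Q \<nu> \<mu> z"
proof -
  have zn: "z \<noteq> 0" "z + 1 \<noteq> 0" "z - 1 \<noteq> 0" using z by (auto simp: complex_eq_iff)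
  have L: "Ln (- w) = Ln w - \<i> * of_real pi" if "Im w > 0" for w
    using that by (subst Ln_minus) auto
  have L': "Ln (- z + 1) = Ln (z - 1) - \<i> * of_real pi" "Ln (- z - 1) = Ln (z + 1) - \<i> * of_real pi"
    using L[of "z - 1"] L[of "z + 1"] z by simp_all
  have n: "- z + 1 \<noteq> 0" "- z - 1 \<noteq> 0" using z by (auto simp: complex_eq_iff)
  have "(- z + 1) powr (\<mu> / 2) * (- z - 1) powr (\<mu> / 2) / (- z) powr (\<nu> + \<mu> + 1)
      = exp (\<mu> / 2 * Ln (- z + 1) + \<mu> / 2 * Ln (- z - 1) - (\<nu> + \<mu> + 1) * Ln (- z))"
    using zn n by (simp add: powr_def exp_add exp_diff)
  also have "\<mu> / 2 * Ln (- z + 1) + \<mu> / 2 * Ln (- z - 1) - (\<nu> + \<mu> + 1) * Ln (- z)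
     = \<i> * of_real pi * (\<nu> + 1) + (\<mu> / 2 * Ln (z + 1) + \<mu> / 2 * Ln (z - 1) - (\<nu> + \<mu> + 1) * Ln z)"
    unfolding L' L[OF z] by (simp add: field_simps)
  also have "exp \<dots> = exp (\<i> * of_real pi * (\<nu> + 1))
       * ((z + 1) powr (\<mu> / 2) * (z - 1) powr (\<mu> / 2) / z powr (\<nu> + \<mu> + 1))"
    using zn by (simp add: powr_def exp_add exp_diff)
  finally show ?thesis unfolding norm_Q_def by simp
qed

text \<open>The quadratic transformation at w = 2/(1 + z) leads to the argument 1/z^2 with upper
  parameters in which \<mu> has the wrong sign; Euler's transformation with exponent \<mu> corrects
  it.\<close>

lemma norm_Q_Whipple:
  assumes z: "Im z \<noteq> 0" and \<nu>: "2 * \<nu> + 2 \<notin> \<int>\<^sub>\<le>\<^sub>0" "\<nu> + 3 / 2 \<notin> \<int>\<^sub>\<le>\<^sub>0"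
  shows "norm_Q \<nu> \<mu> z = (1 + z) powr (-1 + \<mu> / 2 - \<nu>) * (z - 1) powr (- \<mu> / 2)
           * hyp2F1 (\<nu> - \<mu> + 1) (\<nu> + 1) (2 * \<nu> + 2) (2 / (1 + z))"
proof -
  define t where "t = 1 / z\<^sup>2"
  define w where "w = 2 / (1 + z)"
  have zn: "z \<noteq> 0" "1 + z \<noteq> 0" "z - 1 \<noteq> 0" using z by (auto simp: complex_eq_iff)
  have t: "t \<in> cut_plane" and w: "w \<in> cut_plane"
    unfolding t_def w_def using inverse_square_mem_cut_plane[OF z] by auto
  have t1: "1 - t \<noteq> 0" using one_minus_cut_plane[OF t] by auto
  have w_eq: "(w / (2 - w))\<^sup>2 = t" "1 - w / 2 = z / (1 + z)"
  proof -
    have "2 / u / 2 = 1 / u" for u :: complex by simp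
    then have w2: "w / 2 = 1 / (1 + z)" unfolding w_def .
    show eq: "1 - w / 2 = z / (1 + z)" unfolding w2 using zn by (simp add: field_simps)
    have "2 - w = 2 * (1 - w / 2)" by simp
    then have w3: "2 - w = 2 * (z / (1 + z))" unfolding eq .
    have "2 / u / (2 * (z / u)) = 1 / z" if "u \<noteq> 0" for u
      using zn that by simp
    from this[OF zn(2)] have "w / (2 - w) = 1 / z" unfolding w3 unfolding w_def .
    then show "(w / (2 - w))\<^sup>2 = t" by (simp add: t_def power_divide)
  qed
  have e1: "2 * \<nu> + 2 = 2 * (\<nu> + 1)" "\<nu> + 1 + 1 / 2 = \<nu> + 3 / 2"
    "(\<nu> - \<mu> + 1 + 1) / 2 = (\<nu> - \<mu> + 2) / 2"
    "(\<nu> + \<mu> + 2) / 2 - (\<nu> - \<mu> + 2) / 2 = \<mu>"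
    "\<nu> + 3 / 2 - (\<nu> - \<mu> + 1) / 2 = (\<nu> + \<mu> + 2) / 2"
    "\<nu> + 3 / 2 - (\<nu> - \<mu> + 2) / 2 = (\<nu> + \<mu> + 1) / 2"
    by (simp_all add: field_simps)
  have c: "2 * (\<nu> + 1) \<notin> \<int>\<^sub>\<le>\<^sub>0" "\<nu> + 1 + 1 / 2 \<notin> \<int>\<^sub>\<le>\<^sub>0"
    using \<nu> unfolding e1 by blast+
  have Q: "hyp2F1 (\<nu> - \<mu> + 1) (\<nu> + 1) (2 * \<nu> + 2) w
     = (z / (1 + z)) powr (- (\<nu> - \<mu> + 1)) * hyp2F1 ((\<nu> - \<mu> + 1) / 2) ((\<nu> - \<mu> + 2) / 2) (\<nu> + 3 / 2) t"
    using hyp2F1_quadratic[OF c w, of "\<nu> - \<mu> + 1"] unfolding w_eq e1 .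
  have E: "hyp2F1 ((\<nu> - \<mu> + 1) / 2) ((\<nu> - \<mu> + 2) / 2) (\<nu> + 3 / 2) t
     = (1 - t) powr \<mu> * hyp2F1 ((\<nu> + \<mu> + 2) / 2) ((\<nu> + \<mu> + 1) / 2) (\<nu> + 3 / 2) t"
    using hyp2F1_Euler[OF \<nu>(2) t, of "(\<nu> - \<mu> + 1) / 2" "(\<nu> - \<mu> + 2) / 2"] unfolding e1 .
  note F = Q[unfolded E]
  have pw: "(1 + z) powr (-1 + \<mu> / 2 - \<nu>) * (z - 1) powr (- \<mu> / 2)
        * ((z / (1 + z)) powr (- (\<nu> - \<mu> + 1)) * (1 - t) powr \<mu>)
     = (z + 1) powr (\<mu> / 2) * (z - 1) powr (\<mu> / 2) / z powr (\<nu> + \<mu> + 1)"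
  proof -
    have nz: "z / (1 + z) \<noteq> 0" "z + 1 \<noteq> 0" using zn by (auto simp: add.commute)
    have g1: "exp A * exp B * (exp C * exp E) = exp (A + B + C + E)" for A B C E :: complex
      by (simp add: exp_add)
    have g2: "exp A * exp B / exp C = exp (A + B - C)" for A B C :: complex
      by (simp add: exp_add exp_diff)
    define m where "m = \<mu> / 2"
    have m: "\<mu> = 2 * m" "- (2 * m) / 2 = - m" "2 * m / 2 = m" by (simp_all add: m_def)
    \<comment> \<open>All powers are exponentials of multiples of three logarithms, and their
      exponents agree as linear forms.\<close>
    have "(-1 + m - \<nu>) * L1 + (- m) * L2 + (- (\<nu> - 2 * m + 1)) * (L3 - L1) + 2 * m * (L2 + L1 - 2 * L3)
       = m * L1 + m * L2 - (\<nu> + 2 * m + 1) * L3" for L1 L2 L3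
      by algebra
    then have e: "(-1 + \<mu> / 2 - \<nu>) * Ln (z + 1) + (- \<mu> / 2) * Ln (z - 1)
        + (- (\<nu> - \<mu> + 1)) * Ln (z / (1 + z)) + \<mu> * Ln (1 - t)
     = \<mu> / 2 * Ln (z + 1) + \<mu> / 2 * Ln (z - 1) - (\<nu> + \<mu> + 1) * Ln z"
      unfolding t_def Ln_Legendre[OF z] m .
    have Lc: "Ln (1 + z) = Ln (z + 1)" by (simp only: add.commute)
    show ?thesis
      by (simp only: powr_def zn nz t1 if_False g1 g2 Lc e)
  qed
  have "norm_Q \<nu> \<mu> z = (1 + z) powr (-1 + \<mu> / 2 - \<nu>) * (z - 1) powr (- \<mu> / 2)
      * ((z / (1 + z)) powr (- (\<nu> - \<mu> + 1)) * (1 - t) powr \<mu>)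
      * hyp2F1 ((\<nu> + \<mu> + 2) / 2) ((\<nu> + \<mu> + 1) / 2) (\<nu> + 3 / 2) t"
    unfolding norm_Q_def t_def[symmetric] pw by (rule refl)
  also have "\<dots> = (1 + z) powr (-1 + \<mu> / 2 - \<nu>) * (z - 1) powr (- \<mu> / 2)
      * hyp2F1 (\<nu> - \<mu> + 1) (\<nu> + 1) (2 * \<nu> + 2) w"
    unfolding F by (simp only: mult.assoc)
  finally show ?thesis unfolding w_def .
qed

text \<open>
  Unlike \<open>Q\<close> itself, \<open>reg_Q\<close> has no factor \<open>\<Gamma>(\<nu> + \<mu> + 1)\<close>, so \<open>\<nu>\<close> may be replaced by \<open>- \<nu> - 1\<close>
  even where \<open>\<Gamma>(\<mu> - \<nu>)\<close> has a pole.
\<close>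

definition reg_Q :: "complex \<Rightarrow> complex \<Rightarrow> complex \<Rightarrow> complex" where
  "reg_Q \<nu> \<mu> z = of_real (sqrt pi) / 2 powr (\<nu> + 1) * rGamma (\<nu> + 3 / 2) * norm_Q \<nu> \<mu> z"

text \<open>The coefficients of \<open>reg_Q\<close> in the upper half-plane. Gamma(\<nu> + 3/2)
  from the connection formula has cancelled against its reciprocal in \<open>reg_Q\<close>, so they
  are entire in both parameters.\<close>

definition even_coeff :: "complex \<Rightarrow> complex \<Rightarrow> complex" where
  "even_coeff \<nu> \<mu> = of_real pi / 2 powr (\<nu> + 1) * exp (- (\<i> * of_real pi * (\<nu> + 1) / 2))
     * (rGamma ((\<nu> - \<mu> + 2) / 2) * rGamma ((\<nu> + \<mu> + 2) / 2))"

definition odd_coeff :: "complex \<Rightarrow> complex \<Rightarrow> complex" where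
  "odd_coeff \<nu> \<mu> = 2 * \<i> * of_real pi / 2 powr (\<nu> + 1) * exp (- (\<i> * of_real pi * (\<nu> + 1) / 2))
     * (rGamma ((\<nu> - \<mu> + 1) / 2) * rGamma ((\<nu> + \<mu> + 1) / 2))"

lemma legendre_Q_eq_reg_Q:
  "legendre_Q \<nu> \<mu> z = exp (\<i> * of_real pi * \<mu>) * Gamma (\<nu> + \<mu> + 1) * reg_Q \<nu> \<mu> z"
proof -
  have "s * e * g * p / (t * y) * r * h = e * g * (s / t * r * (p / y * h))"
    for s e g p t y r h :: complex by simp
  then show ?thesis unfolding legendre_Q_def reg_Q_def norm_Q_def .
qed

lemma reg_Q_upper:
  assumes "Im z > 0" "\<nu> + 3 / 2 \<notin> \<int>\<^sub>\<le>\<^sub>0"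
  shows "reg_Q \<nu> \<mu> z = even_coeff \<nu> \<mu> * even_sol \<nu> \<mu> z + odd_coeff \<nu> \<mu> * odd_sol \<nu> \<mu> z"
proof -
  have gen: "s / t * r * (e * (g * s * (a * b * E + 2 * \<i> * c * d * F)))
     = p / t * e * (a * b) * E + 2 * \<i> * p / t * e * (c * d) * F"
    if "r * g = 1" "s * s = p" for s t r e g a b c d E F p :: complex
  proof -
    have "s / t * r * (e * (g * s * (a * b * E + 2 * \<i> * c * d * F)))
       = (r * g) * ((s * s) / t * e * (a * b * E + 2 * \<i> * c * d * F))" by simp
    also have "\<dots> = p / t * e * (a * b) * E + 2 * \<i> * p / t * e * (c * d) * F"
      unfolding that by (simp add: algebra_simps)
    finally show ?thesis .
  qed
  have g: "rGamma (\<nu> + 3 / 2) * Gamma (\<nu> + 3 / 2) = 1"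
    using assms(2) by (simp add: rGamma_inverse_Gamma Gamma_eq_zero_iff)
  have p: "of_real (sqrt pi) * of_real (sqrt pi) = complex_of_real pi"
    unfolding of_real_mult[symmetric] by simp
  show ?thesis
    unfolding reg_Q_def norm_Q_eq_even_odd[OF assms] even_coeff_def odd_coeff_def by (rule gen[OF g p])
qed

text \<open>The point \<open>- z\<close> lies in the upper half-plane; parity changes the sign of
  the odd part.\<close>

lemma reg_Q_lower:
  assumes "Im z < 0" "\<nu> + 3 / 2 \<notin> \<int>\<^sub>\<le>\<^sub>0"
  shows "reg_Q \<nu> \<mu> z = exp (\<i> * of_real pi * (\<nu> + 1))
           * (even_coeff \<nu> \<mu> * even_sol \<nu> \<mu> z - odd_coeff \<nu> \<mu> * odd_sol \<nu> \<mu> z)"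
proof -
  have im: "Im (- z) > 0" using assms by simp
  have "reg_Q \<nu> \<mu> z = exp (\<i> * of_real pi * (\<nu> + 1)) * reg_Q \<nu> \<mu> (- z)"
    using norm_Q_minus[OF im, of \<nu> \<mu>] unfolding reg_Q_def by simp
  then show ?thesis
    unfolding reg_Q_upper[OF im assms(2)] even_sol_minus odd_sol_minus by simp
qed

lemma two_powr: "2 powr a = exp (a * complex_of_real (ln 2))"
  using Ln_of_real[of 2] by (simp add: powr_def)

text \<open>The last conclusion lets the lemma be applied once more, to -\<nu> - 1.\<close>

lemma two_nu_notin_Ints:
  fixes \<nu> :: complex
  assumes "2 * \<nu> \<notin> \<int>"
  shows "2 * \<nu> + 2 \<notin> \<int>\<^sub>\<le>\<^sub>0" "\<nu> + 3 / 2 \<notin> \<int>\<^sub>\<le>\<^sub>0" "\<nu> + 1 \<notin> \<int>\<^sub>\<le>\<^sub>0" "2 * (- \<nu> - 1) \<notin> \<int>"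
proof -
  have *: "w \<notin> \<int>\<^sub>\<le>\<^sub>0" if "2 * \<nu> = of_int m * w - of_int k" for w m k
  proof
    assume "w \<in> \<int>\<^sub>\<le>\<^sub>0"
    then obtain n where "w = of_int n" by (elim nonpos_Ints_cases)
    then have "2 * \<nu> = of_int (m * n - k)" using that by simp
    then show False using assms Ints_of_int by metis
  qed
  show "2 * \<nu> + 2 \<notin> \<int>\<^sub>\<le>\<^sub>0" by (rule *[of 1 _ 2]) simp
  show "\<nu> + 3 / 2 \<notin> \<int>\<^sub>\<le>\<^sub>0" by (rule *[of 2 _ 3]) (simp add: algebra_simps)
  show "\<nu> + 1 \<notin> \<int>\<^sub>\<le>\<^sub>0" by (rule *[of 2 _ 2]) (simp add: algebra_simps)
  show "2 * (- \<nu> - 1) \<notin> \<int>"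
  proof
    assume "2 * (- \<nu> - 1) \<in> \<int>"
    then have "- (2 * (- \<nu> - 1)) - 2 \<in> \<int>" by (intro Ints_diff Ints_minus) auto
    then show False using assms by simp
  qed
qed

text \<open>The duplication formula at \<nu> + 1 converts the quotient of sqrt(\<pi>) by Gamma(\<nu>
  + 3/2) into that of Gamma(\<nu> + 1) by Gamma(2\<nu> + 2), up to a power of 2. This is the form of
  both terms of the theorem.\<close>

lemma reg_Q_Whipple:
  assumes \<nu>: "2 * \<nu> \<notin> \<int>" and z: "Im z \<noteq> 0"
  shows "reg_Q \<nu> \<mu> z = 2 powr \<nu> * (Gamma (\<nu> + 1) * rGamma (2 * \<nu> + 2))
      * ((1 + z) powr (-1 + \<mu> / 2 - \<nu>) * (z - 1) powr (- \<mu> / 2)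
           * hyp2F1 (\<nu> - \<mu> + 1) (\<nu> + 1) (2 * \<nu> + 2) (2 / (1 + z)))"
proof -
  note n = two_nu_notin_Ints[OF \<nu>]
  have g: "Gamma (\<nu> + 1) * rGamma (\<nu> + 1) = 1"
    using n(3) by (simp add: rGamma_inverse_Gamma Gamma_eq_zero_iff)
  have e: "\<nu> + 1 + 1 / 2 = \<nu> + 3 / 2" "2 * (\<nu> + 1) = 2 * \<nu> + 2" "2 * \<nu> + 2 - 1 = 2 * \<nu> + 1" by simp_all
  have d: "rGamma (\<nu> + 1) * rGamma (\<nu> + 3 / 2) * of_real (sqrt pi)
      = 2 powr (2 * \<nu> + 1) * rGamma (2 * \<nu> + 2)"
    using rGamma_legendre_duplication[of "\<nu> + 1"] unfolding e two_powr .
  have t: "2 powr (2 * \<nu> + 1) / 2 powr (\<nu> + 1) = (2 :: complex) powr \<nu>"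
    unfolding powr_diff[symmetric] by simp
  have "s / t * r = t1 * (G * R)"
    if "G * h = 1" "h * r * s = t2 * R" "t2 / t = t1" for s t r t1 G R h t2 :: complex
  proof -
    have "s / t * r = (G * h) * (s / t * r)" unfolding that(1) by simp
    also have "\<dots> = G * (h * r * s) / t" by simp
    also have "\<dots> = (t2 / t) * (G * R)" unfolding that(2) by simp
    finally show ?thesis unfolding that(3) .
  qed
  note eq = this[OF g d t]
  show ?thesis
    unfolding reg_Q_def norm_Q_Whipple[OF z n(1,2)] eq by (rule refl)
qed

section \<open>Reflection of the coefficients\<close>

text \<open>Duplication splits \<open>R\<close> into \<open>A * B * C * D\<close>, up to \<pi> and
  the power of 2. Reflection pairs two of these with the two reflected factors and gives a product
  of sines, which becomes the sum or difference of cosines.\<close>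

lemma rGamma_product_reflect:
  fixes \<nu> \<mu> :: complex
  defines "A \<equiv> rGamma ((\<nu> - \<mu> + 1) / 2)" and "B \<equiv> rGamma ((\<nu> - \<mu> + 2) / 2)"
    and "C \<equiv> rGamma ((\<nu> + \<mu> + 1) / 2)" and "D \<equiv> rGamma ((\<nu> + \<mu> + 2) / 2)"
    and "R \<equiv> rGamma (\<nu> - \<mu> + 1) * rGamma (\<nu> + \<mu> + 1)"
  shows "R * (2 powr \<nu>)\<^sup>2 * (rGamma ((- \<nu> - 1 - \<mu> + 2) / 2) * rGamma ((- \<nu> - 1 + \<mu> + 2) / 2)) * (2 * of_real pi)
           = B * D * (cos (of_real pi * \<mu>) + cos (of_real pi * \<nu>))"
    and "R * (2 powr \<nu>)\<^sup>2 * (rGamma ((- \<nu> - 1 - \<mu> + 1) / 2) * rGamma ((- \<nu> - 1 + \<mu> + 1) / 2)) * (2 * of_real pi)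
           = A * C * (cos (of_real pi * \<mu>) - cos (of_real pi * \<nu>))"
proof -
  define p where "p = complex_of_real pi"
  have p0: "p \<noteq> 0" by (simp add: p_def)
  have sq: "complex_of_real (sqrt pi) * of_real (sqrt pi) = p"
    unfolding p_def of_real_mult[symmetric] by simp
  have h: "(\<nu> - \<mu> + 1) / 2 + 1 / 2 = (\<nu> - \<mu> + 2) / 2" "(\<nu> + \<mu> + 1) / 2 + 1 / 2 = (\<nu> + \<mu> + 2) / 2"
    "2 * ((\<nu> - \<mu> + 1) / 2) = \<nu> - \<mu> + 1" "2 * ((\<nu> + \<mu> + 1) / 2) = \<nu> + \<mu> + 1"
    "\<nu> - \<mu> + 1 - 1 = \<nu> - \<mu>" "\<nu> + \<mu> + 1 - 1 = \<nu> + \<mu>"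
    by (simp_all add: field_simps)
  have 1: "A * B * of_real (sqrt pi) = 2 powr (\<nu> - \<mu>) * rGamma (\<nu> - \<mu> + 1)"
    using rGamma_legendre_duplication[of "(\<nu> - \<mu> + 1) / 2"] unfolding h two_powr A_def B_def .
  have 2: "C * D * of_real (sqrt pi) = 2 powr (\<nu> + \<mu>) * rGamma (\<nu> + \<mu> + 1)"
    using rGamma_legendre_duplication[of "(\<nu> + \<mu> + 1) / 2"] unfolding h two_powr C_def D_def .
  have T: "2 powr (\<nu> - \<mu>) * 2 powr (\<nu> + \<mu>) = (2 powr \<nu> :: complex)\<^sup>2"
    unfolding power2_eq_square powr_add[symmetric] by simp
  have "R * (2 powr (\<nu> - \<mu>) * 2 powr (\<nu> + \<mu>)) = (A * B * of_real (sqrt pi)) * (C * D * of_real (sqrt pi))"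
    unfolding 1 2 R_def by (simp only: mult_ac)
  then have R: "R * (2 powr \<nu>)\<^sup>2 = A * B * C * D * p"
    unfolding T sq[symmetric] by (simp only: mult_ac)
  have q: "1 - (\<nu> - \<mu> + 1) / 2 = (- \<nu> - 1 + \<mu> + 2) / 2" "1 - (\<nu> + \<mu> + 1) / 2 = (- \<nu> - 1 - \<mu> + 2) / 2"
    "1 - (\<nu> - \<mu> + 2) / 2 = (- \<nu> - 1 + \<mu> + 1) / 2" "1 - (\<nu> + \<mu> + 2) / 2 = (- \<nu> - 1 - \<mu> + 1) / 2"
    by (simp_all add: field_simps)
  have refl: "A * rGamma ((- \<nu> - 1 + \<mu> + 2) / 2) * p = sin (p * ((\<nu> - \<mu> + 1) / 2))"
    "C * rGamma ((- \<nu> - 1 - \<mu> + 2) / 2) * p = sin (p * ((\<nu> + \<mu> + 1) / 2))"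
    "B * rGamma ((- \<nu> - 1 + \<mu> + 1) / 2) * p = sin (p * ((\<nu> - \<mu> + 2) / 2))"
    "D * rGamma ((- \<nu> - 1 - \<mu> + 1) / 2) * p = sin (p * ((\<nu> + \<mu> + 2) / 2))"
    unfolding A_def B_def C_def D_def q[symmetric] rGamma_reflection_complex p_def by simp_all
  have arg: "p * ((\<nu> - \<mu> + 1) / 2) - p * ((\<nu> + \<mu> + 1) / 2) = - (p * \<mu>)"
    "p * ((\<nu> - \<mu> + 1) / 2) + p * ((\<nu> + \<mu> + 1) / 2) = p * \<nu> + p"
    "p * ((\<nu> - \<mu> + 2) / 2) - p * ((\<nu> + \<mu> + 2) / 2) = - (p * \<mu>)"
    "p * ((\<nu> - \<mu> + 2) / 2) + p * ((\<nu> + \<mu> + 2) / 2) = p * \<nu> + 2 * p"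
    by (simp_all add: field_simps)
  have cp: "cos (p * \<nu> + p) = - cos (p * \<nu>)" "cos (p * \<nu> + 2 * p) = cos (p * \<nu>)"
  proof -
    have "cos p = - 1" "sin p = 0" unfolding p_def by (simp_all flip: cos_of_real sin_of_real)
    then show "cos (p * \<nu> + p) = - cos (p * \<nu>)" "cos (p * \<nu> + 2 * p) = cos (p * \<nu>)"
      by (simp_all add: cos_add cos_double sin_double)
  qed
  have s1: "sin (p * ((\<nu> - \<mu> + 1) / 2)) * sin (p * ((\<nu> + \<mu> + 1) / 2)) = (cos (p * \<mu>) + cos (p * \<nu>)) / 2"
    unfolding sin_times_sin arg cp by simp
  have s2: "sin (p * ((\<nu> - \<mu> + 2) / 2)) * sin (p * ((\<nu> + \<mu> + 2) / 2)) = (cos (p * \<mu>) - cos (p * \<nu>)) / 2"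
    unfolding sin_times_sin arg cp by simp
  have gen: "Q * (y * x) * (2 * p) = b * d * S"
    if "Q = a * b * c * d * p" "a * x * p = u" "c * y * p = v" "u * v = S / 2" for Q x y a b c d u v S
  proof -
    have "Q * (y * x) * (2 * p) = 2 * (b * d * ((a * x * p) * (c * y * p)))"
      unfolding that(1) by (simp only: mult_ac)
    also have "\<dots> = b * d * S" unfolding that(2,3,4) by simp
    finally show ?thesis .
  qed
  show "R * (2 powr \<nu>)\<^sup>2 * (rGamma ((- \<nu> - 1 - \<mu> + 2) / 2) * rGamma ((- \<nu> - 1 + \<mu> + 2) / 2)) * (2 * of_real pi)
           = B * D * (cos (of_real pi * \<mu>) + cos (of_real pi * \<nu>))"
    using gen[OF R refl(1,2) s1] unfolding p_def .
  have R': "R * (2 powr \<nu>)\<^sup>2 = B * A * D * C * p" unfolding R by (simp only: mult_ac)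
  show "R * (2 powr \<nu>)\<^sup>2 * (rGamma ((- \<nu> - 1 - \<mu> + 1) / 2) * rGamma ((- \<nu> - 1 + \<mu> + 1) / 2)) * (2 * of_real pi)
           = A * C * (cos (of_real pi * \<mu>) - cos (of_real pi * \<nu>))"
    using gen[OF R' refl(3,4) s2] unfolding p_def .
qed

text \<open>Only the sign between the two cosines distinguishes the even from the odd case. The
  reciprocal Gamma factors stay on the left, so no division by a possible zero occurs.\<close>

lemma
  fixes \<nu> \<mu> :: complex
  shows even_coeff_reflect: "\<i> * of_real pi * rGamma (\<nu> - \<mu> + 1) * rGamma (\<nu> + \<mu> + 1) * even_coeff (- \<nu> - 1) \<mu>
      = - (even_coeff \<nu> \<mu> * exp (\<i> * of_real pi * \<nu>) * (cos (of_real pi * \<mu>) + cos (of_real pi * \<nu>)))"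
    and odd_coeff_reflect: "\<i> * of_real pi * rGamma (\<nu> - \<mu> + 1) * rGamma (\<nu> + \<mu> + 1) * odd_coeff (- \<nu> - 1) \<mu>
      = - (odd_coeff \<nu> \<mu> * exp (\<i> * of_real pi * \<nu>) * (cos (of_real pi * \<mu>) - cos (of_real pi * \<nu>)))"
proof -
  define e where "e = exp (\<i> * of_real pi * \<nu> / 2)"
  define T where "T = (2 :: complex) powr \<nu>"
  have nz: "e \<noteq> 0" "T \<noteq> 0" by (simp_all add: e_def T_def)
  have e2: "exp (\<i> * of_real pi * \<nu>) = e * e"
  proof -
    have "\<i> * of_real pi * \<nu> / 2 + \<i> * of_real pi * \<nu> / 2 = \<i> * of_real pi * \<nu>" by simp
    then show ?thesis unfolding e_def exp_add[symmetric] by (simp only:)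
  qed
  have "- (\<i> * of_real pi * (\<nu> + 1) / 2) = - (\<i> * of_real pi / 2) - \<i> * of_real pi * \<nu> / 2"
    by (simp add: field_simps)
  then have e1: "exp (- (\<i> * of_real pi * (\<nu> + 1) / 2)) = - \<i> / e"
    unfolding e_def exp_minus_i_pi_half[symmetric] exp_diff[symmetric] by simp
  have e3: "exp (- (\<i> * of_real pi * (- \<nu> - 1 + 1) / 2)) = e"
    by (simp add: e_def)
  have T1: "2 powr (\<nu> + 1) = 2 * T" by (simp add: T_def powr_add)
  have T2: "(2 :: complex) powr (- \<nu> - 1 + 1) = 1 / T" by (simp add: T_def powr_minus_divide)
  \<comment> \<open>One computation for both parities: the constant \<open>k\<close> is 1 for the
    even and \<open>2 * \<i>\<close> for the odd coefficient.\<close>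
  have gen: "\<i> * p * r1 * r2 * (k * p / (1 / T) * e * Y) = - (k * p / (2 * T) * (- \<i> / e) * X * (e * e) * S)"
    if "r1 * r2 * T\<^sup>2 * Y * (2 * p) = X * S" for r1 r2 k Y X S p
  proof -
    have "- (k * p / (2 * T) * (- \<i> / e) * X * (e * e) * S) = \<i> * k * p * e / (2 * T) * (X * S)"
      using nz by simp
    also have "\<dots> = \<i> * p * r1 * r2 * (k * p / (1 / T) * e * Y)"
      unfolding that[symmetric] using nz by (simp add: power2_eq_square)
    finally show ?thesis by (rule sym)
  qed
  note R = rGamma_product_reflect[of \<nu> \<mu>, folded T_def]
  show "\<i> * of_real pi * rGamma (\<nu> - \<mu> + 1) * rGamma (\<nu> + \<mu> + 1) * even_coeff (- \<nu> - 1) \<mu>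
      = - (even_coeff \<nu> \<mu> * exp (\<i> * of_real pi * \<nu>) * (cos (of_real pi * \<mu>) + cos (of_real pi * \<nu>)))"
    using gen[OF R(1), of 1] unfolding even_coeff_def e1 e2 e3 T1 T2 mult_1_left .
  show "\<i> * of_real pi * rGamma (\<nu> - \<mu> + 1) * rGamma (\<nu> + \<mu> + 1) * odd_coeff (- \<nu> - 1) \<mu>
      = - (odd_coeff \<nu> \<mu> * exp (\<i> * of_real pi * \<nu>) * (cos (of_real pi * \<mu>) - cos (of_real pi * \<nu>)))"
    using gen[OF R(2), of "2 * \<i>"] unfolding odd_coeff_def e1 e2 e3 T1 T2 .
qed

section \<open>Boundary values and the Ferrers function\<close>

text \<open>\<open>Lim\<close> is determined by convergence only along a nontrivial filter, hence
  the limit point hypothesis.\<close>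

lemma Lim_eq_of_eq_on_half_plane:
  fixes f g :: "complex \<Rightarrow> complex"
  assumes g: "isCont g x" and eq: "\<And>z. z \<in> S \<Longrightarrow> f z = g z" and x: "x islimpt S"
  shows "Lim (at x within S) f = g x"
proof (rule tendsto_Lim)
  show "at x within S \<noteq> bot" using x by (simp add: trivial_limit_within)
  have "(g \<longlongrightarrow> g x) (at x within S)"
    using g by (simp add: continuous_at_imp_continuous_at_within continuous_within[symmetric])
  moreover have "eventually (\<lambda>z. g z = f z) (at x within S)"
    unfolding eventually_at_filter by (simp add: eq)
  ultimately show "(f \<longlongrightarrow> g x) (at x within S)" by (rule Lim_transform_eventually)
qed

lemma real_islimpt_half_planes:
  assumes "Im x = 0"
  shows "x islimpt {z. Im z > 0}" "x islimpt {z. Im z < 0}"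
  unfolding islimpt_approachable
proof safe
  fix e :: real assume e: "e > 0"
  have "x + \<i> * of_real (e / 2) \<in> {z. Im z > 0}" "x + \<i> * of_real (e / 2) \<noteq> x" "dist (x + \<i> * of_real (e / 2)) x < e"
    using e assms by (auto simp: dist_norm norm_mult)
  then show "\<exists>x'\<in>{z. Im z > 0}. x' \<noteq> x \<and> dist x' x < e" by blast
  have "x - \<i> * of_real (e / 2) \<in> {z. Im z < 0}" "x - \<i> * of_real (e / 2) \<noteq> x" "dist (x - \<i> * of_real (e / 2)) x < e"
    using e assms by (auto simp: dist_norm norm_mult)
  then show "\<exists>x'\<in>{z. Im z < 0}. x' \<noteq> x \<and> dist x' x < e" by blast
qed

text \<open>Each boundary value on (-1,1) is the value of a function holomorphic on the whole doubly
  cut plane. Their weighted mean is therefore an extension, and extensions are unique.\<close>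

lemma ferrers_Q_eq_even_odd:
  fixes \<nu> \<mu> x :: complex
  assumes c: "\<nu> + 3 / 2 \<notin> \<int>\<^sub>\<le>\<^sub>0" and x: "x \<in> ferrers_plane"
  defines "a \<equiv> even_coeff \<nu> \<mu>" and "b \<equiv> odd_coeff \<nu> \<mu>"
  shows "ferrers_Q \<nu> \<mu> x = 1 / 2 * Gamma (\<nu> + \<mu> + 1)
           * (exp (- (\<i> * of_real pi * \<mu> / 2)) * (a * even_sol \<nu> \<mu> x + b * odd_sol \<nu> \<mu> x)
              + exp (\<i> * of_real pi * \<mu> / 2)
                * (exp (\<i> * of_real pi * (\<nu> + 1)) * (a * even_sol \<nu> \<mu> x - b * odd_sol \<nu> \<mu> x)))"
  unfolding ferrers_Q_def
proof (rule holomorphic_extension_unique[where \<xi> = 0 and g = "\<lambda>x. 1 / 2 * Gamma (\<nu> + \<mu> + 1)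
           * (exp (- (\<i> * of_real pi * \<mu> / 2)) * (a * even_sol \<nu> \<mu> x + b * odd_sol \<nu> \<mu> x)
              + exp (\<i> * of_real pi * \<mu> / 2)
                * (exp (\<i> * of_real pi * (\<nu> + 1)) * (a * even_sol \<nu> \<mu> x - b * odd_sol \<nu> \<mu> x)))"])
  note hol = holomorphic_on_even_sol[of \<nu> \<mu>] holomorphic_on_odd_sol[of \<nu> \<mu>]
  \<comment> \<open>The continuations of \<open>legendre_Q\<close> across the interval from the
    upper half-plane (\<open>?u\<close>) and from the lower one (\<open>?l\<close>).\<close>
  let ?u = "\<lambda>z. exp (\<i> * of_real pi * \<mu>) * Gamma (\<nu> + \<mu> + 1)
      * (a * even_sol \<nu> \<mu> z + b * odd_sol \<nu> \<mu> z)"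
  let ?l = "\<lambda>z. exp (\<i> * of_real pi * \<mu>) * Gamma (\<nu> + \<mu> + 1)
      * (exp (\<i> * of_real pi * (\<nu> + 1)) * (a * even_sol \<nu> \<mu> z - b * odd_sol \<nu> \<mu> z))"
  show "open ferrers_plane" by (rule open_doubly_cut_plane)
  show "connected ferrers_plane" by (rule connected_doubly_cut_plane) simp
  show sub: "complex_of_real ` {-1<..<1} \<subseteq> ferrers_plane" by auto
  show "0 \<in> ferrers_plane" unfolding mem_ferrers_plane_iff by simp
  show "(0 :: complex) islimpt complex_of_real ` {-1<..<1}"
    unfolding islimpt_approachable
  proof (intro allI impI)
    fix e :: real assume e: "e > 0"
    define d where "d = min e 1 / 2"
    have d: "0 < d" "d < e" "d < 1" using e by (auto simp: d_def min_def)
    then have "complex_of_real d \<in> complex_of_real ` {-1<..<1}" "complex_of_real d \<noteq> 0"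
      "dist (complex_of_real d) 0 < e"
      by auto
    then show "\<exists>x'\<in>complex_of_real ` {-1<..<1}. x' \<noteq> 0 \<and> dist x' 0 < e" by blast
  qed
  show "(\<lambda>x. 1 / 2 * Gamma (\<nu> + \<mu> + 1)
           * (exp (- (\<i> * of_real pi * \<mu> / 2)) * (a * even_sol \<nu> \<mu> x + b * odd_sol \<nu> \<mu> x)
              + exp (\<i> * of_real pi * \<mu> / 2)
                * (exp (\<i> * of_real pi * (\<nu> + 1)) * (a * even_sol \<nu> \<mu> x - b * odd_sol \<nu> \<mu> x))))
        holomorphic_on ferrers_plane"
    by (intro holomorphic_on_mult holomorphic_on_add holomorphic_on_diff holomorphic_on_const hol)
  have "?u holomorphic_on ferrers_plane" "?l holomorphic_on ferrers_plane"
    by (intro holomorphic_on_mult holomorphic_on_add holomorphic_on_diff holomorphic_on_const hol)+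
  then have cont: "isCont ?u w" "isCont ?l w" if "w \<in> ferrers_plane" for w
    using that open_doubly_cut_plane[of "-1" 1]
    by (meson continuous_on_eq_continuous_at holomorphic_on_imp_continuous_on)+
  fix w assume w: "w \<in> complex_of_real ` {-1<..<1}"
  then have wD: "w \<in> ferrers_plane" and wI: "Im w = 0" using sub by auto
  have up: "legendre_Q_above \<nu> \<mu> w = ?u w"
    unfolding legendre_Q_above_def
    by (rule Lim_eq_of_eq_on_half_plane[where g = ?u, OF cont(1)[OF wD] _ real_islimpt_half_planes(1)[OF wI]])
       (simp add: legendre_Q_eq_reg_Q reg_Q_upper[OF _ c] a_def b_def)
  have low: "legendre_Q_below \<nu> \<mu> w = ?l w"
    unfolding legendre_Q_below_def
    by (rule Lim_eq_of_eq_on_half_plane[where g = ?l, OF cont(2)[OF wD] _ real_islimpt_half_planes(2)[OF wI]])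
       (simp add: legendre_Q_eq_reg_Q reg_Q_lower[OF _ c] a_def b_def)
  \<comment> \<open>The normalising exponential in the Ferrers function cancels the one in
    \<open>legendre_Q\<close>.\<close>
  have inv: "exp (- (\<i> * of_real pi * \<mu>)) * exp (\<i> * of_real pi * \<mu>) = 1"
    by (simp flip: exp_add)
  have gen: "1 / 2 * G * (K * P + H * Q) = 1 / 2 * (K * m * (M * G * P) + H * m * (M * G * Q))"
    if "m * M = 1" for G P H K Q m M :: complex
  proof -
    have "1 / 2 * (K * m * (M * G * P) + H * m * (M * G * Q)) = 1 / 2 * ((m * M) * G * (K * P + H * Q))"
      by (simp add: algebra_simps)
    also have "\<dots> = 1 / 2 * G * (K * P + H * Q)" unfolding that by simp
    finally show ?thesis by (rule sym)
  qed
  show "1 / 2 * Gamma (\<nu> + \<mu> + 1)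
           * (exp (- (\<i> * of_real pi * \<mu> / 2)) * (a * even_sol \<nu> \<mu> w + b * odd_sol \<nu> \<mu> w)
              + exp (\<i> * of_real pi * \<mu> / 2)
                * (exp (\<i> * of_real pi * (\<nu> + 1)) * (a * even_sol \<nu> \<mu> w - b * odd_sol \<nu> \<mu> w)))
      = ferrers_Q_real \<nu> \<mu> w"
    unfolding ferrers_Q_real_def up low by (rule gen[OF inv])
qed (rule x)

text \<open>
  Here \<open>\<epsilon>\<close> is \<open>1\<close> for the even and \<open>-1\<close> for the odd solution; the two conclusions serve the upper and
  the lower half-plane.
\<close>

lemma coefficient_identity:
  fixes M N \<epsilon> G r g g' :: complex
  assumes cN: "cos N \<noteq> 0" and G: "G * R2 = 1" and \<epsilon>: "\<epsilon> * \<epsilon> = 1"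
    and refl: "\<i> * p * R1 * R2 * g' = - (g * exp (\<i> * N) * (cos M + \<epsilon> * cos N))"
  defines "h \<equiv> exp (\<i> * M / 2)" and "h' \<equiv> exp (- (\<i> * M / 2))"
  shows "1 / 2 * G * (h' * g + h * (- exp (\<i> * N) * (\<epsilon> * g)))
       = (cos M - \<i> * (sin (M - N) / (2 * cos N))) * G * h * g
         + \<i> * p * (1 / cos N) / 2 * R1 * h * g'"
    and "1 / 2 * G * (h' * g + h * (- exp (\<i> * N) * (\<epsilon> * g)))
       = (cos M + \<i> * (sin (M - N) / (2 * cos N))) * G * h' * (- exp (\<i> * N) * (\<epsilon> * g))
         - \<i> * p * (1 / cos N) / 2 * R1 * h' * (exp (- (\<i> * N)) * (\<epsilon> * g'))"
proof -
  define E where "E = exp (\<i> * N)"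
  define C where "C = cos N"
  define S where "S = sin N"
  define c where "c = cos M"
  define s where "s = sin M"
  have trig: "C\<^sup>2 + S\<^sup>2 = 1" "c\<^sup>2 + s\<^sup>2 = 1" by (simp_all add: C_def S_def c_def s_def)
  have E: "E = C + \<i> * S"
    unfolding E_def C_def S_def by (rule exp_Euler)
  have EE: "exp (- (\<i> * N)) * E = 1" unfolding E_def exp_minus by simp
  have half: "\<i> * M / 2 + \<i> * M / 2 = \<i> * M" "- (\<i> * M / 2) + - (\<i> * M / 2) = - (\<i> * M)"
    by simp_all
  have hM: "h * h = c + \<i> * s" "h' * h' = c - \<i> * s" "h * h' = 1"
  proof -
    show "h * h = c + \<i> * s"
      unfolding h_def exp_add[symmetric] half c_def s_def by (rule exp_Euler)
    have "exp (- (\<i> * M)) = c - \<i> * s"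
      using exp_Euler[of "- M"] unfolding c_def s_def by simp
    then show "h' * h' = c - \<i> * s"
      unfolding h'_def exp_add[symmetric] half .
    show "h * h' = 1" unfolding h_def h'_def exp_minus by simp
  qed
  \<comment> \<open>The two half-angle phases differ by the factor exp(\<i>M), so either one can be
    made the common factor of all terms.\<close>
  have h': "h' = h * (c - \<i> * s)" "h = h' * (c + \<i> * s)"
  proof -
    have "h' = (h * h') * h'" by (simp only: hM mult_1_left)
    also have "\<dots> = h * (h' * h')" by (simp only: mult.assoc)
    finally show "h' = h * (c - \<i> * s)" unfolding hM(2) .
    have "h = (h * h') * h" by (simp only: hM mult_1_left)
    also have "\<dots> = h' * (h * h)" by (simp only: mult_ac)
    finally show "h = h' * (c + \<i> * s)" unfolding hM(1) .
  qed
  have C0: "C \<noteq> 0" using cN by (simp add: C_def)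
  have sd: "sin (M - N) = s * C - c * S" by (simp add: sin_diff s_def c_def C_def S_def)
  \<comment> \<open>Multiplication by \<open>G\<close>, the inverse of \<open>R2\<close>, solves the
    reflection relation for the term with \<open>g'\<close> and expresses it through
    \<open>g\<close>.\<close>
  have "\<i> * p * R1 * g' = G * R2 * (\<i> * p * R1 * g')" unfolding G by simp
  also have "\<dots> = G * (\<i> * p * R1 * R2 * g')" by (simp only: mult_ac)
  also have "\<dots> = - (G * g * E * (c + \<epsilon> * C))"
    unfolding refl E_def C_def c_def by simp
  finally have X: "\<i> * p * R1 * g' = - (G * g * E * (c + \<epsilon> * C))" .
  have ii: "\<i> * \<i> = - 1" by simp
  show "1 / 2 * G * (h' * g + h * (- exp (\<i> * N) * (\<epsilon> * g)))
       = (cos M - \<i> * (sin (M - N) / (2 * cos N))) * G * h * g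
         + \<i> * p * (1 / cos N) / 2 * R1 * h * g'"
  proof -
    have "\<i> * p * (1 / C) / 2 * R1 * h * g' = (\<i> * p * R1 * g') * h / (2 * C)"
      by (simp add: mult_ac)
    also have "\<dots> = - (G * g * E * (c + \<epsilon> * C)) * h / (2 * C)" unfolding X ..
    finally have 1: "\<i> * p * (1 / C) / 2 * R1 * h * g' = - (G * g * E * (c + \<epsilon> * C)) * h / (2 * C)" .
    \<comment> \<open>After removal of common factors, the first conclusion rests only on
      \<open>E = C + \<i> * S\<close>.\<close>
    have "C * ((c - \<i> * s) - E * \<epsilon>) = (2 * c * C - \<i> * (s * C - c * S)) - E * (c + \<epsilon> * C)"
      unfolding E by (simp add: algebra_simps)
    moreover have "1 / 2 * G * (h * (c - \<i> * s) * g + h * (- E * (\<epsilon> * g)))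
      = G * g * h * (C * ((c - \<i> * s) - E * \<epsilon>)) / (2 * C)"
      using C0 by (simp add: field_simps)
    moreover have "(c - \<i> * ((s * C - c * S) / (2 * C))) * G * h * g + - (G * g * E * (c + \<epsilon> * C)) * h / (2 * C)
      = G * g * h * ((2 * c * C - \<i> * (s * C - c * S)) - E * (c + \<epsilon> * C)) / (2 * C)"
      using C0 by (simp add: field_simps)
    ultimately have "1 / 2 * G * (h * (c - \<i> * s) * g + h * (- E * (\<epsilon> * g)))
      = (c - \<i> * ((s * C - c * S) / (2 * C))) * G * h * g + - (G * g * E * (c + \<epsilon> * C)) * h / (2 * C)"
      by (simp only:)
    then show ?thesis
      unfolding E_def[symmetric] C_def[symmetric] c_def[symmetric] sd 1 h'(1) .
  qed
  show "1 / 2 * G * (h' * g + h * (- exp (\<i> * N) * (\<epsilon> * g)))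
       = (cos M + \<i> * (sin (M - N) / (2 * cos N))) * G * h' * (- exp (\<i> * N) * (\<epsilon> * g))
         - \<i> * p * (1 / cos N) / 2 * R1 * h' * (exp (- (\<i> * N)) * (\<epsilon> * g'))"
  proof -
    define F where "F = exp (- (\<i> * N))"
    have FE: "F * E = 1" using EE by (simp add: F_def)
    have "\<i> * p * (1 / C) / 2 * R1 * h' * (F * (\<epsilon> * g')) = (\<i> * p * R1 * g') * (h' * F * \<epsilon>) / (2 * C)"
      by (simp add: mult_ac)
    also have "\<dots> = - (F * E) * (G * g * ((c + \<epsilon> * C) * \<epsilon>)) * h' / (2 * C)"
      unfolding X by (simp add: mult_ac)
    also have "(c + \<epsilon> * C) * \<epsilon> = c * \<epsilon> + C"
      using \<epsilon> by (simp add: algebra_simps)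
    finally have 1: "\<i> * p * (1 / C) / 2 * R1 * h' * (F * (\<epsilon> * g')) = - (G * g * (c * \<epsilon> + C)) * h' / (2 * C)"
      unfolding FE by simp
    \<comment> \<open>In the lower half-plane \<open>F\<close> cancels the \<open>E\<close> coming
      from the reflection relation. Writing \<open>c\<close> as a multiple of \<open>E\<close> makes
      that term comparable with the others.\<close>
    have "E * (c * C - \<i> * c * S) = c * (C\<^sup>2 + S\<^sup>2)"
      unfolding E by (simp add: algebra_simps power2_eq_square)
    then have Ec: "E * (c * C - \<i> * c * S) = c" unfolding trig by simp
    have "C * (1 - (c + \<i> * s) * E * \<epsilon>)
        = - (2 * c * C + \<i> * (s * C - c * S)) * E * \<epsilon> + (E * (c * C - \<i> * c * S) * \<epsilon> + C)"
      by (simp add: algebra_simps)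
    then have "C * (1 - (c + \<i> * s) * E * \<epsilon>)
        = - (2 * c * C + \<i> * (s * C - c * S)) * E * \<epsilon> + (c * \<epsilon> + C)"
      unfolding Ec .
    moreover have "1 / 2 * G * (h' * g + h' * (c + \<i> * s) * (- E * (\<epsilon> * g)))
      = G * g * h' * (C * (1 - (c + \<i> * s) * E * \<epsilon>)) / (2 * C)"
      using C0 by (simp add: field_simps)
    moreover have "(c + \<i> * ((s * C - c * S) / (2 * C))) * G * h' * (- E * (\<epsilon> * g))
        - - (G * g * (c * \<epsilon> + C)) * h' / (2 * C)
      = G * g * h' * (- (2 * c * C + \<i> * (s * C - c * S)) * E * \<epsilon> + (c * \<epsilon> + C)) / (2 * C)"
      using C0 by (simp add: field_simps)
    ultimately have "1 / 2 * G * (h' * g + h' * (c + \<i> * s) * (- E * (\<epsilon> * g)))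
      = (c + \<i> * ((s * C - c * S) / (2 * C))) * G * h' * (- E * (\<epsilon> * g))
        - - (G * g * (c * \<epsilon> + C)) * h' / (2 * C)"
      by (simp only:)
    then show ?thesis
      unfolding E_def[symmetric] F_def[symmetric] C_def[symmetric] c_def[symmetric] sd 1 h'(2)[symmetric] .
  qed
qed

text \<open>The argument of x - 1 exceeds that of 1 - x by \<pi> in the upper half-plane and falls
  short of it by \<pi> in the lower one.\<close>

lemma one_minus_powr:
  assumes "(s = 1 \<and> Im x > 0) \<or> (s = -1 \<and> Im x < 0)"
  shows "(1 - x) powr (- \<mu> / 2) = exp (s * (\<i> * (of_real pi * \<mu>) / 2)) * (x - 1) powr (- \<mu> / 2)"
proof -
  have nz: "1 - x \<noteq> 0" "x - 1 \<noteq> 0" using assms by (auto simp: complex_eq_iff)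
  have "Ln (- (1 - x)) = Ln (1 - x) + s * (\<i> * of_real pi)"
    using assms nz by (subst Ln_minus) auto
  then have L: "Ln (x - 1) = Ln (1 - x) + s * (\<i> * of_real pi)" by simp
  have "- \<mu> / 2 * Ln (1 - x) = s * (\<i> * (of_real pi * \<mu>) / 2) + - \<mu> / 2 * Ln (x - 1)"
    unfolding L by (simp add: field_simps)
  then show ?thesis
    unfolding powr_def using nz by (simp only: if_False exp_add)
qed

text \<open>The sign \<open>s\<close> lets both half-planes share one statement: it replaces the
  double signs. Gamma functions in denominators appear as \<open>rGamma\<close>.\<close>

theorem theorem3p5:
  fixes \<nu> \<mu> x s :: complex
  assumes "\<nu> + \<mu> \<notin> \<int>\<^sub>\<le>\<^sub>0"
    and "2 * \<nu> \<notin> \<int>"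
    and "(s = 1 \<and> Im x > 0) \<or> (s = -1 \<and> Im x < 0)"
  shows "ferrers_Q \<nu> \<mu> x =
      2 powr \<nu>
        * (cos (of_real pi * \<mu>)
            - s * \<i> * (sin (of_real pi * (\<mu> - \<nu>)) / (2 * cos (of_real pi * \<nu>))))
        * (Gamma (\<nu> + 1) * Gamma (\<nu> + \<mu> + 1) * rGamma (2 * \<nu> + 2))
        * (1 + x) powr (-1 + \<mu> / 2 - \<nu>) * (1 - x) powr (- \<mu> / 2)
        * hyp2F1 (\<nu> - \<mu> + 1) (\<nu> + 1) (2 * \<nu> + 2) (2 / (1 + x))
    + s * \<i> * of_real pi * 2 powr (- \<nu> - 2) * (1 / cos (of_real pi * \<nu>))
        * (Gamma (- \<nu>) * rGamma (- 2 * \<nu>) * rGamma (\<nu> - \<mu> + 1))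
        * (1 + x) powr (\<nu> + \<mu> / 2) * (1 - x) powr (- \<mu> / 2)
        * hyp2F1 (- \<nu>) (- \<nu> - \<mu>) (- 2 * \<nu>) (2 / (1 + x))"
proof -
  define M where "M = complex_of_real pi * \<mu>"
  define N where "N = complex_of_real pi * \<nu>"
  define G where "G = Gamma (\<nu> + \<mu> + 1)"
  define h where "h = exp (\<i> * M / 2)"
  define h' where "h' = exp (- (\<i> * M / 2))"
  define a where "a = even_coeff \<nu> \<mu>"
  define b where "b = odd_coeff \<nu> \<mu>"
  define a' where "a' = even_coeff (- \<nu> - 1) \<mu>"
  define b' where "b' = odd_coeff (- \<nu> - 1) \<mu>"
  define U where "U = even_sol \<nu> \<mu> x"
  define V where "V = odd_sol \<nu> \<mu> x"
  define R1 where "R1 = rGamma (\<nu> - \<mu> + 1)"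
  define R2 where "R2 = rGamma (\<nu> + \<mu> + 1)"
  note n = two_nu_notin_Ints[OF assms(2)]
  note n' = two_nu_notin_Ints[OF n(4)]
  have im: "Im x \<noteq> 0" using assms(3) by auto
  have x: "x \<in> ferrers_plane" unfolding mem_ferrers_plane_iff using im by simp
  have "\<nu> + \<mu> + 1 \<notin> \<int>\<^sub>\<le>\<^sub>0" using add_of_nat_notin_nonpos_Ints[OF assms(1), of 1] by simp
  then have G: "G * R2 = 1"
    by (simp add: G_def R2_def rGamma_inverse_Gamma Gamma_eq_zero_iff)
  \<comment> \<open>A zero of the cosine would make \<open>2 * \<nu>\<close> an odd integer.\<close>
  have cN: "cos N \<noteq> 0"
  proof
    assume "cos N = 0"
    then obtain k :: int where "N = of_real (of_int k * pi) + of_real pi / 2"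
      unfolding cos_eq_0 by blast
    moreover have "complex_of_real pi * (2 * \<nu>) = 2 * N" by (simp add: N_def)
    ultimately have "complex_of_real pi * (2 * \<nu>) = complex_of_real pi * of_int (2 * k + 1)"
      by (simp add: algebra_simps)
    then have "2 * \<nu> = of_int (2 * k + 1)" by (subst (asm) mult_cancel_left) simp
    then show False using assms(2) Ints_of_int by metis
  qed
  have eiN: "exp (\<i> * of_real pi * \<nu>) = exp (\<i> * N)"
    unfolding N_def mult.assoc by (rule refl)
  \<comment> \<open>Written with the factors 1 and -1 to fit the parameter \<open>\<epsilon>\<close>
    of \<open>coefficient_identity\<close>.\<close>
  have refl: "\<i> * of_real pi * R1 * R2 * a' = - (a * exp (\<i> * N) * (cos M + 1 * cos N))"
    "\<i> * of_real pi * R1 * R2 * b' = - (b * exp (\<i> * N) * (cos M + - 1 * cos N))"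
    using even_coeff_reflect[of \<nu> \<mu>] odd_coeff_reflect[of \<nu> \<mu>]
    unfolding R1_def[symmetric] R2_def[symmetric] a_def[symmetric] b_def[symmetric]
      a'_def[symmetric] b'_def[symmetric] M_def[symmetric] N_def[symmetric] eiN
    by (simp_all only: mult_1_left mult_minus1 diff_conv_add_uminus)
  have m: "- 1 * - 1 = (1 :: complex)" by simp
  note even = coefficient_identity[OF cN G mult_1_left refl(1), folded h_def h'_def]
    and odd = coefficient_identity[OF cN G m refl(2), folded h_def h'_def]
  have eN: "exp (\<i> * of_real pi * (\<nu> + 1)) = - exp (\<i> * N)"
    by (simp add: N_def ring_distribs exp_add mult.assoc)
  have eN': "exp (\<i> * of_real pi * (- \<nu> - 1 + 1)) = exp (- (\<i> * N))"
    by (simp add: N_def mult.assoc)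
  have eM: "exp (- (\<i> * of_real pi * \<mu> / 2)) = h'" "exp (\<i> * of_real pi * \<mu> / 2) = h"
    by (simp_all add: M_def h_def h'_def mult.assoc)
  have Q: "reg_Q \<nu> \<mu> x = (if s = 1 then a * U + b * V else - exp (\<i> * N) * (a * U - b * V))"
    using assms(3) reg_Q_upper[OF _ n(2), of x \<mu>] reg_Q_lower[OF _ n(2), of x \<mu>]
    unfolding a_def b_def U_def V_def eN by auto
  have Q': "reg_Q (- \<nu> - 1) \<mu> x = (if s = 1 then a' * U + b' * V else exp (- (\<i> * N)) * (a' * U - b' * V))"
    using assms(3) reg_Q_upper[OF _ n'(2), of x \<mu>] reg_Q_lower[OF _ n'(2), of x \<mu>]
    unfolding a'_def b'_def U_def V_def even_sol_reflect[OF x] odd_sol_reflect[OF x] eN' by auto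
  \<comment> \<open>The phase from replacing 1 - x by x - 1; it is \<open>h\<close> in the upper and
    \<open>h'\<close> in the lower half-plane.\<close>
  define H where "H = exp (s * (\<i> * M / 2))"
  have pw: "(1 - x) powr (- \<mu> / 2) = H * (x - 1) powr (- \<mu> / 2)"
    unfolding H_def M_def by (rule one_minus_powr[OF assms(3)])
  have F: "ferrers_Q \<nu> \<mu> x = 1 / 2 * G * (h' * (a * U + b * V) + h * (- exp (\<i> * N) * (a * U - b * V)))"
    unfolding ferrers_Q_eq_even_odd[OF n(2) x] eM eN G_def a_def b_def U_def V_def by simp
  have 1: "2 powr \<nu> * T * (Gamma (\<nu> + 1) * Gamma (\<nu> + \<mu> + 1) * rGamma (2 * \<nu> + 2))
        * (1 + x) powr (-1 + \<mu> / 2 - \<nu>) * (1 - x) powr (- \<mu> / 2)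
        * hyp2F1 (\<nu> - \<mu> + 1) (\<nu> + 1) (2 * \<nu> + 2) (2 / (1 + x)) = T * G * H * reg_Q \<nu> \<mu> x" for T
    unfolding reg_Q_Whipple[OF assms(2) im] pw G_def by (simp only: mult_ac)
  have t: "(2 :: complex) powr (- \<nu> - 2) = 2 powr (- \<nu> - 1) / 2"
    using powr_diff[of 2 "- \<nu> - 1" 1] by (simp add: algebra_simps)
  have e: "- \<nu> - 1 + 1 = - \<nu>" "2 * (- \<nu> - 1) + 2 = - 2 * \<nu>" "-1 + \<mu> / 2 - (- \<nu> - 1) = \<nu> + \<mu> / 2"
    "- \<nu> - 1 - \<mu> + 1 = - \<nu> - \<mu>"
    by (simp_all add: algebra_simps)
  \<comment> \<open>The second hypergeometric term is \<open>reg_Q\<close> at -\<nu> - 1 with its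
    upper parameters interchanged; the remaining power of 2 supplies the factor 1/2.\<close>
  have 2: "s * \<i> * of_real pi * 2 powr (- \<nu> - 2) * (1 / cos N)
        * (Gamma (- \<nu>) * rGamma (- 2 * \<nu>) * rGamma (\<nu> - \<mu> + 1))
        * (1 + x) powr (\<nu> + \<mu> / 2) * (1 - x) powr (- \<mu> / 2)
        * hyp2F1 (- \<nu>) (- \<nu> - \<mu>) (- 2 * \<nu>) (2 / (1 + x))
     = s * (\<i> * of_real pi * (1 / cos N) / 2 * R1 * H * reg_Q (- \<nu> - 1) \<mu> x)"
    unfolding reg_Q_Whipple[OF n(4) im] e pw t R1_def hyp2F1_commute[of "- \<nu>"]
    by (simp only: mult_ac times_divide_eq_left times_divide_eq_right mult_1_left mult_1_right)
  have MN: "of_real pi * (\<mu> - \<nu>) = M - N" by (simp add: M_def N_def algebra_simps)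
  \<comment> \<open>Both sides are linear in \<open>U\<close> and \<open>V\<close>, and
    \<open>U\<close> and \<open>V\<close> are unchanged by \<nu> \<mapsto> -\<nu> - 1. Hence it
    suffices to match the coefficients, by \<open>even\<close> for \<open>U\<close> and by
    \<open>odd\<close> for \<open>V\<close>.\<close>
  have goal: "1 / 2 * G * (h' * (a * U + b * V) + h * (- exp (\<i> * N) * (a * U - b * V)))
     = (cos M - s * \<i> * (sin (M - N) / (2 * cos N))) * G * H * reg_Q \<nu> \<mu> x
       + s * (\<i> * of_real pi * (1 / cos N) / 2 * R1 * H * reg_Q (- \<nu> - 1) \<mu> x)"
  proof -
    have split: "1 / 2 * G * (h' * (a * U + b * V) + h * (- E * (a * U - b * V)))
      = (1 / 2 * G * (h' * a + h * (- E * (1 * a)))) * U + (1 / 2 * G * (h' * b + h * (- E * (- 1 * b)))) * V"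
      for E by (simp add: algebra_simps)
    define X where "X = sin (M - N) / (2 * cos N)"
    define B where "B = \<i> * of_real pi * (1 / cos N) / 2 * R1"
    define E where "E = exp (\<i> * N)"
    define E' where "E' = exp (- (\<i> * N))"
    note defs = X_def[symmetric] B_def[symmetric] E_def[symmetric] E'_def[symmetric]
    show ?thesis
    proof (cases "s = 1")
      case True
      have H: "H = h" by (simp add: H_def h_def True)
      have "((cos M - \<i> * X) * G * h * a + B * h * a') * U + ((cos M - \<i> * X) * G * h * b + B * h * b') * V
         = (cos M - 1 * \<i> * X) * G * h * (a * U + b * V) + 1 * (B * h * (a' * U + b' * V))"
        by (simp add: algebra_simps)
      then show ?thesis
        unfolding split even(1) odd(1) unfolding Q Q' H defs unfolding True by (simp only: if_True simp_thms)
    next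
      case False
      then have s: "s = - 1" using assms(3) by auto
      have H: "H = h'" by (simp add: H_def h'_def s)
      have "((cos M + \<i> * X) * G * h' * (- E * (1 * a)) - B * h' * (E' * (1 * a'))) * U
           + ((cos M + \<i> * X) * G * h' * (- E * (- 1 * b)) - B * h' * (E' * (- 1 * b'))) * V
         = (cos M - - 1 * \<i> * X) * G * h' * (- E * (a * U - b * V)) + - 1 * (B * h' * (E' * (a' * U - b' * V)))"
        by (simp add: algebra_simps)
      then show ?thesis
        using False unfolding split even(2) odd(2) unfolding Q Q' H defs unfolding s by (simp only: if_False)
    qed
  qed
  show ?thesis
    unfolding F goal M_def[symmetric] N_def[symmetric] MN 1 2 by simp
qed

end
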